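(* Let $\psi:\mathbb{R}\to\mathbb{R}$ be an even continuous strictly positive function that is monotone increasing for $x\ge0$, with $V_0=\int_{-\infty}^\infty e^{-\psi^2(t)}dt<\infty$ and $V_m=\int_{-\infty}^{\infty}(1+\psi^2(s))^m e^{-\psi^2(s)}ds<\infty$ for all $m\in\mathbb{N}$. Let $q\ge1$, $\alpha\in\{0,1\}$ and let $Y^{(\alpha,q)}_{N,c,R}$ be the random variable defined in the context. Then in each of the three asymptotic regimes ($i=1$: $cR\gg N$; $i=2$: $cR=sN$ with $s>0$ fixed; $i=3$: $cR\ll N$) of the limiting transition $N,c,R\to\infty$, $R=o(N)$, $c=o(N)$, the following convergence in distribution holds: $$\frac1{\sqrt{b^{(i)}_{N,c,R}}}\left(Y^{(\alpha,q)}_{N,c,R}-\mathbb{E}Y^{(\alpha,q)}_{N,c,R}\right)\to\chi^{(\alpha,i)},\qquad i=1,2,3,$$ where $$b^{(1)}_{N,c,R}=\frac{(cR)^{2q-1}}{N^{2q-2}},\qquad b^{(2)}_{N,c,R}=cR,\qquad b^{(3)}_{N,c,R}=cR,$$ and $\chi^{(\alpha,i)}$ is a centered normal random variable with variance $\phi_2^{(\alpha,i)}$ given by $$\phi_2^{(0,1)}=2q^2V_0^{2q-1},\quad \phi_2^{(1,1)}=2q^2V_1^{2q-2}V_2,\quad \phi_2^{(0,2)}=\Phi_2^{(q,2)}(s),\quad \phi_2^{(1,2)}=\Xi_2^{(q,2)}(s),\quad \phi_2^{(0,3)}=2V_0,\quad \phi_2^{(1,3)}=2V_{2q}.$$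
   Context: Let $N=2n+1$, $L_N=\{-n,\dots,n\}$, and let $c,R>0$ be parameters with $c\le N$. Let $a_{ij}=a_{ij}^{(N,c,R)}$, $-n\le i<j\le n$, be jointly independent random variables with values in $\{0,1\}$ and $P(a_{ij}=1)=\frac{c}{N}e^{-\psi^2((i-j)/R)}$; $\mathbb{E}$ is the corresponding expectation. For $\alpha\in\{0,1\}$ let $A^{(\alpha)}_{N,c,R}$ be the real symmetric $N\times N$ matrix (indexed by $L_N$) with zero diagonal and entries $\big(1+\alpha\psi^2(\tfrac{i-j}{R})\big)a_{ij}$ for $i<j$. Define $Y^{(\alpha,q)}_{N,c,R}=\sum_{i,j\in L_N}\big((A^{(\alpha)}_{N,c,R})^q\big)_{ij}$. The numbers $\Phi_2^{(q,2)}(s)$ and $\Xi_2^{(q,2)}(s)$ are the limits (which exist) of $\frac1{cR}\mathrm{Cum}_2(Y^{(0,q)}_{N,c,R})$ and $\frac1{cR}\mathrm{Cum}_2(Y^{(1,q)}_{N,c,R})$, respectively, as $N,c,R\to\infty$, $R=o(N)$, $c=o(N)$ with $cR/N=s$, where $\mathrm{Cum}_2$ is the second cumulant (variance). The notation $x\gg y$ ($x\ll y$) means $x/y\to\infty$ ($x/y\to0$) along the limiting transition. *)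

theory Defs
  imports
    "HOL-Probability.Probability"
    "HOL-Library.Landau_Symbols"
    "Jordan_Normal_Form.Matrix"
begin

definition V :: "(real \<Rightarrow> real) \<Rightarrow> nat \<Rightarrow> real" where
  "V \<psi> m = (LINT t|lborel. (1 + (\<psi> t)\<^sup>2) ^ m * exp (- (\<psi> t)\<^sup>2))"

definition dim_N :: "nat \<Rightarrow> nat" where
  "dim_N n = 2 * n + 1"

definition edges :: "nat \<Rightarrow> (int \<times> int) set" where
  "edges n = {(i, j). - int n \<le> i \<and> i < j \<and> j \<le> int n}"

definition edge_prob :: "(real \<Rightarrow> real) \<Rightarrow> nat \<Rightarrow> real \<Rightarrow> real \<Rightarrow> int \<times> int \<Rightarrow> real" where
  "edge_prob \<psi> n c R = (\<lambda>(i, j). c / real (dim_N n) * exp (- (\<psi> (real_of_int (i - j) / R))\<^sup>2))"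

definition edge_variables ::
  "'w measure \<Rightarrow> (real \<Rightarrow> real) \<Rightarrow> nat \<Rightarrow> real \<Rightarrow> real \<Rightarrow> (int \<Rightarrow> int \<Rightarrow> 'w \<Rightarrow> real) \<Rightarrow> bool" where
  "edge_variables M \<psi> n c R a \<longleftrightarrow>
     prob_space M \<and>
     prob_space.indep_vars M (\<lambda>_. borel) (\<lambda>(i, j). a i j) (edges n) \<and>
     (\<forall>(i, j) \<in> edges n.
        (\<forall>\<omega> \<in> space M. a i j \<omega> \<in> {0, 1}) \<and>
        measure M {\<omega> \<in> space M. a i j \<omega> = 1} = edge_prob \<psi> n c R (i, j))"

text \<open>
  Rows and columns of a \<^typ>\<open>real mat\<close> are numbered from \<open>0\<close>; row \<open>r\<close> stands for the element
  \<open>r - n\<close> of \<open>{-n..n}\<close>. Only the values \<open>a i j\<close> with \<open>(i, j) \<in> edges n\<close> are used.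
\<close>

definition weighted_adjacency ::
  "nat \<Rightarrow> (real \<Rightarrow> real) \<Rightarrow> nat \<Rightarrow> real \<Rightarrow> (int \<Rightarrow> int \<Rightarrow> real) \<Rightarrow> real mat" where
  "weighted_adjacency \<alpha> \<psi> n R a =
     (let w = (\<lambda>i j. (1 + real \<alpha> * (\<psi> (real_of_int (i - j) / R))\<^sup>2) * a i j)
      in mat (dim_N n) (dim_N n) (\<lambda>(r, s).
           let i = int r - int n; j = int s - int n
           in if i < j then w i j else if j < i then w j i else 0))"

definition Y ::
  "nat \<Rightarrow> nat \<Rightarrow> (real \<Rightarrow> real) \<Rightarrow> nat \<Rightarrow> real \<Rightarrow> (int \<Rightarrow> int \<Rightarrow> real) \<Rightarrow> real" where
  "Y \<alpha> q \<psi> n R a =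
     (\<Sum>r<dim_N n. \<Sum>s<dim_N n. (weighted_adjacency \<alpha> \<psi> n R a ^\<^sub>m q) $$ (r, s))"

definition limiting_transition :: "(nat \<Rightarrow> nat) \<Rightarrow> (nat \<Rightarrow> real) \<Rightarrow> (nat \<Rightarrow> real) \<Rightarrow> bool" where
  "limiting_transition n c R \<longleftrightarrow>
     (\<forall>k. 0 < c k \<and> c k \<le> real (dim_N (n k)) \<and> 0 < R k) \<and>
     filterlim n at_top sequentially \<and>
     filterlim c at_top sequentially \<and>
     filterlim R at_top sequentially \<and>
     R \<in> o(\<lambda>k. real (dim_N (n k))) \<and>
     c \<in> o(\<lambda>k. real (dim_N (n k)))"

text \<open>
  The second cumulant depends only on the joint law of the edge variables, so the limiting
  cumulants are defined in the canonical model: independent Bernoulli variables indexed by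
  \<open>edges n\<close>.
\<close>

definition edge_pmf :: "(real \<Rightarrow> real) \<Rightarrow> nat \<Rightarrow> real \<Rightarrow> real \<Rightarrow> (int \<times> int \<Rightarrow> bool) pmf" where
  "edge_pmf \<psi> n c R = Pi_pmf (edges n) False (\<lambda>e. bernoulli_pmf (edge_prob \<psi> n c R e))"

lemma edge_variables_edge_pmf:
  assumes "0 < c" "c \<le> real (dim_N n)"
  shows "edge_variables (measure_pmf (edge_pmf \<psi> n c R)) \<psi> n c R (\<lambda>i j g. of_bool (g (i, j)))"
proof -
  have "edges n \<subseteq> {- int n..int n} \<times> {- int n..int n}"
    by (auto simp: edges_def)
  then have fin: "finite (edges n)"
    by (rule finite_subset) simp
  have p: "0 \<le> edge_prob \<psi> n c R e" "edge_prob \<psi> n c R e \<le> 1" for e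
  proof -
    have "c / real (dim_N n) * exp (- x\<^sup>2) \<le> 1 * 1" for x :: real
      using assms by (intro mult_mono) (auto simp: dim_N_def)
    then show "0 \<le> edge_prob \<psi> n c R e" "edge_prob \<psi> n c R e \<le> 1"
      using assms by (auto simp: edge_prob_def split: prod.split)
  qed
  have ind: "prob_space.indep_vars (measure_pmf (edge_pmf \<psi> n c R)) (\<lambda>_. borel)
      (\<lambda>e g. of_bool (g e) :: real) (edges n)"
    unfolding edge_pmf_def
    by (rule prob_space.indep_vars_compose2[OF measure_pmf.prob_space_axioms indep_vars_Pi_pmf[OF fin]]) simp
  have "measure (measure_pmf (edge_pmf \<psi> n c R)) {g. of_bool (g e) = (1::real)}
      = edge_prob \<psi> n c R e" if "e \<in> edges n" for e
  proof -
    have "measure (measure_pmf (edge_pmf \<psi> n c R)) {g. of_bool (g e) = (1::real)}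
        = measure (measure_pmf (map_pmf (\<lambda>g. g e) (edge_pmf \<psi> n c R))) {True}"
      by (simp add: vimage_def)
    also have "\<dots> = edge_prob \<psi> n c R e"
      using p that by (simp add: edge_pmf_def Pi_pmf_component fin measure_pmf_single)
    finally show ?thesis .
  qed
  then show ?thesis
    using ind by (auto simp: edge_variables_def measure_pmf.prob_space_axioms case_prod_beta')
qed

definition Cum2_Y :: "nat \<Rightarrow> nat \<Rightarrow> (real \<Rightarrow> real) \<Rightarrow> nat \<Rightarrow> real \<Rightarrow> real \<Rightarrow> real" where
  "Cum2_Y \<alpha> q \<psi> n c R =
     measure_pmf.variance (edge_pmf \<psi> n c R) (\<lambda>g. Y \<alpha> q \<psi> n R (\<lambda>i j. of_bool (g (i, j))))"

definition Cum2_limit :: "nat \<Rightarrow> nat \<Rightarrow> (real \<Rightarrow> real) \<Rightarrow> real \<Rightarrow> real" where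
  "Cum2_limit \<alpha> q \<psi> s =
     (THE L. \<forall>n c R. limiting_transition n c R \<longrightarrow>
        (\<forall>k. c k * R k / real (dim_N (n k)) = s) \<longrightarrow>
        (\<lambda>k. Cum2_Y \<alpha> q \<psi> (n k) (c k) (R k) / (c k * R k)) \<longlonglongrightarrow> L)"

definition Phi2 :: "nat \<Rightarrow> (real \<Rightarrow> real) \<Rightarrow> real \<Rightarrow> real" where
  "Phi2 q \<psi> s = Cum2_limit 0 q \<psi> s"

definition Xi2 :: "nat \<Rightarrow> (real \<Rightarrow> real) \<Rightarrow> real \<Rightarrow> real" where
  "Xi2 q \<psi> s = Cum2_limit 1 q \<psi> s"

text \<open>Meaningful for \<open>v > 0\<close> only: \<^const>\<open>normal_density\<close> vanishes for standard deviation \<open>0\<close>.\<close>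

definition centered_normal :: "real \<Rightarrow> real measure" where
  "centered_normal v = density lborel (normal_density 0 (sqrt v))"

definition converges_to_centered_normal ::
  "(nat \<Rightarrow> 'w measure) \<Rightarrow> (nat \<Rightarrow> 'w \<Rightarrow> real) \<Rightarrow> (nat \<Rightarrow> real) \<Rightarrow> real \<Rightarrow> bool" where
  "converges_to_centered_normal M X b v \<longleftrightarrow>
     weak_conv_m
       (\<lambda>k. distr (M k) borel
          (\<lambda>\<omega>. (X k \<omega> - prob_space.expectation (M k) (X k)) / sqrt (b k)))
       (centered_normal v)"

end

theory Submission
  imports Defs
begin

text \<open>
  Write \<open>Y\<close> as a sum, over all walks \<open>u\<close> of length \<open>q\<close>, of a weight times the product of the edge
  variables along \<open>u\<close>; two summands are independent unless the walks share an edge. Stein's equation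
  for the characteristic function then gives a normal approximation whose error is a sum over triples
  of walks chained by common edges, while the variance is a sum over pairs sharing an edge. Both sums
  are organised by the coincidence pattern of the vertices of the walks. A pattern with \<open>v\<close> vertices
  is a connected graph; if it is a tree its contribution is asymptotic to \<open>N (c R / N) ^ (v - 1)\<close>
  times a product of moments \<open>V\<close>, one for each edge, and every additional edge costs a
  factor \<open>c / N\<close>, which tends to zero. So with \<open>D = c R / N\<close> the variance is of order
  \<open>N (D + D ^ (2 q - 1))\<close>, the triples contribute at most \<open>N (D + D ^ (3 q - 2))\<close>, and their ratio
  to the cubed standard deviation vanishes because \<open>c R\<close> tends to infinity. In the dense regime only
  the \<open>2 q\<^sup>2\<close> pairs of paths with exactly one common edge survive, in the sparse regime only the two
  patterns that run along a single edge. For \<open>\<alpha> \<in> {0, 1}\<close> the weights satisfy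
  \<open>1 + \<alpha> \<psi>\<^sup>2 = (1 + \<psi>\<^sup>2) ^ \<alpha>\<close>, so both cases are treated at once.
\<close>

section \<open>Dissociated sums\<close>

text \<open>Stein's equation is preferred to computing cumulants of every order because it leaves
  only pairs and triples of walks to be counted. Two obstacles shape the counting. The index segment
  has ends, where the row sums of the kernel are smaller than in the bulk. The limit over trees is
  therefore built on two inputs only, an upper bound valid for every row and the limit of the
  average row; with equal limits they force the average deficit of the rows to vanish. The other
  obstacle is that one argument should serve all regimes of \<open>D\<close>. The largest orders of
  pairs and triples are tied by the identity \<open>(N * D ^ (3 * q - 2)) ^ 2 * (N * D) = (N * D ^
  (2 * q - 1)) ^ 3\<close>, and the smallest ones by the trivial identity
  \<open>(N * D) ^ 2 * (N * D) = (N * D) ^ 3\<close>. Since \<open>N * D\<close> is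
  \<open>c * R\<close>, the normalised triple sum is in both cases of order
  \<open>1 / sqrt (c * R)\<close>. Finally \<open>Phi2\<close> and \<open>Xi2\<close> are definite
  descriptions, so identifying them requires, besides the limit itself, one limiting transition with
  the prescribed ratio.\<close>

text \<open>Every variable that occurs is a polynomial in finitely many 0/1 variables, or is
  obtained from such polynomials by absolute values and unimodular exponentials, so boundedness is
  all the integrability needed. The bound is asked for on \<open>space M\<close> only, because the
  edge variables are known to be 0 or 1 only there.\<close>

definition bounded_rv :: "'a measure \<Rightarrow> ('a \<Rightarrow> 'b::{real_normed_field, second_countable_topology, banach}) \<Rightarrow> bool" where
  "bounded_rv M X \<longleftrightarrow> X \<in> borel_measurable M \<and> (\<exists>B. \<forall>\<omega>\<in>space M. norm (X \<omega>) \<le> B)"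

named_theorems bounded_rv_intros

lemma bounded_rvD: "bounded_rv M X \<Longrightarrow> X \<in> borel_measurable M"
  by (simp add: bounded_rv_def)

lemma bounded_rv_const [bounded_rv_intros]: "bounded_rv M (\<lambda>_. c)"
  by (auto simp: bounded_rv_def)

lemma bounded_rv_add [bounded_rv_intros]:
  assumes "bounded_rv M X" "bounded_rv M Z"
  shows "bounded_rv M (\<lambda>\<omega>. X \<omega> + Z \<omega>)"
proof -
  obtain B C where "\<forall>\<omega>\<in>space M. norm (X \<omega>) \<le> B" "\<forall>\<omega>\<in>space M. norm (Z \<omega>) \<le> C"
    using assms by (auto simp: bounded_rv_def)
  then have "\<forall>\<omega>\<in>space M. norm (X \<omega> + Z \<omega>) \<le> B + C"
    by (auto intro!: norm_triangle_le add_mono)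
  then show ?thesis using assms by (auto simp: bounded_rv_def)
qed

lemma bounded_rv_mult [bounded_rv_intros]:
  assumes "bounded_rv M X" "bounded_rv M Z"
  shows "bounded_rv M (\<lambda>\<omega>. X \<omega> * Z \<omega>)"
proof -
  obtain B C where BC: "\<forall>\<omega>\<in>space M. norm (X \<omega>) \<le> B" "\<forall>\<omega>\<in>space M. norm (Z \<omega>) \<le> C"
    using assms by (auto simp: bounded_rv_def)
  have "\<forall>\<omega>\<in>space M. norm (X \<omega> * Z \<omega>) \<le> B * C"
  proof
    fix \<omega> assume w: "\<omega> \<in> space M"
    have "norm (X \<omega>) * norm (Z \<omega>) \<le> B * C"
      using w BC by (intro mult_mono) (auto intro: order_trans[OF norm_ge_zero])
    then show "norm (X \<omega> * Z \<omega>) \<le> B * C" by (simp add: norm_mult)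
  qed
  then show ?thesis using assms by (auto simp: bounded_rv_def)
qed

lemma bounded_rv_uminus [bounded_rv_intros]:
  "bounded_rv M X \<Longrightarrow> bounded_rv M (\<lambda>\<omega>. - X \<omega>)"
  using bounded_rv_mult[OF bounded_rv_const[of M "-1"], of X] by simp

lemma bounded_rv_diff [bounded_rv_intros]:
  "bounded_rv M X \<Longrightarrow> bounded_rv M Z \<Longrightarrow> bounded_rv M (\<lambda>\<omega>. X \<omega> - Z \<omega>)"
  using bounded_rv_add[of M X "\<lambda>\<omega>. - Z \<omega>"] bounded_rv_uminus[of M Z] by simp

lemma bounded_rv_divide [bounded_rv_intros]:
  "bounded_rv M X \<Longrightarrow> bounded_rv M (\<lambda>\<omega>. X \<omega> / c)"
  using bounded_rv_mult[OF _ bounded_rv_const[of M "inverse c"], of X] by (simp add: divide_inverse)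

lemma bounded_rv_power [bounded_rv_intros]:
  "bounded_rv M X \<Longrightarrow> bounded_rv M (\<lambda>\<omega>. X \<omega> ^ k)"
  by (induction k) (auto intro: bounded_rv_intros)

lemma bounded_rv_sum [bounded_rv_intros]:
  "(\<And>i. i \<in> A \<Longrightarrow> bounded_rv M (X i)) \<Longrightarrow> bounded_rv M (\<lambda>\<omega>. \<Sum>i\<in>A. X i \<omega>)"
  by (induction A rule: infinite_finite_induct) (auto intro: bounded_rv_intros)

lemma bounded_rv_prod [bounded_rv_intros]:
  "(\<And>i. i \<in> A \<Longrightarrow> bounded_rv M (X i)) \<Longrightarrow> bounded_rv M (\<lambda>\<omega>. \<Prod>i\<in>A. X i \<omega>)"
  by (induction A rule: infinite_finite_induct) (auto intro: bounded_rv_intros)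

lemma bounded_rv_norm [bounded_rv_intros]:
  "bounded_rv M X \<Longrightarrow> bounded_rv M (\<lambda>\<omega>. norm (X \<omega>))"
  by (auto simp: bounded_rv_def)

lemma bounded_rv_abs [bounded_rv_intros]:
  "bounded_rv M (X :: _ \<Rightarrow> real) \<Longrightarrow> bounded_rv M (\<lambda>\<omega>. \<bar>X \<omega>\<bar>)"
  using bounded_rv_norm[of M X] by simp

lemma bounded_rv_of_real [bounded_rv_intros]:
  "bounded_rv M X \<Longrightarrow> bounded_rv M (\<lambda>\<omega>. complex_of_real (X \<omega>))"
  by (auto simp: bounded_rv_def)

lemma bounded_rv_iexp [bounded_rv_intros]:
  "bounded_rv M X \<Longrightarrow> bounded_rv M (\<lambda>\<omega>. iexp (X \<omega>))"
  by (auto simp: bounded_rv_def intro!: exI[of _ 1])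

lemma bounded_rv_scaleR [bounded_rv_intros]:
  "bounded_rv M (X :: _ \<Rightarrow> complex) \<Longrightarrow> bounded_rv M (\<lambda>\<omega>. c *\<^sub>R X \<omega>)"
  unfolding scaleR_conv_of_real by (intro bounded_rv_intros)

lemma (in prob_space) integrable_bounded_rv:
  "bounded_rv M X \<Longrightarrow> integrable M X"
  unfolding bounded_rv_def by (auto intro!: integrable_const_bound AE_I2)

section \<open>Exponential estimates and the differential equation of a characteristic
  function\<close>

lemma norm_iexp_diff_le: "cmod (iexp x - iexp y) \<le> \<bar>x - y\<bar>"
proof -
  have "iexp x - iexp y = iexp y * (iexp (x - y) - 1)"
    by (simp add: exp_diff algebra_simps)
  then have "cmod (iexp x - iexp y) = cmod (iexp (x - y) - 1)"
    by (simp add: norm_mult)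
  also have "\<dots> \<le> \<bar>x - y\<bar>" using iexp_approx1[of "x - y" 0] by simp
  finally show ?thesis .
qed

lemma norm_iexp_approx1: "cmod (iexp x - 1 - \<i> * x) \<le> x\<^sup>2 / 2"
  using iexp_approx1[of x 1] by (simp add: power2_eq_square algebra_simps)

context prob_space
begin

text \<open>The remainder of the first-order expansion of \<open>iexp\<close> is at most the square
  of its argument, so the difference quotient misses the claimed derivative by at most
  \<open>\<bar>y - t\<bar>\<close> times the second moment of \<open>W\<close>. The explicit bound
  takes the place of differentiation under the integral by dominated convergence.\<close>

lemma char_bounded_rv_derivative:
  assumes W: "bounded_rv M W"
  shows "((\<lambda>t. expectation (\<lambda>\<omega>. iexp (t * W \<omega>))) has_vector_derivative
      \<i> * expectation (\<lambda>\<omega>. of_real (W \<omega>) * iexp (t * W \<omega>))) (at t)"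
proof -
  let ?f = "\<lambda>t. expectation (\<lambda>\<omega>. iexp (t * W \<omega>))"
  let ?D = "\<i> * expectation (\<lambda>\<omega>. of_real (W \<omega>) * iexp (t * W \<omega>))"
  define C where "C = expectation (\<lambda>\<omega>. (W \<omega>)\<^sup>2)"
  note [intro!] = integrable_bounded_rv bounded_rv_intros W
  have bound: "cmod (?f y - ?f t - (y - t) *\<^sub>R ?D) \<le> (y - t)\<^sup>2 * C" for y
  proof -
    have eq: "?f y - ?f t - (y - t) *\<^sub>R ?D = expectation (\<lambda>\<omega>. iexp (y * W \<omega>) - iexp (t * W \<omega>)
        - (y - t) *\<^sub>R (\<i> * (of_real (W \<omega>) * iexp (t * W \<omega>))))"
    proof -
      have 1: "integrable M (\<lambda>\<omega>. iexp (y * W \<omega>))" "integrable M (\<lambda>\<omega>. iexp (t * W \<omega>))"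
        "integrable M (\<lambda>\<omega>. of_real (W \<omega>) * iexp (t * W \<omega>))"
        by (intro integrable_bounded_rv bounded_rv_intros W)+
      show ?thesis using 1 by simp
    qed
    have pt: "cmod (iexp (y * W \<omega>) - iexp (t * W \<omega>) - (y - t) *\<^sub>R (\<i> * (of_real (W \<omega>) * iexp (t * W \<omega>))))
       \<le> (y - t)\<^sup>2 * (W \<omega>)\<^sup>2" for \<omega>
    proof -
      have "iexp (y * W \<omega>) - iexp (t * W \<omega>) - (y - t) *\<^sub>R (\<i> * (of_real (W \<omega>) * iexp (t * W \<omega>)))
        = iexp (t * W \<omega>) * (iexp ((y - t) * W \<omega>) - 1 - \<i> * of_real ((y - t) * W \<omega>))"
      proof -
        have "iexp (y * W \<omega>) = iexp (t * W \<omega>) * iexp ((y - t) * W \<omega>)"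
          by (simp add: exp_add[symmetric] algebra_simps)
        then show ?thesis by (simp add: algebra_simps scaleR_conv_of_real)
      qed
      then have "cmod (iexp (y * W \<omega>) - iexp (t * W \<omega>) - (y - t) *\<^sub>R (\<i> * (of_real (W \<omega>) * iexp (t * W \<omega>))))
        = cmod (iexp ((y - t) * W \<omega>) - 1 - \<i> * of_real ((y - t) * W \<omega>))"
        by (simp only: norm_mult norm_exp_i_times mult_1)
      also have "\<dots> \<le> ((y - t) * W \<omega>)\<^sup>2 / 2" by (rule norm_iexp_approx1)
      also have "\<dots> \<le> (y - t)\<^sup>2 * (W \<omega>)\<^sup>2" by (simp add: power_mult_distrib)
      finally show ?thesis .
    qed
    have "cmod (?f y - ?f t - (y - t) *\<^sub>R ?D) \<le> expectation (\<lambda>\<omega>. (y - t)\<^sup>2 * (W \<omega>)\<^sup>2)"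
      unfolding eq by (rule order_trans[OF integral_norm_bound])
        (intro integral_mono pt integrable_bounded_rv bounded_rv_intros W bounded_rv_scaleR)
    then show ?thesis by (simp add: C_def)
  qed
  have "((\<lambda>y. (?f y - ?f t - (y - t) *\<^sub>R ?D) /\<^sub>R norm (y - t)) \<longlongrightarrow> 0) (at t)"
  proof (rule Lim_null_comparison)
    show "\<forall>\<^sub>F y in at t. norm ((?f y - ?f t - (y - t) *\<^sub>R ?D) /\<^sub>R norm (y - t)) \<le> \<bar>y - t\<bar> * C"
    proof (rule eventually_mono[OF eventually_at_ball[of 1 t UNIV]])
      fix y assume "y \<in> ball t 1 \<and> y \<in> UNIV"
      have "cmod (?f y - ?f t - (y - t) *\<^sub>R ?D) / \<bar>y - t\<bar> \<le> \<bar>y - t\<bar> * C"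
      proof (cases "y = t")
        case False
        have eq: "(y - t)\<^sup>2 * C = \<bar>y - t\<bar> * C * \<bar>y - t\<bar>" by (simp add: power2_eq_square)
        have pos: "0 < \<bar>y - t\<bar>" using False by simp
        show ?thesis unfolding pos_divide_le_eq[OF pos] using bound[of y] unfolding eq .
      qed simp
      then show "norm ((?f y - ?f t - (y - t) *\<^sub>R ?D) /\<^sub>R norm (y - t)) \<le> \<bar>y - t\<bar> * C"
        by (simp add: divide_inverse mult.commute)
    qed simp
    have "((\<lambda>y. \<bar>y - t\<bar> * C) \<longlongrightarrow> \<bar>t - t\<bar> * C) (at t)" by (intro tendsto_intros)
    then show "((\<lambda>y. \<bar>y - t\<bar> * C) \<longlongrightarrow> 0) (at t)" by simp
  qed
  then show ?thesis
    unfolding has_vector_derivative_def has_derivative_at_within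
    by (auto intro!: bounded_linear_intros)
qed

end

text \<open>The integrating factor \<open>exp (v * s\<^sup>2 / 2)\<close> turns the approximate
  equation f' = - v s f into a bound on the derivative of \<open>g\<close>. The mean value
  inequality on the segment from 0 to t costs at most \<open>exp (v * t\<^sup>2 / 2)\<close>, which
  cancels when the factor is removed; hence the final error is free of \<open>v\<close>.\<close>

lemma gaussian_ode_bound:
  fixes f f' :: "real \<Rightarrow> complex" and v \<epsilon> :: real
  assumes f0: "f 0 = 1" and \<epsilon>: "0 \<le> \<epsilon>" and v: "0 \<le> v"
    and der: "\<And>t. (f has_vector_derivative f' t) (at t)"
    and bd: "\<And>t. cmod (f' t + of_real (v * t) * f t) \<le> t\<^sup>2 * \<epsilon>"
  shows "cmod (f t - exp (- of_real (v * t\<^sup>2 / 2))) \<le> \<bar>t\<bar> ^ 3 * \<epsilon>"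
proof -
  define g where "g s = f s * of_real (exp (v * s\<^sup>2 / 2))" for s
  define g' where "g' s = (f' s + of_real (v * s) * f s) * of_real (exp (v * s\<^sup>2 / 2))" for s
  have "(g has_vector_derivative g' s) (at s within S)" for s S
  proof -
    have "((\<lambda>s. exp (v * s\<^sup>2 / 2)) has_real_derivative (v * s) * exp (v * s\<^sup>2 / 2)) (at s within S)"
      by (auto intro!: derivative_eq_intros)
    then have "((\<lambda>s. complex_of_real (exp (v * s\<^sup>2 / 2))) has_vector_derivative of_real ((v * s) * exp (v * s\<^sup>2 / 2))) (at s within S)"
      by (intro has_vector_derivative_of_real) (simp add: has_real_derivative_iff_has_vector_derivative)
    from has_vector_derivative_mult[OF has_vector_derivative_at_within[OF der[of s], of S] this]
    show ?thesis unfolding g_def g'_def by (simp add: algebra_simps)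
  qed
  then have gd: "(g has_derivative (\<lambda>h. h *\<^sub>R g' s)) (at s within S)" for s S
    by (simp add: has_vector_derivative_def)
  have "norm (g t - g 0) \<le> (t\<^sup>2 * \<epsilon> * exp (v * t\<^sup>2 / 2)) * norm (t - 0)"
  proof (rule differentiable_bound[where S = "closed_segment 0 t"])
    show "(g has_derivative (\<lambda>h. h *\<^sub>R g' s)) (at s within closed_segment 0 t)" for s by (rule gd)
    fix s assume "s \<in> closed_segment 0 t"
    then have s: "\<bar>s\<bar> \<le> \<bar>t\<bar>" by (auto simp: closed_segment_eq_real_ivl split: if_splits)
    then have s2: "s\<^sup>2 \<le> t\<^sup>2" by (simp add: abs_le_square_iff)
    have "norm (g' s) \<le> (s\<^sup>2 * \<epsilon>) * exp (v * s\<^sup>2 / 2)"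
      unfolding g'_def norm_mult using bd[of s] \<epsilon> by (intro mult_mono) auto
    also have "\<dots> \<le> (t\<^sup>2 * \<epsilon>) * exp (v * t\<^sup>2 / 2)"
      using s2 \<epsilon> v by (intro mult_mono) (auto intro: mult_left_mono)
    finally have "norm (g' s) \<le> t\<^sup>2 * \<epsilon> * exp (v * t\<^sup>2 / 2)" .
    then show "onorm (\<lambda>h. h *\<^sub>R g' s) \<le> t\<^sup>2 * \<epsilon> * exp (v * t\<^sup>2 / 2)"
      by (intro onorm_le) (simp add: mult.commute[of _ "norm _"] mult_right_mono)
  qed auto
  then have *: "cmod (g t - 1) \<le> \<bar>t\<bar> ^ 3 * \<epsilon> * exp (v * t\<^sup>2 / 2)"
    by (simp add: g_def f0 power3_eq_cube power2_eq_square mult_ac)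
  have "f t - exp (- of_real (v * t\<^sup>2 / 2)) = (g t - 1) * of_real (exp (- (v * t\<^sup>2 / 2)))"
    unfolding g_def by (simp add: algebra_simps exp_of_real[symmetric] exp_minus exp_diff)
  then have "cmod (f t - exp (- of_real (v * t\<^sup>2 / 2))) = cmod (g t - 1) * exp (- (v * t\<^sup>2 / 2))"
    by (simp add: norm_mult)
  also have "\<dots> \<le> (\<bar>t\<bar> ^ 3 * \<epsilon> * exp (v * t\<^sup>2 / 2)) * exp (- (v * t\<^sup>2 / 2))"
    using * by (intro mult_right_mono) auto
  also have "\<dots> = \<bar>t\<bar> ^ 3 * \<epsilon>" by (simp add: exp_minus)
  finally show ?thesis .
qed

text \<open>
  Stein's equation for the characteristic function: each summand is independent of the sum over
  the complement of its neighbourhood, and likewise for pairs of neighbouring summands.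
\<close>

lemma (in prob_space) char_dissociated_sum_bound:
  fixes X :: "'i \<Rightarrow> 'a \<Rightarrow> real" and Nb :: "'i \<Rightarrow> 'i set"
  assumes fin: "finite I"
    and X: "\<And>i. i \<in> I \<Longrightarrow> bounded_rv M (X i)"
    and Nb: "\<And>i. i \<in> I \<Longrightarrow> Nb i \<subseteq> I"
    and ind1: "\<And>i t. i \<in> I \<Longrightarrow>
      expectation (\<lambda>\<omega>. of_real (X i \<omega>) * iexp (t * (\<Sum>j\<in>I - Nb i. X j \<omega>))) = 0"
    and ind2: "\<And>i j t. i \<in> I \<Longrightarrow> j \<in> Nb i \<Longrightarrow>
      expectation (\<lambda>\<omega>. of_real (X i \<omega> * X j \<omega>) * iexp (t * (\<Sum>l\<in>I - (Nb i \<union> Nb j). X l \<omega>))) =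
      of_real (expectation (\<lambda>\<omega>. X i \<omega> * X j \<omega>)) * expectation (\<lambda>\<omega>. iexp (t * (\<Sum>l\<in>I - (Nb i \<union> Nb j). X l \<omega>)))"
    and v: "(\<Sum>i\<in>I. \<Sum>j\<in>Nb i. expectation (\<lambda>\<omega>. X i \<omega> * X j \<omega>)) = v" "0 \<le> v"
    and \<epsilon>: "(\<Sum>i\<in>I. \<Sum>j\<in>Nb i. \<Sum>l\<in>Nb i \<union> Nb j. expectation (\<lambda>\<omega>. \<bar>X i \<omega> * X j \<omega> * X l \<omega>\<bar>)
        + expectation (\<lambda>\<omega>. \<bar>X i \<omega> * X j \<omega>\<bar>) * expectation (\<lambda>\<omega>. \<bar>X l \<omega>\<bar>)) \<le> \<epsilon>"
  shows "cmod (expectation (\<lambda>\<omega>. iexp (t * (\<Sum>i\<in>I. X i \<omega>))) - exp (- of_real (v * t\<^sup>2 / 2))) \<le> \<bar>t\<bar> ^ 3 * \<epsilon>"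
proof (rule gaussian_ode_bound)
  define W where "W \<omega> = (\<Sum>i\<in>I. X i \<omega>)" for \<omega>
  define \<phi> where "\<phi> t = expectation (\<lambda>\<omega>. iexp (t * W \<omega>))" for t
  have bW: "bounded_rv M W" unfolding W_def using X by (intro bounded_rv_intros)
  have NbI: "j \<in> I" if "i \<in> I" "j \<in> Nb i" for i j using Nb that by blast
  have finNb: "finite (Nb i)" if "i \<in> I" for i using Nb[OF that] fin finite_subset by blast
  note bI = bounded_rv_intros X bW
  note iI = integrable_bounded_rv
  show "expectation (\<lambda>\<omega>. iexp (0 * (\<Sum>i\<in>I. X i \<omega>))) = 1" by (simp add: prob_space)
  show "((\<lambda>t. expectation (\<lambda>\<omega>. iexp (t * (\<Sum>i\<in>I. X i \<omega>)))) has_vector_derivative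
      \<i> * expectation (\<lambda>\<omega>. of_real (W \<omega>) * iexp (t * W \<omega>))) (at t)" for t
    using char_bounded_rv_derivative[OF bW, of t] unfolding W_def .
  show "0 \<le> v" by (rule v(2))
  let ?c = "\<lambda>i j. expectation (\<lambda>\<omega>. X i \<omega> * X j \<omega>)"
  let ?E3 = "\<lambda>i j l. expectation (\<lambda>\<omega>. \<bar>X i \<omega> * X j \<omega> * X l \<omega>\<bar>)"
  let ?E21 = "\<lambda>i j l. expectation (\<lambda>\<omega>. \<bar>X i \<omega> * X j \<omega>\<bar>) * expectation (\<lambda>\<omega>. \<bar>X l \<omega>\<bar>)"
  have E3: "0 \<le> ?E3 i j l" for i j l by (intro integral_nonneg_AE) auto
  have E21: "0 \<le> ?E21 i j l" for i j l by (intro mult_nonneg_nonneg integral_nonneg_AE) auto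
  show "0 \<le> \<epsilon>" by (rule order_trans[OF _ \<epsilon>]) (intro sum_nonneg add_nonneg_nonneg E3 E21)
  fix t :: real
  \<comment> \<open>Three errors arise for each summand: expanding the exponential over the
    neighbourhood of \<open>i\<close>, deleting the rest of the neighbourhood of \<open>j\<close>
    from the exponent, and restoring the full sum after \<open>X i * X j\<close> has been separated.
    The first two produce the \<open>?E3\<close> terms, the last one the \<open>?E21\<close>
    terms.\<close>
  have main: "cmod (expectation (\<lambda>\<omega>. of_real (X i \<omega>) * iexp (t * W \<omega>))
      - \<i> * t * (\<Sum>j\<in>Nb i. of_real (?c i j)) * \<phi> t)
      \<le> t\<^sup>2 * (\<Sum>j\<in>Nb i. \<Sum>l\<in>Nb i \<union> Nb j. ?E3 i j l + ?E21 i j l)" if i: "i \<in> I" for i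
  proof -
    define Wi where "Wi \<omega> = (\<Sum>j\<in>I - Nb i. X j \<omega>)" for \<omega>
    define Z where "Z \<omega> = (\<Sum>j\<in>Nb i. X j \<omega>)" for \<omega>
    have WZ: "W \<omega> = Wi \<omega> + Z \<omega>" for \<omega>
      unfolding W_def Wi_def Z_def using sum.subset_diff[OF Nb[OF i] fin] by blast
    let ?e = "\<lambda>j. expectation (\<lambda>\<omega>. of_real (X i \<omega> * X j \<omega>) * iexp (t * Wi \<omega>))"
    have bWi: "bounded_rv M Wi" unfolding Wi_def by (intro bI) auto
    have bZ: "bounded_rv M Z" unfolding Z_def by (intro bI) (use NbI i in auto)
    note bI = bI bWi bZ
    \<comment> \<open>Remainder of the first-order expansion in \<open>t * Z\<close>. The constant
      term vanishes by \<open>ind1\<close>, and the linear term supplies the products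
      \<open>X i * X j\<close>.\<close>
    define err where "err \<omega> = of_real (X i \<omega>) * (iexp (t * Wi \<omega>) * (iexp (t * Z \<omega>) - 1 - \<i> * of_real (t * Z \<omega>)))" for \<omega>
    have berr: "bounded_rv M err" unfolding err_def by (intro bI i)
    have split: "of_real (X i \<omega>) * iexp (t * W \<omega>) = of_real (X i \<omega>) * iexp (t * Wi \<omega>)
       + \<i> * t * (\<Sum>j\<in>Nb i. of_real (X i \<omega> * X j \<omega>) * iexp (t * Wi \<omega>)) + err \<omega>" for \<omega>
    proof -
      have "iexp (t * W \<omega>) = iexp (t * Wi \<omega>) * iexp (t * Z \<omega>)"
        unfolding WZ by (simp add: exp_add[symmetric] algebra_simps)
      moreover have "(\<Sum>j\<in>Nb i. of_real (X i \<omega> * X j \<omega>) * iexp (t * Wi \<omega>)) = of_real (X i \<omega> * Z \<omega>) * iexp (t * Wi \<omega>)"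
        unfolding Z_def by (simp add: sum_distrib_left sum_distrib_right)
      ultimately show ?thesis unfolding err_def by (simp add: algebra_simps)
    qed
    have b1: "bounded_rv M (\<lambda>\<omega>. of_real (X i \<omega> * X j \<omega>) * iexp (t * Wi \<omega>))" if "j \<in> Nb i" for j
      using NbI[OF i that] i by (intro bI)
    have "expectation (\<lambda>\<omega>. of_real (X i \<omega>) * iexp (t * W \<omega>)) =
       expectation (\<lambda>\<omega>. of_real (X i \<omega>) * iexp (t * Wi \<omega>))
       + expectation (\<lambda>\<omega>. \<i> * t * (\<Sum>j\<in>Nb i. of_real (X i \<omega> * X j \<omega>) * iexp (t * Wi \<omega>))) + expectation err"
    proof -
      have 1: "integrable M (\<lambda>\<omega>. of_real (X i \<omega>) * iexp (t * Wi \<omega>))" by (intro iI bI i)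
      have 2: "integrable M (\<lambda>\<omega>. \<i> * t * (\<Sum>j\<in>Nb i. of_real (X i \<omega> * X j \<omega>) * iexp (t * Wi \<omega>)))"
        by (intro iI bounded_rv_mult bounded_rv_const bounded_rv_sum b1)
      show ?thesis unfolding split
        using Bochner_Integration.integral_add[OF Bochner_Integration.integrable_add[OF 1 2] iI[OF berr]]
          Bochner_Integration.integral_add[OF 1 2] by simp
    qed
    also have "expectation (\<lambda>\<omega>. of_real (X i \<omega>) * iexp (t * Wi \<omega>)) = 0"
      unfolding Wi_def using ind1[OF i] .
    also have "expectation (\<lambda>\<omega>. \<i> * t * (\<Sum>j\<in>Nb i. of_real (X i \<omega> * X j \<omega>) * iexp (t * Wi \<omega>))) =
      \<i> * t * (\<Sum>j\<in>Nb i. ?e j)"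
      unfolding integral_mult_right_zero
      by (subst Bochner_Integration.integral_sum) (intro iI b1, simp_all)
    finally have eq: "expectation (\<lambda>\<omega>. of_real (X i \<omega>) * iexp (t * W \<omega>))
       - \<i> * t * (\<Sum>j\<in>Nb i. of_real (?c i j)) * \<phi> t =
       \<i> * t * (\<Sum>j\<in>Nb i. ?e j
           - of_real (?c i j) * \<phi> t) + expectation err"
      unfolding sum_subtractf sum_distrib_right[symmetric] by (simp add: algebra_simps)
    have errb: "cmod (expectation err) \<le> t\<^sup>2 * (\<Sum>j\<in>Nb i. \<Sum>l\<in>Nb i. ?E3 i j l)"
    proof -
      have "cmod (err \<omega>) \<le> t\<^sup>2 * (\<Sum>j\<in>Nb i. \<Sum>l\<in>Nb i. \<bar>X i \<omega> * X j \<omega> * X l \<omega>\<bar>)" for \<omega>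
      proof -
        have "cmod (err \<omega>) = \<bar>X i \<omega>\<bar> * cmod (iexp (t * Z \<omega>) - 1 - \<i> * of_real (t * Z \<omega>))"
          unfolding err_def norm_mult norm_exp_i_times by simp
        also have "\<dots> \<le> \<bar>X i \<omega>\<bar> * ((t * Z \<omega>)\<^sup>2 / 2)" by (intro mult_left_mono norm_iexp_approx1) auto
        also have "\<dots> \<le> t\<^sup>2 * (\<bar>X i \<omega>\<bar> * (Z \<omega>)\<^sup>2)" by (simp add: power_mult_distrib)
        also have "\<bar>X i \<omega>\<bar> * (Z \<omega>)\<^sup>2 \<le> \<bar>X i \<omega>\<bar> * (\<Sum>j\<in>Nb i. \<bar>X j \<omega>\<bar>)\<^sup>2"
          unfolding Z_def by (intro mult_left_mono) (simp_all add: abs_le_square_iff[symmetric])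
        also have "\<dots> = (\<Sum>j\<in>Nb i. \<Sum>l\<in>Nb i. \<bar>X i \<omega> * X j \<omega> * X l \<omega>\<bar>)"
          unfolding power2_eq_square sum_product by (simp only: sum_distrib_left abs_mult mult.assoc)
        finally show ?thesis by (simp add: mult_left_mono)
      qed
      then have "cmod (expectation err) \<le> expectation (\<lambda>\<omega>. t\<^sup>2 * (\<Sum>j\<in>Nb i. \<Sum>l\<in>Nb i. \<bar>X i \<omega> * X j \<omega> * X l \<omega>\<bar>))"
        by (intro order_trans[OF integral_norm_bound] integral_mono iI bI berr i NbI[OF i])
      also have "\<dots> = t\<^sup>2 * (\<Sum>j\<in>Nb i. \<Sum>l\<in>Nb i. ?E3 i j l)"
      proof -
        have 3: "integrable M (\<lambda>\<omega>. \<bar>X i \<omega> * X j \<omega> * X l \<omega>\<bar>)" if "j \<in> Nb i" "l \<in> Nb i" for j l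
          by (intro iI bI i NbI[OF i] that)
        show ?thesis by (simp add: 3)
      qed
      finally show ?thesis .
    qed
    have jb: "cmod (?e j
           - of_real (?c i j) * \<phi> t)
        \<le> \<bar>t\<bar> * ((\<Sum>l\<in>Nb j - Nb i. ?E3 i j l) + (\<Sum>l\<in>Nb i \<union> Nb j. ?E21 i j l))" if j: "j \<in> Nb i" for j
    proof -
      have jI: "j \<in> I" using NbI i j by blast
      \<comment> \<open>With both neighbourhoods deleted, \<open>ind2\<close> lets the product
        \<open>X i * X j\<close> leave the expectation.\<close>
      define Wij where "Wij \<omega> = (\<Sum>l\<in>I - (Nb i \<union> Nb j). X l \<omega>)" for \<omega>
      let ?e' = "\<lambda>j. expectation (\<lambda>\<omega>. of_real (X i \<omega> * X j \<omega>) * iexp (t * Wij \<omega>))"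
      have bWij: "bounded_rv M Wij" unfolding Wij_def by (intro bI) auto
      have d1: "Wi \<omega> - Wij \<omega> = (\<Sum>l\<in>Nb j - Nb i. X l \<omega>)" for \<omega>
      proof -
        have s: "Nb j - Nb i \<subseteq> I - Nb i" using Nb[OF jI] by auto
        have "I - Nb i - (Nb j - Nb i) = I - (Nb i \<union> Nb j)" by auto
        then show ?thesis unfolding Wi_def Wij_def
          using sum.subset_diff[OF s, of "\<lambda>l. X l \<omega>"] fin by simp
      qed
      have d2: "W \<omega> - Wij \<omega> = (\<Sum>l\<in>Nb i \<union> Nb j. X l \<omega>)" for \<omega>
        unfolding W_def Wij_def using sum.subset_diff[of "Nb i \<union> Nb j" I "\<lambda>l. X l \<omega>"] fin Nb[OF i] Nb[OF jI] by simp
      have e1: "cmod (?e j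
         - ?e' j) \<le> \<bar>t\<bar> * (\<Sum>l\<in>Nb j - Nb i. ?E3 i j l)"
      proof -
        have lI: "l \<in> Nb j - Nb i \<Longrightarrow> l \<in> I" for l using Nb[OF jI] by auto
        have b2: "bounded_rv M (\<lambda>\<omega>. of_real (X i \<omega> * X j \<omega>) * iexp (t * Wi \<omega>) - of_real (X i \<omega> * X j \<omega>) * iexp (t * Wij \<omega>))"
          by (intro bI bWij i jI)
        have "?e j
         - ?e' j =
         expectation (\<lambda>\<omega>. of_real (X i \<omega> * X j \<omega>) * iexp (t * Wi \<omega>) - of_real (X i \<omega> * X j \<omega>) * iexp (t * Wij \<omega>))"
          by (subst Bochner_Integration.integral_diff) (intro iI bI bWij i jI refl)+
        also have "cmod \<dots> \<le> expectation (\<lambda>\<omega>. \<bar>t\<bar> * (\<Sum>l\<in>Nb j - Nb i. \<bar>X i \<omega> * X j \<omega> * X l \<omega>\<bar>))"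
        proof (intro order_trans[OF integral_norm_bound] integral_mono iI bounded_rv_norm b2 bI i jI lI)
          fix \<omega>
          have "cmod (of_real (X i \<omega> * X j \<omega>) * iexp (t * Wi \<omega>) - of_real (X i \<omega> * X j \<omega>) * iexp (t * Wij \<omega>))
             = \<bar>X i \<omega> * X j \<omega>\<bar> * cmod (iexp (t * Wi \<omega>) - iexp (t * Wij \<omega>))"
            unfolding right_diff_distrib[symmetric] norm_mult norm_of_real by simp
          also have "\<dots> \<le> \<bar>X i \<omega> * X j \<omega>\<bar> * \<bar>t * (Wi \<omega> - Wij \<omega>)\<bar>"
            using norm_iexp_diff_le[of "t * Wi \<omega>" "t * Wij \<omega>"] by (intro mult_left_mono) (auto simp: right_diff_distrib)
          also have "\<dots> = \<bar>t\<bar> * (\<bar>X i \<omega> * X j \<omega>\<bar> * \<bar>\<Sum>l\<in>Nb j - Nb i. X l \<omega>\<bar>)"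
            unfolding d1 by (simp add: abs_mult)
          also have "\<dots> \<le> \<bar>t\<bar> * (\<bar>X i \<omega> * X j \<omega>\<bar> * (\<Sum>l\<in>Nb j - Nb i. \<bar>X l \<omega>\<bar>))"
            by (intro mult_left_mono sum_abs) auto
          finally show "cmod (of_real (X i \<omega> * X j \<omega>) * iexp (t * Wi \<omega>) - of_real (X i \<omega> * X j \<omega>) * iexp (t * Wij \<omega>))
            \<le> \<bar>t\<bar> * (\<Sum>l\<in>Nb j - Nb i. \<bar>X i \<omega> * X j \<omega> * X l \<omega>\<bar>)"
            by (simp add: sum_distrib_left abs_mult)
        qed
        also have "\<dots> = \<bar>t\<bar> * (\<Sum>l\<in>Nb j - Nb i. ?E3 i j l)"
        proof -
          have 3: "integrable M (\<lambda>\<omega>. \<bar>X i \<omega> * X j \<omega> * X l \<omega>\<bar>)" if "l \<in> Nb j - Nb i" for l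
            by (intro iI bI i jI lI that)
          show ?thesis unfolding integral_mult_right_zero
            by (subst Bochner_Integration.integral_sum) (use 3 in auto)
        qed
        finally show ?thesis .
      qed
      have e2: "cmod (expectation (\<lambda>\<omega>. iexp (t * Wij \<omega>)) - \<phi> t) \<le> \<bar>t\<bar> * (\<Sum>l\<in>Nb i \<union> Nb j. expectation (\<lambda>\<omega>. \<bar>X l \<omega>\<bar>))"
      proof -
        have lI: "l \<in> Nb i \<union> Nb j \<Longrightarrow> l \<in> I" for l using Nb[OF jI] Nb[OF i] by auto
        have "expectation (\<lambda>\<omega>. iexp (t * Wij \<omega>)) - \<phi> t = expectation (\<lambda>\<omega>. iexp (t * Wij \<omega>) - iexp (t * W \<omega>))"
          unfolding \<phi>_def by (subst Bochner_Integration.integral_diff) (intro iI bI bWij refl)+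
        also have "cmod \<dots> \<le> expectation (\<lambda>\<omega>. \<bar>t\<bar> * (\<Sum>l\<in>Nb i \<union> Nb j. \<bar>X l \<omega>\<bar>))"
        proof (intro order_trans[OF integral_norm_bound] integral_mono iI bI bWij lI)
          fix \<omega>
          have "cmod (iexp (t * Wij \<omega>) - iexp (t * W \<omega>)) \<le> \<bar>t * (W \<omega> - Wij \<omega>)\<bar>"
            using norm_iexp_diff_le[of "t * Wij \<omega>" "t * W \<omega>"] by (simp only: right_diff_distrib abs_minus_commute)
          also have "\<dots> \<le> \<bar>t\<bar> * (\<Sum>l\<in>Nb i \<union> Nb j. \<bar>X l \<omega>\<bar>)"
            unfolding d2 abs_mult by (intro mult_left_mono sum_abs) auto
          finally show "cmod (iexp (t * Wij \<omega>) - iexp (t * W \<omega>)) \<le> \<bar>t\<bar> * (\<Sum>l\<in>Nb i \<union> Nb j. \<bar>X l \<omega>\<bar>)" .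
        qed
        also have "\<dots> = \<bar>t\<bar> * (\<Sum>l\<in>Nb i \<union> Nb j. expectation (\<lambda>\<omega>. \<bar>X l \<omega>\<bar>))"
        proof -
          have 3: "integrable M (\<lambda>\<omega>. \<bar>X l \<omega>\<bar>)" if "l \<in> Nb i \<union> Nb j" for l by (intro iI bI lI that)
          show ?thesis unfolding integral_mult_right_zero
            by (subst Bochner_Integration.integral_sum) (use 3 in auto)
        qed
        finally show ?thesis .
      qed
      have absE: "\<bar>?c i j\<bar> \<le> expectation (\<lambda>\<omega>. \<bar>X i \<omega> * X j \<omega>\<bar>)"
        by (rule integral_abs_bound)
      have eqj: "?e j - of_real (?c i j) * \<phi> t
        = (?e j
         - ?e' j)
         + of_real (?c i j) * (expectation (\<lambda>\<omega>. iexp (t * Wij \<omega>)) - \<phi> t)"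
        using ind2[OF i j, of t] unfolding Wij_def by (simp only: algebra_simps)
      have e3: "cmod (of_real (?c i j) * (expectation (\<lambda>\<omega>. iexp (t * Wij \<omega>)) - \<phi> t))
        \<le> expectation (\<lambda>\<omega>. \<bar>X i \<omega> * X j \<omega>\<bar>) * (\<bar>t\<bar> * (\<Sum>l\<in>Nb i \<union> Nb j. expectation (\<lambda>\<omega>. \<bar>X l \<omega>\<bar>)))"
        unfolding norm_mult norm_of_real
        by (rule mult_mono[OF absE e2 Bochner_Integration.integral_nonneg norm_ge_zero]) (rule abs_ge_zero)
      have "\<bar>t\<bar> * ((\<Sum>l\<in>Nb j - Nb i. ?E3 i j l) + (\<Sum>l\<in>Nb i \<union> Nb j. ?E21 i j l)) =
        \<bar>t\<bar> * (\<Sum>l\<in>Nb j - Nb i. ?E3 i j l) +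
         expectation (\<lambda>\<omega>. \<bar>X i \<omega> * X j \<omega>\<bar>) * (\<bar>t\<bar> * (\<Sum>l\<in>Nb i \<union> Nb j. expectation (\<lambda>\<omega>. \<bar>X l \<omega>\<bar>)))"
        by (simp only: sum_distrib_left[symmetric] distrib_left mult.left_commute)
      then show ?thesis unfolding eqj using order_trans[OF norm_triangle_ineq add_mono[OF e1 e3]] by (simp only:)
    qed
    have "cmod (expectation (\<lambda>\<omega>. of_real (X i \<omega>) * iexp (t * W \<omega>))
      - \<i> * t * (\<Sum>j\<in>Nb i. of_real (?c i j)) * \<phi> t) \<le>
      \<bar>t\<bar> * (\<Sum>j\<in>Nb i. \<bar>t\<bar> * ((\<Sum>l\<in>Nb j - Nb i. ?E3 i j l) + (\<Sum>l\<in>Nb i \<union> Nb j. ?E21 i j l)))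
      + t\<^sup>2 * (\<Sum>j\<in>Nb i. \<Sum>l\<in>Nb i. ?E3 i j l)"
    proof -
      have "cmod (\<i> * t * (\<Sum>j\<in>Nb i. ?e j
           - of_real (?c i j) * \<phi> t)) \<le>
        \<bar>t\<bar> * (\<Sum>j\<in>Nb i. \<bar>t\<bar> * ((\<Sum>l\<in>Nb j - Nb i. ?E3 i j l) + (\<Sum>l\<in>Nb i \<union> Nb j. ?E21 i j l)))"
        unfolding norm_mult norm_ii norm_of_real mult_1
        by (rule mult_left_mono[OF order_trans[OF norm_sum sum_mono[OF jb]]]) auto
      then show ?thesis unfolding eq by (intro order_trans[OF norm_triangle_ineq] add_mono errb)
    qed
    also have "\<dots> = t\<^sup>2 * (\<Sum>j\<in>Nb i. (\<Sum>l\<in>Nb j - Nb i. ?E3 i j l) + (\<Sum>l\<in>Nb i \<union> Nb j. ?E21 i j l) + (\<Sum>l\<in>Nb i. ?E3 i j l))"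
      by (simp add: sum.distrib sum_distrib_left[symmetric] algebra_simps power2_eq_square)
    also have "\<dots> = t\<^sup>2 * (\<Sum>j\<in>Nb i. \<Sum>l\<in>Nb i \<union> Nb j. ?E3 i j l + ?E21 i j l)"
    proof -
      \<comment> \<open>The two kinds of third-moment errors run over the disjoint sets
        \<open>Nb i\<close> and \<open>Nb j - Nb i\<close>, so together they count each triple
        once.\<close>
      have "(\<Sum>l\<in>Nb i \<union> Nb j. ?E3 i j l) = (\<Sum>l\<in>Nb i. ?E3 i j l) + (\<Sum>l\<in>Nb j - Nb i. ?E3 i j l)" if "j \<in> Nb i" for j
      proof -
        have "Nb i \<union> Nb j = Nb i \<union> (Nb j - Nb i)" by auto
        then show ?thesis using finNb[OF i] finNb[OF NbI[OF i that]]
          by (metis (no_types, lifting) Diff_disjoint finite_Diff sum.union_disjoint)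
      qed
      then show ?thesis by (simp add: sum.distrib algebra_simps)
    qed
    finally show ?thesis .
  qed
  \<comment> \<open>One factor \<open>\<i>\<close> comes from differentiation and one from the
    expansion; their product -1 turns the covariances into the Gaussian drift.\<close>
  have ode: "\<i> * expectation (\<lambda>\<omega>. of_real (W \<omega>) * iexp (t * W \<omega>)) + of_real (v * t) * \<phi> t =
     \<i> * (\<Sum>i\<in>I. expectation (\<lambda>\<omega>. of_real (X i \<omega>) * iexp (t * W \<omega>))
      - \<i> * t * (\<Sum>j\<in>Nb i. of_real (?c i j)) * \<phi> t)"
  proof -
    have "expectation (\<lambda>\<omega>. of_real (W \<omega>) * iexp (t * W \<omega>)) = expectation (\<lambda>\<omega>. \<Sum>i\<in>I. of_real (X i \<omega>) * iexp (t * W \<omega>))"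
      by (simp add: W_def sum_distrib_right)
    also have "\<dots> = (\<Sum>i\<in>I. expectation (\<lambda>\<omega>. of_real (X i \<omega>) * iexp (t * W \<omega>)))"
      by (intro Bochner_Integration.integral_sum iI bI)
    finally have 1: "expectation (\<lambda>\<omega>. of_real (W \<omega>) * iexp (t * W \<omega>)) = (\<Sum>i\<in>I. expectation (\<lambda>\<omega>. of_real (X i \<omega>) * iexp (t * W \<omega>)))" .
    have 2: "complex_of_real v = (\<Sum>i\<in>I. \<Sum>j\<in>Nb i. of_real (?c i j))"
      using v(1) by (simp flip: of_real_sum)
    have ii: "\<i> * (a - \<i> * b) = \<i> * a + b" for a b by (simp add: algebra_simps)
    have 3: "(\<Sum>i\<in>I. \<i> * t * (\<Sum>j\<in>Nb i. of_real (?c i j)) * \<phi> t) = \<i> * (t * (complex_of_real v * \<phi> t))"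
      unfolding 2 sum_distrib_left[symmetric] sum_distrib_right[symmetric] by (simp only: mult.assoc)
    show ?thesis unfolding 1 sum_subtractf 3 ii by (simp only: of_real_mult mult_ac)
  qed
  have "cmod (\<i> * expectation (\<lambda>\<omega>. of_real (W \<omega>) * iexp (t * W \<omega>)) + of_real (v * t) * \<phi> t)
      \<le> (\<Sum>i\<in>I. t\<^sup>2 * (\<Sum>j\<in>Nb i. \<Sum>l\<in>Nb i \<union> Nb j. ?E3 i j l + ?E21 i j l))"
    unfolding ode norm_mult norm_ii mult_1 by (intro order_trans[OF norm_sum] sum_mono main)
  also have "\<dots> \<le> t\<^sup>2 * \<epsilon>"
    unfolding sum_distrib_left[symmetric] by (intro mult_left_mono \<epsilon>) auto
  finally show "cmod (\<i> * expectation (\<lambda>\<omega>. of_real (W \<omega>) * iexp (t * W \<omega>)) + of_real (v * t) *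
     expectation (\<lambda>\<omega>. iexp (t * (\<Sum>i\<in>I. X i \<omega>)))) \<le> t\<^sup>2 * \<epsilon>"
    unfolding \<phi>_def W_def .
qed

section \<open>Riemann sums of the profile\<close>

text \<open>The integrand of \<open>V\<close>. An edge traversed several times carries its weight
  once per traversal but its probability only once, which is this function with \<open>m\<close>
  equal to \<alpha> times the number of traversals.\<close>

definition profile :: "(real \<Rightarrow> real) \<Rightarrow> nat \<Rightarrow> real \<Rightarrow> real" where
  "profile \<psi> m t = (1 + (\<psi> t)\<^sup>2) ^ m * exp (- (\<psi> t)\<^sup>2)"

lemma profile_pos: "0 < profile \<psi> m t"
  unfolding profile_def by (intro mult_pos_pos zero_less_power) (auto intro: add_pos_nonneg)

text \<open>For positive \<open>m\<close>, \<open>1 + x\<close> is at most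
  \<open>m * (1 + x / m)\<close>, hence at most \<open>m * exp (x / m)\<close>; raise this to the
  power \<open>m\<close>. For \<open>m = 0\<close> the constant is \<open>0 ^ 0 = 1\<close>.\<close>

lemma power_le_exp:
  fixes x :: real
  assumes "0 \<le> x"
  shows "(1 + x) ^ m \<le> real m ^ m * exp x"
proof (cases "m = 0")
  case False
  have "1 + x \<le> real m * (1 + x / m)" using False by (simp add: field_simps)
  also have "\<dots> \<le> real m * exp (x / m)" by (intro mult_left_mono exp_ge_add_one_self) auto
  finally have "(1 + x) ^ m \<le> (real m * exp (x / m)) ^ m" using assms by (intro power_mono) auto
  also have "\<dots> = real m ^ m * exp x"
    using False by (simp add: power_mult_distrib exp_of_nat_mult[symmetric])
  finally show ?thesis .
qed (use assms in simp)

text \<open>For m \<ge> 2 the function \<open>(1 + v) ^ m * exp (- v)\<close> increases before it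
  decreases, so the profile is monotone only up to a constant, which is enough to dominate Riemann
  sums. The product inequality 1 + v \<le> (1 + u)(1 + (v - u)) reduces the claim to
  \<open>power_le_exp\<close> at v - u.\<close>

lemma power_mult_exp_minus_le:
  fixes u v :: real
  assumes "0 \<le> u" "u \<le> v"
  shows "(1 + v) ^ m * exp (- v) \<le> real m ^ m * ((1 + u) ^ m * exp (- u))"
proof -
  have "(1 + v) ^ m \<le> ((1 + u) * (1 + (v - u))) ^ m"
  proof (rule power_mono)
    have "0 \<le> u * (v - u)" using assms by simp
    then show "1 + v \<le> (1 + u) * (1 + (v - u))" by (simp add: algebra_simps)
  qed (use assms in auto)
  also have "\<dots> \<le> (1 + u) ^ m * (real m ^ m * exp (v - u))"
    unfolding power_mult_distrib using assms by (intro mult_left_mono power_le_exp) auto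
  finally have "(1 + v) ^ m * exp (- v) \<le> (1 + u) ^ m * (real m ^ m * exp (v - u)) * exp (- v)"
    by (intro mult_right_mono) auto
  also have "\<dots> = real m ^ m * ((1 + u) ^ m * (exp (v - u) * exp (- v)))" by (simp only: mult_ac)
  also have "exp (v - u) * exp (- v) = exp (- u)" by (simp add: exp_add[symmetric])
  finally show ?thesis .
qed

lemma profile_le: "profile \<psi> m t \<le> real m ^ m"
  using power_mult_exp_minus_le[of 0 "(\<psi> t)\<^sup>2" m] by (simp add: profile_def)

lemma profile_decreasing:
  assumes pos: "\<And>x. \<psi> x > 0" and mono: "mono_on {0..} \<psi>" and "0 \<le> t" "t \<le> s"
  shows "profile \<psi> m s \<le> real m ^ m * profile \<psi> m t"
  unfolding profile_def
proof (rule power_mult_exp_minus_le)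
  have "\<psi> t \<le> \<psi> s" using assms by (auto simp: mono_on_def)
  then show "(\<psi> t)\<^sup>2 \<le> (\<psi> s)\<^sup>2" using pos[of t] by (intro power_mono) auto
qed simp

lemma integral_pos_half:
  fixes f :: "real \<Rightarrow> real"
  assumes "\<And>x. f (- x) = f x" "integrable lborel f"
  shows "(LINT t|lborel. indicator {0<..} t * f t) = (LINT t|lborel. f t) / 2"
proof -
  have i1: "integrable lborel (\<lambda>t. indicator {0<..} t * f t)"
    and i2: "integrable lborel (\<lambda>t. indicator {..<0} t * f t)"
    using integrable_mult_indicator[OF _ assms(2), of "{0<..}"] integrable_mult_indicator[OF _ assms(2), of "{..<0}"] by auto
  have "(LINT t|lborel. f t) = (LINT t|lborel. indicator {0<..} t * f t + indicator {..<0} t * f t)"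
  proof (rule integral_cong_AE)
    show "AE t in lborel. f t = indicator {0<..} t * f t + indicator {..<0} t * f t"
      using AE_lborel_singleton[of 0] by eventually_elim (auto simp: indicator_def)
  qed (use assms i1 i2 in auto)
  also have "\<dots> = (LINT t|lborel. indicator {0<..} t * f t) + (LINT t|lborel. indicator {..<0} t * f t)"
    by (rule Bochner_Integration.integral_add[OF i1 i2])
  also have "(LINT t|lborel. indicator {..<0} t * f t) = (LINT t|lborel. indicator {0<..} t * f t)"
    by (subst lborel_integral_real_affine[of "-1" _ 0]) (auto simp: assms(1) indicator_def intro!: Bochner_Integration.integral_cong)
  finally show ?thesis by simp
qed

text \<open>The sum is the integral of a step function sampling the profile at right endpoints of
  cells of width \<open>1 / R k\<close>. Right endpoints lie further out, so by
  \<open>profile_decreasing\<close> a constant multiple of the profile dominates all step functions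
  at once. The weights \<theta> allow the plain sum and the sum with the factor 1 - j / N to be
  handled together; both the truncation at \<open>J k\<close> and the weight only have to become
  harmless at each fixed \<open>t\<close>.\<close>

lemma profile_riemann_sum:
  fixes \<psi> :: "real \<Rightarrow> real" and R :: "nat \<Rightarrow> real" and \<theta> :: "nat \<Rightarrow> nat \<Rightarrow> real" and J :: "nat \<Rightarrow> nat"
  assumes even: "\<And>x. \<psi> (- x) = \<psi> x" and cont: "continuous_on UNIV \<psi>"
    and pos: "\<And>x. \<psi> x > 0" and mono: "mono_on {0..} \<psi>"
    and int: "integrable lborel (profile \<psi> m)"
    and R: "\<And>k. 0 < R k" "filterlim R at_top sequentially"
    and \<theta>: "\<And>k j. j \<le> J k \<Longrightarrow> \<bar>\<theta> k j\<bar> \<le> 1"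
      "\<And>t. 0 < t \<Longrightarrow> (\<lambda>k. of_bool (nat \<lceil>t * R k\<rceil> \<le> J k) * \<theta> k (nat \<lceil>t * R k\<rceil>)) \<longlonglongrightarrow> 1"
  shows "(\<lambda>k. (\<Sum>j=1..J k. \<theta> k j * profile \<psi> m (real j / R k)) / R k) \<longlonglongrightarrow> (LINT t|lborel. profile \<psi> m t) / 2"
proof -
  \<comment> \<open>With half-open cells each positive \<open>t\<close> lies in exactly one of them,
    the one with index \<open>nat \<lceil>t * R k\<rceil>\<close>, so the sum collapses to a single
    term.\<close>
  define F where "F k t = (\<Sum>j=1..J k. \<theta> k j * profile \<psi> m (real j / R k) * indicator {(real j - 1) / R k<..real j / R k} t)" for k t
  have meas: "profile \<psi> m \<in> borel_measurable borel" using int by auto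
  have contp: "isCont (profile \<psi> m) t" for t
    using cont unfolding profile_def
    by (intro continuous_intros) (auto simp: continuous_on_eq_continuous_at)
  have Fpos: "F k t = of_bool (nat \<lceil>t * R k\<rceil> \<le> J k) * \<theta> k (nat \<lceil>t * R k\<rceil>) * profile \<psi> m (real (nat \<lceil>t * R k\<rceil>) / R k)"
    if "0 < t" for k t
  proof -
    let ?i = "nat \<lceil>t * R k\<rceil>"
    have tR: "0 < t * R k" using that R(1)[of k] by simp
    have iff: "t \<in> {(real j - 1) / R k<..real j / R k} \<longleftrightarrow> j = ?i" if "1 \<le> j" for j
    proof -
      have "t \<in> {(real j - 1) / R k<..real j / R k} \<longleftrightarrow> real j - 1 < t * R k \<and> t * R k \<le> real j"
        using R(1)[of k] by (auto simp: field_simps)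
      also have "\<dots> \<longleftrightarrow> \<lceil>t * R k\<rceil> = int j"
        by (simp add: ceiling_eq_iff)
      also have "\<dots> \<longleftrightarrow> j = ?i" using tR by linarith
      finally show ?thesis .
    qed
    have "F k t = (\<Sum>j=1..J k. if j = ?i then \<theta> k j * profile \<psi> m (real j / R k) else 0)"
      unfolding F_def by (intro sum.cong refl) (use iff in \<open>auto simp: indicator_def\<close>)
    also have "\<dots> = (if ?i \<in> {1..J k} then \<theta> k ?i * profile \<psi> m (real ?i / R k) else 0)"
      by (subst sum.delta) auto
    also have "?i \<in> {1..J k} \<longleftrightarrow> ?i \<le> J k"
    proof -
      have "1 \<le> ?i" using tR by linarith
      then show ?thesis by simp
    qed
    finally show ?thesis by simp
  qed
  have Fneg: "F k t = 0" if "t \<le> 0" for k t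
    unfolding F_def
  proof (intro sum.neutral ballI)
    fix j assume "j \<in> {1..J k}"
    then have "0 \<le> (real j - 1) / R k" using R(1)[of k] by auto
    then have "t \<notin> {(real j - 1) / R k<..real j / R k}" using that by auto
    then show "\<theta> k j * profile \<psi> m (real j / R k) * indicator {(real j - 1) / R k<..real j / R k} t = 0" by simp
  qed
  have ge: "t \<le> real (nat \<lceil>t * R k\<rceil>) / R k" if "0 < t" for t k
  proof -
    have "0 < t * R k" using that R(1)[of k] by simp
    then have "t * R k \<le> real (nat \<lceil>t * R k\<rceil>)" by linarith
    then show ?thesis using R(1)[of k] by (simp add: field_simps)
  qed
  have "(\<lambda>k. LINT t|lborel. F k t) \<longlonglongrightarrow> (LINT t|lborel. indicator {0<..} t * profile \<psi> m t)"
  proof (rule integral_dominated_convergence[where w = "\<lambda>t. real m ^ m * profile \<psi> m t"])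
    show "integrable lborel (\<lambda>t. real m ^ m * profile \<psi> m t)" using int by simp
    show "AE t in lborel. (\<lambda>k. F k t) \<longlonglongrightarrow> indicator {0<..} t * profile \<psi> m t"
    proof (rule AE_I2)
      fix t :: real
      show "(\<lambda>k. F k t) \<longlonglongrightarrow> indicator {0<..} t * profile \<psi> m t"
      proof (cases "0 < t")
        case True
        have "(\<lambda>k. real (nat \<lceil>t * R k\<rceil>) / R k) \<longlonglongrightarrow> t"
        proof (rule tendsto_sandwich[where f = "\<lambda>_. t" and h = "\<lambda>k. t + 1 / R k"])
          have "(\<lambda>k. t + 1 / R k) \<longlonglongrightarrow> t + 0"
            by (intro tendsto_intros tendsto_divide_0[OF tendsto_const filterlim_at_top_imp_at_infinity[OF R(2)]])
          then show "(\<lambda>k. t + 1 / R k) \<longlonglongrightarrow> t" by simp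
          show "\<forall>\<^sub>F k in sequentially. real (nat \<lceil>t * R k\<rceil>) / R k \<le> t + 1 / R k"
          proof (intro always_eventually allI)
            fix k
            have "0 < t * R k" using True R(1)[of k] by simp
            then have "real (nat \<lceil>t * R k\<rceil>) \<le> t * R k + 1" by linarith
            then have "real (nat \<lceil>t * R k\<rceil>) / R k \<le> (t * R k + 1) / R k" using R(1)[of k] by (intro divide_right_mono) auto
            then show "real (nat \<lceil>t * R k\<rceil>) / R k \<le> t + 1 / R k" using R(1)[of k] by (simp add: add_divide_distrib)
          qed
        qed (use ge[OF True] in auto)
        then have "(\<lambda>k. profile \<psi> m (real (nat \<lceil>t * R k\<rceil>) / R k)) \<longlonglongrightarrow> profile \<psi> m t"
          by (rule isCont_tendsto_compose[OF contp])
        from tendsto_mult[OF \<theta>(2)[OF True] this] show ?thesis using True by (simp add: Fpos)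
      qed (simp add: Fneg)
    qed
    fix k
    show "AE t in lborel. norm (F k t) \<le> real m ^ m * profile \<psi> m t"
    proof (rule AE_I2)
      fix t :: real
      show "norm (F k t) \<le> real m ^ m * profile \<psi> m t"
      proof (cases "0 < t")
        case True
        have "norm (F k t) \<le> 1 * profile \<psi> m (real (nat \<lceil>t * R k\<rceil>) / R k)"
          unfolding Fpos[OF True] norm_mult using profile_pos[of \<psi> m] \<theta>(1)[of "nat \<lceil>t * R k\<rceil>" k]
          by (intro mult_mono) (auto simp: less_imp_le abs_mult)
        also have "\<dots> \<le> real m ^ m * profile \<psi> m t"
          using profile_decreasing[OF pos mono _ ge[OF True, of k], of m] True by simp
        finally show ?thesis .
      qed (use profile_pos[of \<psi> m t] in \<open>simp add: Fneg\<close>)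
    qed
    show "F k \<in> borel_measurable lborel" unfolding F_def by measurable
  qed (use meas in measurable)
  moreover have "(LINT t|lborel. F k t) = (\<Sum>j=1..J k. \<theta> k j * profile \<psi> m (real j / R k)) / R k" for k
  proof -
    have "(LINT t|lborel. F k t) = (\<Sum>j=1..J k. LINT t|lborel. \<theta> k j * profile \<psi> m (real j / R k) * indicator {(real j - 1) / R k<..real j / R k} t)"
      unfolding F_def using R(1)[of k]
      by (subst Bochner_Integration.integral_sum) (auto intro!: integrable_mult_right integrable_real_indicator simp: divide_right_mono)
    also have "\<dots> = (\<Sum>j=1..J k. \<theta> k j * profile \<psi> m (real j / R k) * (1 / R k))"
    proof (intro sum.cong refl)
      fix j
      have "(real j - 1) / R k \<le> real j / R k" using R(1)[of k] by (intro divide_right_mono) auto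
      then show "(LINT t|lborel. \<theta> k j * profile \<psi> m (real j / R k) * indicator {(real j - 1) / R k<..real j / R k} t) =
        \<theta> k j * profile \<psi> m (real j / R k) * (1 / R k)"
        by (simp add: diff_divide_distrib)
    qed
    finally show ?thesis by (simp add: sum_divide_distrib)
  qed
  moreover have "(LINT t|lborel. indicator {0<..} t * profile \<psi> m t) = (LINT t|lborel. profile \<psi> m t) / 2"
    by (rule integral_pos_half[OF _ int]) (simp add: profile_def even)
  ultimately show ?thesis by simp
qed

text \<open>The first sum bounds a row of the kernel wherever the row lies. The second is the exact
  average over all rows, where the factor 1 - j / N accounts for sites with no partner at distance
  \<open>j\<close>. Because R = o(N), both have the limit \<open>V\<close>, and this coincidence is
  what the limit over trees relies on.\<close>

lemma profile_sum_limits: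
  fixes \<psi> :: "real \<Rightarrow> real" and R :: "nat \<Rightarrow> real" and n :: "nat \<Rightarrow> nat"
  assumes even: "\<And>x. \<psi> (- x) = \<psi> x" and cont: "continuous_on UNIV \<psi>"
    and pos: "\<And>x. \<psi> x > 0" and mono: "mono_on {0..} \<psi>"
    and int: "integrable lborel (profile \<psi> m)"
    and R: "\<And>k. 0 < R k" "filterlim R at_top sequentially"
    and RN: "(\<lambda>k. R k / real (dim_N (n k))) \<longlonglongrightarrow> 0"
    and n: "filterlim n at_top sequentially"
  shows "(\<lambda>k. 2 * (\<Sum>j=1..2 * n k. profile \<psi> m (real j / R k)) / R k) \<longlonglongrightarrow> V \<psi> m"
    and "(\<lambda>k. 2 * (\<Sum>j=1..2 * n k. (1 - real j / real (dim_N (n k))) * profile \<psi> m (real j / R k)) / R k) \<longlonglongrightarrow> V \<psi> m"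
proof -
  have N: "filterlim (\<lambda>k. real (dim_N (n k))) at_top sequentially"
  proof (rule filterlim_at_top_mono[OF filterlim_compose[OF filterlim_real_sequentially n]])
    show "\<forall>\<^sub>F k in sequentially. real (n k) \<le> real (dim_N (n k))" by (simp add: dim_N_def)
  qed
  have Npos: "0 < real (dim_N (n k))" for k by (simp add: dim_N_def)
  have lim: "(\<lambda>k. real (nat \<lceil>t * R k\<rceil>) / real (dim_N (n k))) \<longlonglongrightarrow> 0" if "0 < t" for t
  proof (rule tendsto_sandwich[where f = "\<lambda>_. 0" and h = "\<lambda>k. t * (R k / real (dim_N (n k))) + 1 / real (dim_N (n k))"])
    have "(\<lambda>k. t * (R k / real (dim_N (n k))) + 1 / real (dim_N (n k))) \<longlonglongrightarrow> t * 0 + 0"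
      by (intro tendsto_intros RN tendsto_divide_0[OF tendsto_const filterlim_at_top_imp_at_infinity[OF N]])
    then show "(\<lambda>k. t * (R k / real (dim_N (n k))) + 1 / real (dim_N (n k))) \<longlonglongrightarrow> 0" by simp
    show "\<forall>\<^sub>F k in sequentially. real (nat \<lceil>t * R k\<rceil>) / real (dim_N (n k)) \<le> t * (R k / real (dim_N (n k))) + 1 / real (dim_N (n k))"
    proof (intro always_eventually allI)
      fix k
      have "0 < t * R k" using that R(1)[of k] by simp
      then have "real (nat \<lceil>t * R k\<rceil>) \<le> t * R k + 1" by linarith
      then have "real (nat \<lceil>t * R k\<rceil>) / real (dim_N (n k)) \<le> (t * R k + 1) / real (dim_N (n k))"
        using Npos by (intro divide_right_mono) auto
      then show "real (nat \<lceil>t * R k\<rceil>) / real (dim_N (n k)) \<le> t * (R k / real (dim_N (n k))) + 1 / real (dim_N (n k))"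
        by (simp add: add_divide_distrib)
    qed
  qed (use Npos in \<open>auto simp: less_imp_le\<close>)
  \<comment> \<open>The index belonging to a fixed \<open>t\<close> is of order \<open>R k\<close>,
    hence eventually below the cutoff \<open>2 * n k\<close>.\<close>
  have ev: "\<forall>\<^sub>F k in sequentially. nat \<lceil>t * R k\<rceil> \<le> 2 * n k" if "0 < t" for t
  proof (rule eventually_mono[OF order_tendstoD(2)[OF lim[OF that], of 1]])
    fix k assume "real (nat \<lceil>t * R k\<rceil>) / real (dim_N (n k)) < 1"
    then have "real (nat \<lceil>t * R k\<rceil>) < real (2 * n k + 1)" using Npos[of k] by (simp add: dim_N_def)
    then show "nat \<lceil>t * R k\<rceil> \<le> 2 * n k" unfolding of_nat_less_iff by (rule leD[THEN leI] | linarith)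
  qed simp
  have V: "V \<psi> m = (LINT t|lborel. profile \<psi> m t)" by (simp add: V_def profile_def)
  have "(\<lambda>k. (\<Sum>j=1..2 * n k. 1 * profile \<psi> m (real j / R k)) / R k) \<longlonglongrightarrow> (LINT t|lborel. profile \<psi> m t) / 2"
  proof (rule profile_riemann_sum[OF even cont pos mono int R])
    fix t :: real assume t: "0 < t"
    show "(\<lambda>k. of_bool (nat \<lceil>t * R k\<rceil> \<le> 2 * n k) * 1 :: real) \<longlonglongrightarrow> 1"
      by (rule tendsto_eventually, rule eventually_mono[OF ev[OF t]]) simp
  qed auto
  from tendsto_mult[OF tendsto_const[of 2] this]
  show "(\<lambda>k. 2 * (\<Sum>j=1..2 * n k. profile \<psi> m (real j / R k)) / R k) \<longlonglongrightarrow> V \<psi> m" by (simp add: V)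
  have "(\<lambda>k. (\<Sum>j=1..2 * n k. (1 - real j / real (dim_N (n k))) * profile \<psi> m (real j / R k)) / R k) \<longlonglongrightarrow> (LINT t|lborel. profile \<psi> m t) / 2"
  proof (rule profile_riemann_sum[OF even cont pos mono int R])
    fix t :: real assume t: "0 < t"
    have "(\<lambda>k. 1 - real (nat \<lceil>t * R k\<rceil>) / real (dim_N (n k))) \<longlonglongrightarrow> 1 - 0" by (intro tendsto_intros lim t)
    then have l: "(\<lambda>k. 1 - real (nat \<lceil>t * R k\<rceil>) / real (dim_N (n k))) \<longlonglongrightarrow> 1" by (simp only: diff_zero)
    show "(\<lambda>k. of_bool (nat \<lceil>t * R k\<rceil> \<le> 2 * n k) * (1 - real (nat \<lceil>t * R k\<rceil>) / real (dim_N (n k)))) \<longlonglongrightarrow> 1"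
      by (rule Lim_transform_eventually[OF l], rule eventually_mono[OF ev[OF t]]) simp
  next
    fix k j :: nat assume "j \<le> 2 * n k"
    then show "\<bar>1 - real j / real (dim_N (n k))\<bar> \<le> 1" using Npos[of k] by (simp add: dim_N_def field_simps)
  qed
  from tendsto_mult[OF tendsto_const[of 2] this]
  show "(\<lambda>k. 2 * (\<Sum>j=1..2 * n k. (1 - real j / real (dim_N (n k))) * profile \<psi> m (real j / R k)) / R k) \<longlonglongrightarrow> V \<psi> m"
    by (simp add: V)
qed

lemma V_pos:
  assumes "integrable lborel (profile \<psi> m)"
  shows "0 < V \<psi> m"
proof -
  have V: "V \<psi> m = (LINT t|lborel. profile \<psi> m t)" by (simp add: V_def profile_def)
  have "0 \<le> V \<psi> m" unfolding V using profile_pos[of \<psi> m] by (intro integral_nonneg_AE) (auto simp: less_imp_le)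
  moreover have "V \<psi> m \<noteq> 0"
  proof
    assume "V \<psi> m = 0"
    then have "AE t in lborel. profile \<psi> m t = 0"
      unfolding V using assms profile_pos[of \<psi> m] by (subst (asm) integral_nonneg_eq_0_iff_AE) (auto simp: less_imp_le)
    moreover have "profile \<psi> m t \<noteq> 0" for t using profile_pos[of \<psi> m t] by simp
    ultimately have "AE t in (lborel :: real measure). False" by simp
    then show False by (simp add: AE_iff_null emeasure_lborel_UNIV null_sets_def)
  qed
  ultimately show ?thesis by simp
qed

section \<open>Sums over embedded trees\<close>

text \<open>Trees are generated by attaching leaves. In an induction the last leaf occurs in a
  single edge, so the sum over its position can be carried out while everything else stays
  fixed.\<close>

inductive tree_on :: "'i set \<Rightarrow> 'i set set \<Rightarrow> bool" where
  root: "tree_on {r} {}"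
| leaf: "tree_on X E \<Longrightarrow> x \<in> X \<Longrightarrow> y \<notin> X \<Longrightarrow> tree_on (insert y X) (insert {x, y} E)"

lemma tree_on_finite: "tree_on X E \<Longrightarrow> finite X \<and> finite E"
  by (induction rule: tree_on.induct) auto

lemma tree_on_edges: "tree_on X E \<Longrightarrow> e \<in> E \<Longrightarrow> e \<subseteq> X \<and> card e = 2"
  by (induction rule: tree_on.induct) (auto simp: card_2_iff)

lemma tree_on_card: "tree_on X E \<Longrightarrow> card X = Suc (card E)"
proof (induction rule: tree_on.induct)
  case (leaf X E x y)
  have "{x, y} \<notin> E" using tree_on_edges[OF leaf.hyps(1)] leaf.hyps(3) by blast
  then show ?case using leaf tree_on_finite[OF leaf.hyps(1)] by simp
qed simp

lemma tree_on_extend: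
  assumes "tree_on X E" "x \<in> X"
  shows "\<exists>E'. tree_on (insert y X) E' \<and> E' \<subseteq> insert {x, y} E"
proof (cases "y \<in> X")
  case True
  then show ?thesis using assms by (auto simp: insert_absorb)
qed (use tree_on.leaf[OF assms] in blast)

section \<open>Weighted sums over injective placements of a tree\<close>

definition embeddings :: "'i set \<Rightarrow> 'v set \<Rightarrow> ('i \<Rightarrow> 'v) set" where
  "embeddings X L = {h \<in> X \<rightarrow>\<^sub>E L. inj_on h X}"

lemma finite_embeddings: "finite X \<Longrightarrow> finite L \<Longrightarrow> finite (embeddings X L)"
  unfolding embeddings_def by (simp add: finite_PiE)

lemma sum_embeddings_insert:
  assumes "y \<notin> X" "finite X" "finite L"
  shows "(\<Sum>h\<in>embeddings (insert y X) L. F h) = (\<Sum>h\<in>embeddings X L. \<Sum>z\<in>L - h ` X. F (h(y := z)))"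
proof -
  have "(\<Sum>h\<in>embeddings X L. \<Sum>z\<in>L - h ` X. F (h(y := z))) =
      (\<Sum>(h, z)\<in>Sigma (embeddings X L) (\<lambda>h. L - h ` X). F (h(y := z)))"
    using assms by (subst sum.Sigma) (auto intro: finite_embeddings)
  also have "\<dots> = (\<Sum>h\<in>embeddings (insert y X) L. F h)"
  proof (rule sum.reindex_bij_witness[of _ "\<lambda>h. (restrict h X, h y)" "\<lambda>(h, z). h(y := z)"])
    fix a assume "a \<in> Sigma (embeddings X L) (\<lambda>h. L - h ` X)"
    then obtain h z where a: "a = (h, z)" "h \<in> X \<rightarrow>\<^sub>E L" "inj_on h X" "z \<in> L" "z \<notin> h ` X"
      by (auto simp: embeddings_def)
    have "restrict (h(y := z)) X = h"
      using a(2) assms(1) by (auto simp: restrict_def fun_eq_iff PiE_def extensional_def)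
    then show "(restrict (case a of (h, z) \<Rightarrow> h(y := z)) X, (case a of (h, z) \<Rightarrow> h(y := z)) y) = a"
      using a by simp
    have "inj_on (h(y := z)) (insert y X)"
      using a assms(1) by (auto simp: inj_on_def)
    then show "(case a of (h, z) \<Rightarrow> h(y := z)) \<in> embeddings (insert y X) L"
      using a by (auto simp: embeddings_def intro!: PiE_I split: if_splits)
  next
    fix h assume "h \<in> embeddings (insert y X) L"
    then have h: "h \<in> insert y X \<rightarrow>\<^sub>E L" "inj_on h (insert y X)" by (auto simp: embeddings_def)
    show "(case (restrict h X, h y) of (h, z) \<Rightarrow> h(y := z)) = h"
      using h(1) assms(1) by (auto simp: fun_eq_iff restrict_def PiE_def extensional_def)
    have "restrict h X \<in> embeddings X L"
      using h by (auto simp: embeddings_def inj_on_def)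
    moreover have "h y \<in> L - restrict h X ` X"
      using h assms(1) by (auto simp: inj_on_def)
    ultimately show "(restrict h X, h y) \<in> Sigma (embeddings X L) (\<lambda>h. L - h ` X)" by auto
  qed (auto split: prod.split)
  finally show ?thesis by simp
qed

lemma embeddings_singleton: "embeddings {r} L = (\<lambda>i. \<lambda>x\<in>{r}. i) ` L"
  by (auto simp: embeddings_def image_iff PiE_def extensional_def fun_eq_iff restrict_def)

lemma sum_embeddings_singleton:
  "(\<Sum>h\<in>embeddings {r} L. F h) = (\<Sum>i\<in>L. F (\<lambda>x\<in>{r}. i))"
proof -
  have "inj_on (\<lambda>i. \<lambda>x\<in>{r}. i) L" by (auto simp: inj_on_def fun_eq_iff split: if_splits)
  then show ?thesis unfolding embeddings_singleton by (subst sum.reindex) auto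
qed

text \<open>The factor depends on the abstract edge \<open>e\<close> as well as on its image: the
  former determines the multiplicity, the latter the length.\<close>

definition edge_weight :: "('i set \<Rightarrow> 'v set \<Rightarrow> real) \<Rightarrow> 'i set set \<Rightarrow> ('i \<Rightarrow> 'v) \<Rightarrow> real" where
  "edge_weight \<kappa> E h = (\<Prod>e\<in>E. \<kappa> e (h ` e))"

lemma edge_weight_nonneg: "(\<And>e s. 0 \<le> \<kappa> e s) \<Longrightarrow> 0 \<le> edge_weight \<kappa> E h"
  unfolding edge_weight_def by (intro prod_nonneg) auto

lemma edge_weight_leaf:
  assumes "tree_on X E" "y \<notin> X" "x \<in> X"
  shows "edge_weight \<kappa> (insert {x, y} E) (h(y := z)) = \<kappa> {x, y} {h x, z} * edge_weight \<kappa> E h"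
proof -
  have "{x, y} \<notin> E" using tree_on_edges[OF assms(1)] assms(2) by blast
  moreover have "(h(y := z)) ` e = h ` e" if "e \<in> E" for e
    using tree_on_edges[OF assms(1) that] assms(2) by (intro image_cong) auto
  moreover have "(h(y := z)) ` {x, y} = {h x, z}" using assms by auto
  ultimately show ?thesis
    unfolding edge_weight_def using tree_on_finite[OF assms(1)] by simp
qed

lemma sum_tree_leaf:
  assumes "tree_on X E" "y \<notin> X" "x \<in> X" "finite L"
  shows "(\<Sum>h\<in>embeddings (insert y X) L. edge_weight \<kappa> (insert {x, y} E) h * f h) =
     (\<Sum>h\<in>embeddings X L. edge_weight \<kappa> E h * (\<Sum>z\<in>L - h ` X. \<kappa> {x, y} {h x, z} * f (h(y := z))))"
  using assms tree_on_finite[OF assms(1)]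
  by (subst sum_embeddings_insert) (simp_all add: edge_weight_leaf[OF assms(1-3)] sum_distrib_left mult_ac)

text \<open>Pinning one vertex leaves one free row sum per edge. The pinned vertex may be any vertex
  of the tree, so the induction is over arbitrary \<open>x\<close> and \<open>i\<close>: a leaf that
  is not pinned is summed out, and a pinned leaf moves the pin to its neighbour.\<close>

lemma rooted_tree_sum_le:
  fixes \<kappa> :: "'i set \<Rightarrow> 'v set \<Rightarrow> real"
  assumes tree: "tree_on X E" and fin: "finite L" and nn: "\<And>e s. 0 \<le> \<kappa> e s" "\<And>e. 0 \<le> \<rho> e"
    and row: "\<And>e i. e \<in> E \<Longrightarrow> i \<in> L \<Longrightarrow> (\<Sum>z\<in>L - {i}. \<kappa> e {i, z}) \<le> \<rho> e"
    and "x \<in> X" "i \<in> L"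
  shows "(\<Sum>h\<in>embeddings X L. edge_weight \<kappa> E h * of_bool (h x = i)) \<le> (\<Prod>e\<in>E. \<rho> e)"
  using tree row \<open>x \<in> X\<close> \<open>i \<in> L\<close>
proof (induction arbitrary: x i rule: tree_on.induct)
  case (root r)
  then show ?case using fin by (simp add: sum_embeddings_singleton edge_weight_def of_bool_def)
next
  case (leaf X E x0 y)
  note T = \<open>tree_on X E\<close> \<open>y \<notin> X\<close> \<open>x0 \<in> X\<close>
  have E: "{x0, y} \<notin> E" "finite E" using tree_on_edges[OF T(1)] T(2) tree_on_finite[OF T(1)] by blast+
  have row': "(\<Sum>z\<in>L - {i}. \<kappa> {x0, y} {i, z}) \<le> \<rho> {x0, y}" if "i \<in> L" for i
    using leaf.prems(1)[of "{x0, y}" i] that by simp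
  have hx: "h x0 \<in> L" "h x0 \<in> h ` X" if "h \<in> embeddings X L" for h
    using that T(3) by (auto simp: embeddings_def)
  show ?case
  proof (cases "x = y")
    case False
    then have x: "x \<in> X" using leaf.prems by auto
    have "(\<Sum>h\<in>embeddings (insert y X) L. edge_weight \<kappa> (insert {x0, y} E) h * of_bool (h x = i)) =
      (\<Sum>h\<in>embeddings X L. edge_weight \<kappa> E h * of_bool (h x = i) * (\<Sum>z\<in>L - h ` X. \<kappa> {x0, y} {h x0, z}))"
      unfolding sum_tree_leaf[OF T fin] using False by (simp add: sum_distrib_left mult_ac)
    also have "\<dots> \<le> (\<Sum>h\<in>embeddings X L. edge_weight \<kappa> E h * of_bool (h x = i) * \<rho> {x0, y})"
    proof (intro sum_mono mult_left_mono mult_nonneg_nonneg edge_weight_nonneg nn)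
      fix h assume h: "h \<in> embeddings X L"
      have "(\<Sum>z\<in>L - h ` X. \<kappa> {x0, y} {h x0, z}) \<le> (\<Sum>z\<in>L - {h x0}. \<kappa> {x0, y} {h x0, z})"
        using fin hx[OF h] nn by (intro sum_mono2) auto
      also have "\<dots> \<le> \<rho> {x0, y}" using row' hx[OF h] by blast
      finally show "(\<Sum>z\<in>L - h ` X. \<kappa> {x0, y} {h x0, z}) \<le> \<rho> {x0, y}" .
    qed auto
    also have "\<dots> = (\<Sum>h\<in>embeddings X L. edge_weight \<kappa> E h * of_bool (h x = i)) * \<rho> {x0, y}"
      by (simp add: sum_distrib_right)
    also have "\<dots> \<le> (\<Prod>e\<in>E. \<rho> e) * \<rho> {x0, y}"
      using leaf.IH[OF leaf.prems(1) x leaf.prems(3)] nn by (intro mult_right_mono) auto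
    finally show ?thesis using E by (simp add: mult.commute)
  next
    \<comment> \<open>The pinned vertex is the new leaf. Conditioning on the position
      \<open>j\<close> of its neighbour allows the induction hypothesis with that neighbour pinned
      at \<open>j\<close>; the remaining sum over \<open>j\<close> is again a row sum at
      \<open>i\<close>, because edges are unordered.\<close>
    case True
    have "(\<Sum>h\<in>embeddings (insert y X) L. edge_weight \<kappa> (insert {x0, y} E) h * of_bool (h x = i)) =
      (\<Sum>h\<in>embeddings X L. edge_weight \<kappa> E h * (\<Sum>z\<in>L - h ` X. \<kappa> {x0, y} {h x0, z} * of_bool (z = i)))"
      unfolding sum_tree_leaf[OF T fin] using True by simp
    also have "\<dots> \<le> (\<Sum>h\<in>embeddings X L. edge_weight \<kappa> E h * (\<Sum>j\<in>L - {i}. of_bool (h x0 = j) * \<kappa> {x0, y} {i, j}))"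
    proof (intro sum_mono mult_left_mono edge_weight_nonneg nn)
      fix h assume h: "h \<in> embeddings X L"
      have "(\<Sum>z\<in>L - h ` X. \<kappa> {x0, y} {h x0, z} * of_bool (z = i)) = (if i \<in> h ` X then 0 else \<kappa> {x0, y} {h x0, i})"
        using fin leaf.prems(3) by (auto simp: of_bool_def if_distrib[of "\<lambda>a. _ * a"] cong: if_cong)
      also have "\<dots> \<le> (if h x0 = i then 0 else \<kappa> {x0, y} {h x0, i})"
        using hx[OF h] nn by auto
      also have "\<dots> = (\<Sum>j\<in>L - {i}. of_bool (h x0 = j) * \<kappa> {x0, y} {i, j})"
        using fin hx[OF h] by (auto simp: of_bool_def if_distrib[of "\<lambda>a. a * _"] insert_commute cong: if_cong)
      finally show "(\<Sum>z\<in>L - h ` X. \<kappa> {x0, y} {h x0, z} * of_bool (z = i)) \<le> (\<Sum>j\<in>L - {i}. of_bool (h x0 = j) * \<kappa> {x0, y} {i, j})" .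
    qed
    also have "\<dots> = (\<Sum>j\<in>L - {i}. \<kappa> {x0, y} {i, j} * (\<Sum>h\<in>embeddings X L. edge_weight \<kappa> E h * of_bool (h x0 = j)))"
      by (simp add: sum_distrib_left mult_ac) (rule sum.swap)
    also have "\<dots> \<le> (\<Sum>j\<in>L - {i}. \<kappa> {x0, y} {i, j} * (\<Prod>e\<in>E. \<rho> e))"
      using leaf.IH[OF leaf.prems(1) T(3)] nn by (intro sum_mono mult_left_mono) auto
    also have "\<dots> \<le> \<rho> {x0, y} * (\<Prod>e\<in>E. \<rho> e)"
      unfolding sum_distrib_right[symmetric] using row'[OF leaf.prems(3)] nn
      by (intro mult_right_mono prod_nonneg) auto
    finally show ?thesis using E by simp
  qed
qed

lemma tree_sum_le:
  fixes \<kappa> :: "'i set \<Rightarrow> 'v set \<Rightarrow> real"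
  assumes tree: "tree_on X E" and fin: "finite L" and nn: "\<And>e s. 0 \<le> \<kappa> e s" "\<And>e. 0 \<le> \<rho> e"
    and row: "\<And>e i. e \<in> E \<Longrightarrow> i \<in> L \<Longrightarrow> (\<Sum>z\<in>L - {i}. \<kappa> e {i, z}) \<le> \<rho> e"
  shows "(\<Sum>h\<in>embeddings X L. edge_weight \<kappa> E h) \<le> real (card L) * (\<Prod>e\<in>E. \<rho> e)"
proof -
  obtain x where x: "x \<in> X" using tree by (cases rule: tree_on.cases) auto
  have "(\<Sum>h\<in>embeddings X L. edge_weight \<kappa> E h) = (\<Sum>h\<in>embeddings X L. \<Sum>i\<in>L. edge_weight \<kappa> E h * of_bool (h x = i))"
  proof (rule sum.cong[OF refl])
    fix h assume "h \<in> embeddings X L"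
    then have "h x \<in> L" using x by (auto simp: embeddings_def)
    then show "edge_weight \<kappa> E h = (\<Sum>i\<in>L. edge_weight \<kappa> E h * of_bool (h x = i))"
      using fin by (simp add: of_bool_def if_distrib[of "\<lambda>a. _ * a"] cong: if_cong)
  qed
  also have "\<dots> = (\<Sum>i\<in>L. \<Sum>h\<in>embeddings X L. edge_weight \<kappa> E h * of_bool (h x = i))" by (rule sum.swap)
  also have "\<dots> \<le> (\<Sum>i\<in>L. \<Prod>e\<in>E. \<rho> e)"
    by (intro sum_mono rooted_tree_sum_le[OF tree fin nn] row x)
  finally show ?thesis by simp
qed

text \<open>Attaching a leaf should multiply the sum by \<open>D k * W e\<close>, but rows near the
  ends fall short of this and the leaf must avoid the vertices already placed. The shortfall is
  controlled in total: every row is at most \<open>D k * \<rho> k e\<close>, the average row has the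
  same limit, and each site carries a uniformly bounded share of the smaller tree by
  \<open>rooted_tree_sum_le\<close>. The forbidden positions are bounded in number, and each costs
  at most \<open>D k * \<eta> k e\<close>, which is negligible against \<open>D k\<close>.\<close>

lemma tree_sum_limit:
  fixes \<kappa> :: "nat \<Rightarrow> 'i set \<Rightarrow> 'v set \<Rightarrow> real" and L :: "nat \<Rightarrow> 'v set" and D :: "nat \<Rightarrow> real"
  assumes tree: "tree_on X E" and fin: "\<And>k. finite (L k)" and ne: "\<And>k. L k \<noteq> {}"
    and D: "\<And>k. 0 < D k" and nn: "\<And>k e s. 0 \<le> \<kappa> k e s" "\<And>k e. 0 \<le> \<rho> k e" "\<And>k e. 0 \<le> \<eta> k e"
    and row: "\<And>k e i. e \<in> E \<Longrightarrow> i \<in> L k \<Longrightarrow> (\<Sum>z\<in>L k - {i}. \<kappa> k e {i, z}) \<le> D k * \<rho> k e"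
    and \<rho>: "\<And>e. e \<in> E \<Longrightarrow> (\<lambda>k. \<rho> k e) \<longlonglongrightarrow> W e"
    and tot: "\<And>e. e \<in> E \<Longrightarrow> (\<lambda>k. (\<Sum>i\<in>L k. \<Sum>z\<in>L k - {i}. \<kappa> k e {i, z}) / (card (L k) * D k)) \<longlonglongrightarrow> W e"
    and mx: "\<And>k e i z. e \<in> E \<Longrightarrow> \<kappa> k e {i, z} \<le> D k * \<eta> k e" and \<eta>: "\<And>e. e \<in> E \<Longrightarrow> (\<lambda>k. \<eta> k e) \<longlonglongrightarrow> 0"
  shows "(\<lambda>k. (\<Sum>h\<in>embeddings X (L k). edge_weight (\<kappa> k) E h) / (card (L k) * D k ^ card E)) \<longlonglongrightarrow> (\<Prod>e\<in>E. W e)"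
  using tree row \<rho> tot mx \<eta>
proof (induction rule: tree_on.induct)
  case (root r)
  have "(\<Sum>h\<in>embeddings {r} (L k). edge_weight (\<kappa> k) {} h) = real (card (L k))" for k
    unfolding sum_embeddings_singleton by (simp add: edge_weight_def)
  moreover have "real (card (L k)) / real (card (L k)) = 1" for k using fin ne by simp
  ultimately show ?case by simp
next
  case (leaf X E x y)
  note T = \<open>tree_on X E\<close> \<open>y \<notin> X\<close> \<open>x \<in> X\<close>
  define e0 where "e0 = {x, y}"
  have E: "e0 \<notin> E" "finite E" using tree_on_edges[OF T(1)] T(2) tree_on_finite[OF T(1)] by (auto simp: e0_def)
  define N where "N k = real (card (L k))" for k
  have N: "0 < N k" for k using fin ne by (simp add: N_def card_gt_0_iff)
  define S where "S k = (\<Sum>h\<in>embeddings X (L k). edge_weight (\<kappa> k) E h)" for k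
  define r where "r k i = (\<Sum>z\<in>L k - {i}. \<kappa> k e0 {i, z})" for k i
  \<comment> \<open>\<open>A\<close> collects the deviations of the rows from their limit, and
    \<open>B\<close> the positions that injectivity forbids.\<close>
  define A where "A k = (\<Sum>h\<in>embeddings X (L k). edge_weight (\<kappa> k) E h * (r k (h x) - D k * W e0))" for k
  define B where "B k = (\<Sum>h\<in>embeddings X (L k). edge_weight (\<kappa> k) E h * (\<Sum>z\<in>h ` X - {h x}. \<kappa> k e0 {h x, z}))" for k
  have IH: "(\<lambda>k. S k / (N k * D k ^ card E)) \<longlonglongrightarrow> (\<Prod>e\<in>E. W e)"
    unfolding S_def N_def using leaf.prems by (intro leaf.IH) auto
  have split: "(\<Sum>h\<in>embeddings (insert y X) (L k). edge_weight (\<kappa> k) (insert e0 E) h) = D k * W e0 * S k + A k - B k" for k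
  proof -
    have "(\<Sum>h\<in>embeddings (insert y X) (L k). edge_weight (\<kappa> k) (insert e0 E) h) =
      (\<Sum>h\<in>embeddings X (L k). edge_weight (\<kappa> k) E h * (\<Sum>z\<in>L k - h ` X. \<kappa> k e0 {h x, z}))"
      using sum_tree_leaf[OF T fin, of "\<kappa> k" "\<lambda>_. 1" k] by (simp add: e0_def)
    also have "\<dots> = (\<Sum>h\<in>embeddings X (L k). edge_weight (\<kappa> k) E h *
       (D k * W e0 + (r k (h x) - D k * W e0) - (\<Sum>z\<in>h ` X - {h x}. \<kappa> k e0 {h x, z})))"
    proof (rule sum.cong[OF refl])
      fix h assume "h \<in> embeddings X (L k)"
      then have h: "h ` X \<subseteq> L k" "h x \<in> h ` X" using T(3) by (auto simp: embeddings_def)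
      have "(\<Sum>z\<in>L k - h ` X. \<kappa> k e0 {h x, z}) + (\<Sum>z\<in>h ` X - {h x}. \<kappa> k e0 {h x, z}) = r k (h x)"
        unfolding r_def
      proof (subst sum.union_disjoint[symmetric])
        show "finite (L k - h ` X)" "finite (h ` X - {h x})" using fin h finite_subset by blast+
        have "L k - h ` X \<union> (h ` X - {h x}) = L k - {h x}" using h by auto
        then show "(\<Sum>z\<in>L k - h ` X \<union> (h ` X - {h x}). \<kappa> k e0 {h x, z}) = (\<Sum>z\<in>L k - {h x}. \<kappa> k e0 {h x, z})" by simp
      qed auto
      then have "(\<Sum>z\<in>L k - h ` X. \<kappa> k e0 {h x, z}) = D k * W e0 + (r k (h x) - D k * W e0) - (\<Sum>z\<in>h ` X - {h x}. \<kappa> k e0 {h x, z})"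
        by simp
      then show "edge_weight (\<kappa> k) E h * (\<Sum>z\<in>L k - h ` X. \<kappa> k e0 {h x, z}) =
        edge_weight (\<kappa> k) E h * (D k * W e0 + (r k (h x) - D k * W e0) - (\<Sum>z\<in>h ` X - {h x}. \<kappa> k e0 {h x, z}))"
        by simp
    qed
    also have "\<dots> = D k * W e0 * S k + A k - B k"
      unfolding A_def B_def S_def by (simp add: algebra_simps sum.distrib sum_subtractf sum_distrib_left)
    finally show ?thesis .
  qed
  have lim0: "(\<lambda>k. W e0 * (S k / (N k * D k ^ card E))) \<longlonglongrightarrow> W e0 * (\<Prod>e\<in>E. W e)"
    by (intro tendsto_intros IH)
  have limB: "(\<lambda>k. B k / (N k * D k ^ Suc (card E))) \<longlonglongrightarrow> 0"
  proof (rule tendsto_sandwich[where f = "\<lambda>_. 0"])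
    show "\<forall>\<^sub>F k in sequentially. 0 \<le> B k / (N k * D k ^ Suc (card E))"
    proof (rule always_eventually, rule allI)
      fix k
      have "0 \<le> B k" unfolding B_def by (intro sum_nonneg mult_nonneg_nonneg edge_weight_nonneg nn)
      then show "0 \<le> B k / (N k * D k ^ Suc (card E))" using N[of k] D[of k] by simp
    qed
    show "\<forall>\<^sub>F k in sequentially. B k / (N k * D k ^ Suc (card E)) \<le> real (card X) * \<eta> k e0 * (S k / (N k * D k ^ card E))"
    proof (rule always_eventually, rule allI)
      fix k
      have "B k \<le> (\<Sum>h\<in>embeddings X (L k). edge_weight (\<kappa> k) E h * (card X * (D k * \<eta> k e0)))"
        unfolding B_def
      proof (intro sum_mono mult_left_mono edge_weight_nonneg nn)
        fix h :: "'i \<Rightarrow> 'v"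
        have "(\<Sum>z\<in>h ` X - {h x}. \<kappa> k e0 {h x, z}) \<le> real (card (h ` X - {h x})) * (D k * \<eta> k e0)"
          using leaf.prems(4)[of e0 k] by (intro sum_bounded_above) (auto simp: e0_def)
        also have "\<dots> \<le> card X * (D k * \<eta> k e0)"
        proof -
          have "card (h ` X - {h x}) \<le> card X"
            using tree_on_finite[OF T(1)] card_image_le[of X h] card_mono[of "h ` X" "h ` X - {h x}"] by auto
          then show ?thesis using D[of k] nn(3) by (intro mult_right_mono) auto
        qed
        finally show "(\<Sum>z\<in>h ` X - {h x}. \<kappa> k e0 {h x, z}) \<le> card X * (D k * \<eta> k e0)" .
      qed
      also have "\<dots> = D k * (card X * \<eta> k e0 * S k)" unfolding S_def sum_distrib_right[symmetric] by (simp add: mult_ac)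
      finally have "B k / (N k * D k ^ Suc (card E)) \<le> D k * (card X * \<eta> k e0 * S k) / (N k * D k ^ Suc (card E))"
        using N[of k] D[of k] by (intro divide_right_mono) auto
      also have "\<dots> = real (card X) * \<eta> k e0 * (S k / (N k * D k ^ card E))" using D[of k] by simp
      finally show "B k / (N k * D k ^ Suc (card E)) \<le> real (card X) * \<eta> k e0 * (S k / (N k * D k ^ card E))" .
    qed
    have "(\<lambda>k. real (card X) * \<eta> k e0 * (S k / (N k * D k ^ card E))) \<longlonglongrightarrow> real (card X) * 0 * (\<Prod>e\<in>E. W e)"
      by (intro tendsto_intros IH leaf.prems(5)) (auto simp: e0_def)
    then show "(\<lambda>k. real (card X) * \<eta> k e0 * (S k / (N k * D k ^ card E))) \<longlonglongrightarrow> 0" by simp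
  qed simp
  have limA: "(\<lambda>k. A k / (N k * D k ^ Suc (card E))) \<longlonglongrightarrow> 0"
  proof (rule Lim_null_comparison)
    \<comment> \<open>The first two terms are the average deficit of the rows below their common
      bound, the third the distance of that bound from its limit; all of them cancel in the
      limit.\<close>
    define U where "U k = (\<rho> k e0 - (\<Sum>i\<in>L k. r k i) / (N k * D k) + \<bar>\<rho> k e0 - W e0\<bar>) * (\<Prod>e\<in>E. \<rho> k e)" for k
    show "\<forall>\<^sub>F k in sequentially. norm (A k / (N k * D k ^ Suc (card E))) \<le> U k"
    proof (rule always_eventually, rule allI)
      fix k
      have rk: "r k i \<le> D k * \<rho> k e0" if "i \<in> L k" for i
        unfolding r_def using that leaf.prems(1)[of e0] by (simp add: e0_def)
      have "\<bar>A k\<bar> \<le> (\<Sum>h\<in>embeddings X (L k). edge_weight (\<kappa> k) E h * \<bar>r k (h x) - D k * W e0\<bar>)"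
        unfolding A_def using edge_weight_nonneg[of "\<kappa> k" E] nn
        by (intro order_trans[OF sum_abs] sum_mono) (simp add: abs_mult)
      also have "\<dots> = (\<Sum>h\<in>embeddings X (L k). \<Sum>i\<in>L k. \<bar>r k i - D k * W e0\<bar> * (edge_weight (\<kappa> k) E h * of_bool (h x = i)))"
      proof (rule sum.cong[OF refl])
        fix h assume "h \<in> embeddings X (L k)"
        then have "h x \<in> L k" using T(3) by (auto simp: embeddings_def)
        then show "edge_weight (\<kappa> k) E h * \<bar>r k (h x) - D k * W e0\<bar> =
          (\<Sum>i\<in>L k. \<bar>r k i - D k * W e0\<bar> * (edge_weight (\<kappa> k) E h * of_bool (h x = i)))"
          using fin[of k] by (simp add: of_bool_def if_distrib[of "\<lambda>a. _ * a"] cong: if_cong)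
      qed
      also have "\<dots> = (\<Sum>i\<in>L k. \<bar>r k i - D k * W e0\<bar> * (\<Sum>h\<in>embeddings X (L k). edge_weight (\<kappa> k) E h * of_bool (h x = i)))"
        unfolding sum_distrib_left by (rule sum.swap)
      also have "\<dots> \<le> (\<Sum>i\<in>L k. (D k * \<rho> k e0 - r k i + D k * \<bar>\<rho> k e0 - W e0\<bar>) * (\<Prod>e\<in>E. D k * \<rho> k e))"
      proof (intro sum_mono mult_mono)
        fix i assume i: "i \<in> L k"
        \<comment> \<open>Passing through the upper bound \<open>D k * \<rho> k e0\<close> gives the
          first difference a fixed sign, so its sum over \<open>i\<close> is determined by the total
          of the rows.\<close>
        have "\<bar>r k i - D k * W e0\<bar> \<le> \<bar>r k i - D k * \<rho> k e0\<bar> + \<bar>D k * \<rho> k e0 - D k * W e0\<bar>" by linarith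
        also have "\<bar>r k i - D k * \<rho> k e0\<bar> = D k * \<rho> k e0 - r k i" using rk[OF i] by simp
        also have "\<bar>D k * \<rho> k e0 - D k * W e0\<bar> = D k * \<bar>\<rho> k e0 - W e0\<bar>"
          using D[of k] by (simp add: right_diff_distrib[symmetric] abs_mult)
        finally show "\<bar>r k i - D k * W e0\<bar> \<le> D k * \<rho> k e0 - r k i + D k * \<bar>\<rho> k e0 - W e0\<bar>" .
        show "(\<Sum>h\<in>embeddings X (L k). edge_weight (\<kappa> k) E h * of_bool (h x = i)) \<le> (\<Prod>e\<in>E. D k * \<rho> k e)"
          using leaf.prems(1) D[of k] nn i by (intro rooted_tree_sum_le[OF T(1) fin]) (auto intro: T(3))
        show "0 \<le> D k * \<rho> k e0 - r k i + D k * \<bar>\<rho> k e0 - W e0\<bar>" using rk[OF i] D[of k] by simp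
        show "0 \<le> (\<Sum>h\<in>embeddings X (L k). edge_weight (\<kappa> k) E h * of_bool (h x = i))"
          by (intro sum_nonneg mult_nonneg_nonneg edge_weight_nonneg nn) auto
      qed
      also have "\<dots> = (N k * D k * \<rho> k e0 - (\<Sum>i\<in>L k. r k i) + N k * D k * \<bar>\<rho> k e0 - W e0\<bar>) * (D k ^ card E * (\<Prod>e\<in>E. \<rho> k e))"
        unfolding sum_distrib_right[symmetric] N_def by (simp add: sum.distrib sum_subtractf prod.distrib algebra_simps)
      also have "\<dots> = U k * (N k * D k ^ Suc (card E))"
        unfolding U_def using N[of k] D[of k] by (simp add: field_simps)
      finally show "norm (A k / (N k * D k ^ Suc (card E))) \<le> U k"
        using N[of k] D[of k] by (simp add: pos_divide_le_eq abs_mult)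
    qed
    have "U \<longlonglongrightarrow> (W e0 - W e0 + \<bar>W e0 - W e0\<bar>) * (\<Prod>e\<in>E. W e)"
      unfolding U_def r_def N_def using leaf.prems(2,3) by (intro tendsto_intros) (auto simp: e0_def)
    then show "U \<longlonglongrightarrow> 0" by simp
  qed
  have "(\<lambda>k. W e0 * (S k / (N k * D k ^ card E)) + A k / (N k * D k ^ Suc (card E)) - B k / (N k * D k ^ Suc (card E)))
      \<longlonglongrightarrow> W e0 * (\<Prod>e\<in>E. W e) + 0 - 0"
    by (intro tendsto_intros lim0 limA limB)
  moreover have "W e0 * (S k / (N k * D k ^ card E)) + A k / (N k * D k ^ Suc (card E)) - B k / (N k * D k ^ Suc (card E)) =
     (\<Sum>h\<in>embeddings (insert y X) (L k). edge_weight (\<kappa> k) (insert e0 E) h) / (N k * D k ^ card (insert e0 E))" for k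
    unfolding split using E D[of k] N[of k] by (simp add: field_simps)
  ultimately show ?case using E by (simp add: N_def e0_def)
qed

section \<open>Coincidence patterns of walks\<close>

text \<open>The position \<open>(b, i)\<close> stands for the \<open>i\<close>-th vertex of the \<open>b\<close>-th of \<open>r\<close> walks of length \<open>q\<close>.\<close>

definition positions :: "nat \<Rightarrow> nat \<Rightarrow> (nat \<times> nat) set" where
  "positions r q = {..<r} \<times> {..q}"

definition walk_edge :: "(nat \<times> nat \<Rightarrow> 'v) \<Rightarrow> nat \<times> nat \<Rightarrow> 'v set" where
  "walk_edge f s = {f s, f (fst s, Suc (snd s))}"

definition all_edges :: "nat \<Rightarrow> nat \<Rightarrow> (nat \<times> nat \<Rightarrow> 'v) \<Rightarrow> 'v set set" where
  "all_edges r q f = walk_edge f ` ({..<r} \<times> {..<q})"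

definition edge_mult :: "nat \<Rightarrow> nat \<Rightarrow> (nat \<times> nat \<Rightarrow> 'v) \<Rightarrow> 'v set \<Rightarrow> nat" where
  "edge_mult r q f e = card {s \<in> {..<r} \<times> {..<q}. walk_edge f s = e}"

definition proper :: "nat \<Rightarrow> nat \<Rightarrow> (nat \<times> nat \<Rightarrow> 'v) \<Rightarrow> bool" where
  "proper r q f \<longleftrightarrow> (\<forall>a<r. \<forall>i<q. f (a, i) \<noteq> f (a, Suc i))"

text \<open>Each walk may be attached to any earlier one, not only to its predecessor. For three
  walks this is exactly the range \<open>Nb i \<union> Nb j\<close> of the third index in the error
  of the normal approximation.\<close>

definition linked :: "nat \<Rightarrow> nat \<Rightarrow> (nat \<times> nat \<Rightarrow> 'v) \<Rightarrow> bool" where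
  "linked r q f \<longleftrightarrow> (\<forall>a<r. 0 < a \<longrightarrow> (\<exists>i<q. \<exists>b<a. \<exists>j<q. walk_edge f (a, i) = walk_edge f (b, j)))"

text \<open>
  The chosen representative depends only on the level set of \<open>f\<close>, so \<open>canon I f\<close> encodes exactly
  which positions carry the same vertex.
\<close>

definition canon :: "'i set \<Rightarrow> ('i \<Rightarrow> 'v) \<Rightarrow> 'i \<Rightarrow> 'i" where
  "canon I f = (\<lambda>x\<in>I. SOME y. y \<in> I \<and> f y = f x)"

definition same_kernel :: "'i set \<Rightarrow> ('i \<Rightarrow> 'v) \<Rightarrow> ('i \<Rightarrow> 'w) \<Rightarrow> bool" where
  "same_kernel I f g \<longleftrightarrow> (\<forall>x\<in>I. \<forall>y\<in>I. f x = f y \<longleftrightarrow> g x = g y)"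

lemma canon_in: "x \<in> I \<Longrightarrow> canon I f x \<in> I"
  and canon_eq: "x \<in> I \<Longrightarrow> f (canon I f x) = f x"
  unfolding canon_def using someI[of "\<lambda>y. y \<in> I \<and> f y = f x" x] by auto

lemma canon_PiE: "canon I f \<in> I \<rightarrow>\<^sub>E I"
  using canon_in[of _ I f] by (auto simp: canon_def)

lemma same_kernel_canon: "same_kernel I (canon I f) f"
proof -
  have "canon I f x = canon I f y" if "f x = f y" "x \<in> I" "y \<in> I" for x y
    using that by (simp add: canon_def)
  then show ?thesis unfolding same_kernel_def by (metis canon_eq)
qed

lemma same_kernel_sym: "same_kernel I f g \<Longrightarrow> same_kernel I g f"
  by (simp add: same_kernel_def)

lemma same_kernel_trans: "same_kernel I f g \<Longrightarrow> same_kernel I g h \<Longrightarrow> same_kernel I f h"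
  by (simp add: same_kernel_def)

lemma canon_cong: "same_kernel I f g \<Longrightarrow> canon I f = canon I g"
proof -
  assume "same_kernel I f g"
  then have "(y \<in> I \<and> f y = f x) = (y \<in> I \<and> g y = g x)" if "x \<in> I" for x y
    using that by (auto simp: same_kernel_def)
  then show ?thesis unfolding canon_def by (intro restrict_ext) (simp cong: conj_cong)
qed

lemma canon_eq_iff: "canon I f = canon I g \<longleftrightarrow> same_kernel I f g"
  by (metis canon_cong same_kernel_canon same_kernel_sym same_kernel_trans)

lemma canon_canon: "canon I (canon I f) = canon I f"
  by (intro canon_cong same_kernel_canon)

lemma same_kernel_card:
  assumes "same_kernel I f g"
  shows "card (f ` I) = card (g ` I)"
proof -
  have "bij_betw (\<lambda>v. g (SOME x. x \<in> I \<and> f x = v)) (f ` I) (g ` I)"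
  proof -
    define s where "s v = (SOME x. x \<in> I \<and> f x = v)" for v
    have s: "s (f x) \<in> I \<and> f (s (f x)) = f x" if "x \<in> I" for x
      unfolding s_def by (rule someI[of _ x]) (use that in auto)
    have gs: "g (s (f x)) = g x" if "x \<in> I" for x
      using assms s[OF that] that unfolding same_kernel_def by blast
    have "inj_on (\<lambda>v. g (s v)) (f ` I)"
      using gs assms unfolding inj_on_def same_kernel_def by auto
    moreover have "(\<lambda>v. g (s v)) ` f ` I = g ` I" using gs by (force simp: image_image)
    ultimately show ?thesis by (simp add: bij_betw_def s_def)
  qed
  then show ?thesis by (rule bij_betw_same_card)
qed

lemma finite_positions: "finite (positions r q)"
  by (simp add: positions_def)

lemma walk_edge_same_kernel:
  assumes "same_kernel (positions r q) f g" "a < r" "i < q" "b < r" "j < q"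
  shows "walk_edge f (a, i) = walk_edge f (b, j) \<longleftrightarrow> walk_edge g (a, i) = walk_edge g (b, j)"
proof -
  have "f x = f y \<longleftrightarrow> g x = g y" if "x \<in> {(a, i), (a, Suc i), (b, j), (b, Suc j)}" "y \<in> {(a, i), (a, Suc i), (b, j), (b, Suc j)}" for x y
    using assms that unfolding same_kernel_def positions_def by auto
  then show ?thesis by (simp add: walk_edge_def doubleton_eq_iff)
qed

lemma proper_same_kernel:
  assumes "same_kernel (positions r q) f g" shows "proper r q f \<longleftrightarrow> proper r q g"
proof -
  have "f (a, i) = f (a, Suc i) \<longleftrightarrow> g (a, i) = g (a, Suc i)" if "a < r" "i < q" for a i
    using assms that unfolding same_kernel_def positions_def by auto
  then show ?thesis by (simp add: proper_def)
qed

lemma linked_same_kernel: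
  assumes "same_kernel (positions r q) f g" shows "linked r q f \<longleftrightarrow> linked r q g"
  unfolding linked_def using walk_edge_same_kernel[OF assms] by (meson less_trans)

section \<open>Decomposition of sums by coincidence pattern\<close>

text \<open>Fixed points of \<open>canon\<close> represent the partitions of the positions. Their
  number does not involve the size of the matrix, so limits may be taken pattern by pattern.\<close>

definition patterns :: "nat \<Rightarrow> nat \<Rightarrow> (nat \<times> nat \<Rightarrow> nat \<times> nat) set" where
  "patterns r q = {g. canon (positions r q) g = g \<and> proper r q g \<and> linked r q g}"

lemma finite_patterns: "finite (patterns r q)"
proof (rule finite_subset)
  show "patterns r q \<subseteq> positions r q \<rightarrow>\<^sub>E positions r q"
  proof
    fix g assume "g \<in> patterns r q"
    then have "canon (positions r q) g = g" by (simp add: patterns_def)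
    then show "g \<in> positions r q \<rightarrow>\<^sub>E positions r q" using canon_PiE[of "positions r q" g] by simp
  qed
qed (intro finite_PiE finite_positions)

lemma canon_in_patterns:
  "proper r q f \<Longrightarrow> linked r q f \<Longrightarrow> canon (positions r q) f \<in> patterns r q"
  using proper_same_kernel[OF same_kernel_canon, of r q f] linked_same_kernel[OF same_kernel_canon, of r q f]
  by (simp add: patterns_def canon_canon)

text \<open>A function on positions corresponds to its pattern together with its values on the
  representatives. Distinct representatives carry distinct values, so these values form an
  embedding; conversely, composing an embedding with the pattern recovers the function, since the
  pattern fixes its own representatives.\<close>

lemma sum_over_patterns:
  fixes F :: "(nat \<times> nat \<Rightarrow> 'v) \<Rightarrow> real" and r q :: nat
  assumes L: "finite L"
  defines "I \<equiv> positions r q"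
  shows "(\<Sum>f\<in>{f \<in> I \<rightarrow>\<^sub>E L. proper r q f \<and> linked r q f}. F f) =
    (\<Sum>g\<in>patterns r q. \<Sum>h\<in>embeddings (g ` I) L. F (\<lambda>x\<in>I. h (g x)))"
proof -
  have finI: "finite I" by (simp add: I_def finite_positions)
  have "(\<Sum>g\<in>patterns r q. \<Sum>h\<in>embeddings (g ` I) L. F (\<lambda>x\<in>I. h (g x))) =
    (\<Sum>(g, h)\<in>Sigma (patterns r q) (\<lambda>g. embeddings (g ` I) L). F (\<lambda>x\<in>I. h (g x)))"
    using finI L by (subst sum.Sigma) (auto intro: finite_embeddings finite_patterns)
  also have "\<dots> = (\<Sum>f\<in>{f \<in> I \<rightarrow>\<^sub>E L. proper r q f \<and> linked r q f}. F f)"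
  proof (rule sum.reindex_bij_witness[of _ "\<lambda>f. (canon I f, restrict f (canon I f ` I))" "\<lambda>(g, h). \<lambda>x\<in>I. h (g x)"])
    fix p assume "p \<in> Sigma (patterns r q) (\<lambda>g. embeddings (g ` I) L)"
    then obtain g h where p: "p = (g, h)" "g \<in> patterns r q" "h \<in> g ` I \<rightarrow>\<^sub>E L" "inj_on h (g ` I)"
      by (auto simp: embeddings_def)
    have g: "canon I g = g" "proper r q g" "linked r q g" using p(2) by (auto simp: patterns_def I_def)
    have gI: "g x \<in> I" "g (g x) = g x" if "x \<in> I" for x
      using canon_in[OF that, of g] canon_eq[OF that, of g] unfolding g(1) by auto
    let ?f = "\<lambda>x\<in>I. h (g x)"
    have sk: "same_kernel I ?f g"
      using p(4) by (auto simp: same_kernel_def inj_on_def)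
    have c: "canon I ?f = g" using canon_cong[OF sk] g(1) by simp
    have "restrict ?f (g ` I) = h"
    proof
      fix y
      show "restrict ?f (g ` I) y = h y"
      proof (cases "y \<in> g ` I")
        case True
        then show ?thesis using gI by auto
      next
        case False
        then show ?thesis using PiE_arb[OF p(3) False] by simp
      qed
    qed
    then show "(canon I (case p of (g, h) \<Rightarrow> \<lambda>x\<in>I. h (g x)), restrict (case p of (g, h) \<Rightarrow> \<lambda>x\<in>I. h (g x)) (canon I (case p of (g, h) \<Rightarrow> \<lambda>x\<in>I. h (g x)) ` I)) = p"
      by (simp add: p(1) c)
    have "?f \<in> I \<rightarrow>\<^sub>E L" using p(3) by auto
    moreover have "proper r q ?f" "linked r q ?f"
      using g proper_same_kernel[OF sk[unfolded I_def]] linked_same_kernel[OF sk[unfolded I_def]] by (auto simp: I_def)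
    ultimately show "(case p of (g, h) \<Rightarrow> \<lambda>x\<in>I. h (g x)) \<in> {f \<in> I \<rightarrow>\<^sub>E L. proper r q f \<and> linked r q f}"
      by (simp add: p(1))
  next
    fix f assume f: "f \<in> {f \<in> I \<rightarrow>\<^sub>E L. proper r q f \<and> linked r q f}"
    show "(case (canon I f, restrict f (canon I f ` I)) of (g, h) \<Rightarrow> \<lambda>x\<in>I. h (g x)) = f"
    proof
      fix x
      show "(case (canon I f, restrict f (canon I f ` I)) of (g, h) \<Rightarrow> \<lambda>x\<in>I. h (g x)) x = f x"
      proof (cases "x \<in> I")
        case True
        then show ?thesis by (simp add: canon_eq)
      next
        case False
        then show ?thesis using PiE_arb[of f I "\<lambda>_. L" x] f by simp
      qed
    qed
    have "canon I f \<in> patterns r q" using canon_in_patterns f by (auto simp: I_def)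
    moreover have "restrict f (canon I f ` I) \<in> embeddings (canon I f ` I) L"
    proof -
      have "inj_on f (canon I f ` I)"
        using same_kernel_canon[of I f] by (auto simp: inj_on_def same_kernel_def canon_eq)
      then show ?thesis using f canon_in[of _ I f] by (auto simp: embeddings_def)
    qed
    ultimately show "(canon I f, restrict f (canon I f ` I)) \<in> Sigma (patterns r q) (\<lambda>g. embeddings (g ` I) L)" by simp
  qed (auto split: prod.split)
  finally show ?thesis by simp
qed

text \<open>An injective \<open>h\<close> maps edges injectively to edges, so traversal counts are
  those of the pattern alone and the product becomes an edge weight of \<open>h\<close>.\<close>

lemma edge_product_embedding:
  fixes K :: "nat \<Rightarrow> 'v set \<Rightarrow> real"
  assumes h: "inj_on h (g ` positions r q)" and "1 \<le> r"
  shows "(\<Prod>e\<in>all_edges r q (\<lambda>x\<in>positions r q. h (g x)). K (edge_mult r q (\<lambda>x\<in>positions r q. h (g x)) e) e) =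
     edge_weight (\<lambda>e s. K (edge_mult r q g e) s) (all_edges r q g) h"
proof -
  let ?I = "positions r q" and ?f = "\<lambda>x\<in>positions r q. h (g x)"
  have we: "walk_edge ?f s = h ` walk_edge g s" if "s \<in> {..<r} \<times> {..<q}" for s
    using that by (auto simp: walk_edge_def positions_def)
  have sub: "walk_edge g s \<subseteq> g ` ?I" if "s \<in> {..<r} \<times> {..<q}" for s
    using that by (auto simp: walk_edge_def positions_def)
  have inj: "inj_on ((`) h) (all_edges r q g)"
    unfolding all_edges_def by (intro inj_on_subset[OF inj_on_image_Pow[OF h]]) (use sub in blast)
  have ae: "all_edges r q ?f = (`) h ` all_edges r q g"
    unfolding all_edges_def image_image using we by (intro image_cong) auto
  have mu: "edge_mult r q ?f (h ` e) = edge_mult r q g e" if "e \<in> all_edges r q g" for e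
  proof -
    have "walk_edge ?f s = h ` e \<longleftrightarrow> walk_edge g s = e" if s: "s \<in> {..<r} \<times> {..<q}" for s
      using we[OF s] inj_onD[OF inj, of "walk_edge g s" e] s \<open>e \<in> all_edges r q g\<close>
      by (auto simp: all_edges_def)
    then show ?thesis unfolding edge_mult_def by (intro arg_cong[of _ _ card]) auto
  qed
  show ?thesis unfolding ae edge_weight_def
    by (subst prod.reindex[OF inj]) (simp add: mu)
qed

section \<open>Spanning trees and edge counts of patterns\<close>

text \<open>From a vertex of the walk that already lies in the tree, the tree is grown forwards to
  the end of the walk and then backwards to its start. A step to a new vertex adds one leaf, a step
  to an old one adds nothing.\<close>

lemma tree_on_walk:
  assumes T: "tree_on X T" "T \<subseteq> E" and i: "i \<le> q" "v i \<in> X"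
    and E: "\<And>j. j < q \<Longrightarrow> {v j, v (Suc j)} \<in> E"
  shows "\<exists>T'. tree_on (X \<union> v ` {..q}) T' \<and> T' \<subseteq> E"
proof -
  have fw: "\<exists>T'. tree_on (X \<union> v ` {i..i + d}) T' \<and> T' \<subseteq> E" if "i + d \<le> q" for d
    using that
  proof (induction d)
    case 0
    have "X \<union> v ` {i..i + 0} = X" using i by auto
    then show ?case using T by auto
  next
    case (Suc d)
    then obtain T' where T': "tree_on (X \<union> v ` {i..i + d}) T'" "T' \<subseteq> E" by auto
    obtain T'' where "tree_on (insert (v (Suc (i + d))) (X \<union> v ` {i..i + d})) T''" "T'' \<subseteq> insert {v (i + d), v (Suc (i + d))} T'"
      using tree_on_extend[OF T'(1), of "v (i + d)" "v (Suc (i + d))"] by auto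
    moreover have "insert (v (Suc (i + d))) (X \<union> v ` {i..i + d}) = X \<union> v ` {i..i + Suc d}"
      by (auto simp: atLeastAtMostSuc_conv)
    ultimately show ?case using T'(2) E[of "i + d"] Suc.prems by (metis Suc_le_lessD add_Suc_right insert_subset subset_trans)
  qed
  obtain T1 where T1: "tree_on (X \<union> v ` {i..q}) T1" "T1 \<subseteq> E" using fw[of "q - i"] i by auto
  have bw: "\<exists>T'. tree_on (X \<union> v ` {i - d..q}) T' \<and> T' \<subseteq> E" if "d \<le> i" for d
    using that
  proof (induction d)
    case 0
    then show ?case using T1 by auto
  next
    case (Suc d)
    then obtain T' where T': "tree_on (X \<union> v ` {i - d..q}) T'" "T' \<subseteq> E" by auto
    have s: "Suc (i - Suc d) = i - d" using Suc.prems by auto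
    obtain T'' where T'': "tree_on (insert (v (i - Suc d)) (X \<union> v ` {i - d..q})) T''" "T'' \<subseteq> insert {v (i - d), v (i - Suc d)} T'"
      using tree_on_extend[OF T'(1), of "v (i - d)" "v (i - Suc d)"] i by auto
    have "{i - Suc d..q} = insert (i - Suc d) {i - d..q}" using s i by auto
    then have "insert (v (i - Suc d)) (X \<union> v ` {i - d..q}) = X \<union> v ` {i - Suc d..q}" by auto
    moreover have "{v (i - d), v (i - Suc d)} \<in> E" using E[of "i - Suc d"] s i Suc.prems by (simp add: insert_commute)
    ultimately show ?case using T'' T'(2) by (metis insert_subset subset_trans)
  qed
  show ?thesis using bw[of i] by (simp add: atLeast0AtMost)
qed

text \<open>The walks are absorbed one after the other; an edge shared with an earlier walk provides
  the vertex at which \<open>tree_on_walk\<close> can start.\<close>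

lemma pattern_spanning_tree:
  assumes "linked r q g" "1 \<le> r" "1 \<le> q"
  shows "\<exists>T. tree_on (g ` positions r q) T \<and> T \<subseteq> all_edges r q g"
proof -
  let ?E = "all_edges r q g"
  have E: "{g (a, j), g (a, Suc j)} \<in> ?E" if "a < r" "j < q" for a j
    using that unfolding all_edges_def by (intro image_eqI[of _ _ "(a, j)"]) (auto simp: walk_edge_def)
  have "\<exists>T. tree_on (g ` positions (Suc a) q) T \<and> T \<subseteq> ?E" if "Suc a \<le> r" for a
    using that
  proof (induction a)
    case 0
    have "g ` positions (Suc 0) q = {g (0, 0)} \<union> (\<lambda>i. g (0, i)) ` {..q}"
      by (auto simp: positions_def)
    then show ?case
      using tree_on_walk[OF tree_on.root, of ?E 0 q "\<lambda>i. g (0, i)" "g (0, 0)"] E[of 0] 0 by auto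
  next
    case (Suc a)
    then obtain T where T: "tree_on (g ` positions (Suc a) q) T" "T \<subseteq> ?E" by auto
    obtain i b j where ij: "i < q" "b < Suc a" "j < q" "walk_edge g (Suc a, i) = walk_edge g (b, j)"
      using assms(1) Suc.prems unfolding linked_def by (metis Suc_le_eq zero_less_Suc)
    have "g (Suc a, i) \<in> walk_edge g (b, j)" unfolding ij(4)[symmetric] by (simp add: walk_edge_def)
    then have "g (Suc a, i) \<in> g ` positions (Suc a) q"
      using ij by (auto simp: walk_edge_def positions_def)
    from tree_on_walk[OF T, where v = "\<lambda>i. g (Suc a, i)", OF _ this, of q] have "\<exists>T'. tree_on (g ` positions (Suc a) q \<union> (\<lambda>i. g (Suc a, i)) ` {..q}) T' \<and> T' \<subseteq> ?E"
      using E[of "Suc a"] ij Suc.prems by auto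
    moreover have "g ` positions (Suc a) q \<union> (\<lambda>i. g (Suc a, i)) ` {..q} = g ` positions (Suc (Suc a)) q"
      by (auto simp: positions_def less_Suc_eq)
    ultimately show ?case by simp
  qed
  from this[of "r - 1"] show ?thesis using assms by simp
qed

lemma finite_all_edges: "finite (all_edges r q f)"
  by (simp add: all_edges_def)

text \<open>The first walk contributes at most \<open>q\<close> edges and each later one at most
  \<open>q - 1\<close> new ones, since at least one of its edges has already occurred.\<close>

lemma card_all_edges_linked:
  assumes "linked r q g" "1 \<le> r" "1 \<le> q"
  shows "card (all_edges r q g) + r \<le> r * q + 1"
proof -
  have "card (all_edges (Suc a) q g) + Suc a \<le> Suc a * q + 1" if "Suc a \<le> r" for a
    using that
  proof (induction a)
    case 0
    have "card (all_edges (Suc 0) q g) \<le> card ({..<Suc 0} \<times> {..<q})"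
      unfolding all_edges_def by (intro card_image_le) auto
    then show ?case by simp
  next
    case (Suc a)
    obtain i b j where ij: "i < q" "b < Suc a" "j < q" "walk_edge g (Suc a, i) = walk_edge g (b, j)"
      using assms(1) Suc.prems unfolding linked_def by (metis Suc_le_eq zero_less_Suc)
    have "all_edges (Suc (Suc a)) q g \<subseteq> all_edges (Suc a) q g \<union> (\<lambda>i. walk_edge g (Suc a, i)) ` ({..<q} - {i})"
    proof
      fix e assume "e \<in> all_edges (Suc (Suc a)) q g"
      then obtain a' i' where e: "a' < Suc (Suc a)" "i' < q" "e = walk_edge g (a', i')" by (auto simp: all_edges_def)
      show "e \<in> all_edges (Suc a) q g \<union> (\<lambda>i. walk_edge g (Suc a, i)) ` ({..<q} - {i})"
      proof (cases "a' < Suc a")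
        case True
        then show ?thesis using e by (auto simp: all_edges_def)
      next
        case False
        then have "a' = Suc a" using e by simp
        then show ?thesis using e ij by (cases "i' = i") (auto simp: all_edges_def)
      qed
    qed
    then have "card (all_edges (Suc (Suc a)) q g) \<le> card (all_edges (Suc a) q g \<union> (\<lambda>i. walk_edge g (Suc a, i)) ` ({..<q} - {i}))"
      by (intro card_mono) (auto simp: finite_all_edges)
    also have "\<dots> \<le> card (all_edges (Suc a) q g) + card ((\<lambda>i. walk_edge g (Suc a, i)) ` ({..<q} - {i}))"
      by (rule card_Un_le)
    also have "card ((\<lambda>i. walk_edge g (Suc a, i)) ` ({..<q} - {i})) \<le> card ({..<q} - {i})"
      by (intro card_image_le) auto
    also have "card ({..<q} - {i}) = q - 1" using ij by simp
    finally show ?case using Suc ij(1) by simp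
  qed
  from this[of "r - 1"] show ?thesis using assms by simp
qed

lemma proper_card_ge2:
  assumes "proper r q g" "1 \<le> r" "1 \<le> q"
  shows "2 \<le> card (g ` positions r q)"
proof -
  have "{g (0, 0), g (0, Suc 0)} \<subseteq> g ` positions r q" using assms by (auto simp: positions_def)
  moreover have "g (0, 0) \<noteq> g (0, Suc 0)" using assms by (auto simp: proper_def)
  ultimately show ?thesis
    using card_mono[of "g ` positions r q" "{g (0, 0), g (0, Suc 0)}"] by (simp add: finite_positions)
qed

lemma sum_edge_mult: "(\<Sum>e\<in>all_edges r q g. edge_mult r q g e) = r * q"
proof -
  have "r * q = card ({..<r} \<times> {..<q})" by simp
  also have "\<dots> = (\<Sum>s\<in>{..<r} \<times> {..<q}. 1)" by simp
  also have "\<dots> = (\<Sum>e\<in>all_edges r q g. \<Sum>s | s \<in> {..<r} \<times> {..<q} \<and> walk_edge g s = e. 1)"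
    unfolding all_edges_def by (rule sum.image_gen) simp
  finally show ?thesis by (simp add: edge_mult_def)
qed

lemma edge_mult_pos: "e \<in> all_edges r q g \<Longrightarrow> 1 \<le> edge_mult r q g e"
  unfolding all_edges_def edge_mult_def by (auto simp: Suc_le_eq card_gt_0_iff)

text \<open>Source of the extreme exponents: a pair has at most 2q vertices and a triple at most 3q
  - 1, hence spanning trees with at most 2q - 1 and 3q - 2 edges.\<close>

lemma card_pattern_le:
  assumes "g \<in> patterns r q" "1 \<le> r" "1 \<le> q"
  shows "card (g ` positions r q) \<le> Suc (card (all_edges r q g))" "card (g ` positions r q) + r \<le> r * q + 2"
proof -
  have l: "linked r q g" using assms by (simp add: patterns_def)
  obtain T where T: "tree_on (g ` positions r q) T" "T \<subseteq> all_edges r q g"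
    using pattern_spanning_tree[OF l assms(2,3)] by auto
  show *: "card (g ` positions r q) \<le> Suc (card (all_edges r q g))"
    using tree_on_card[OF T(1)] card_mono[OF finite_all_edges T(2)] by simp
  show "card (g ` positions r q) + r \<le> r * q + 2"
    using * card_all_edges_linked[OF l assms(2,3)] by simp
qed

section \<open>Patterns of extreme size for two walks\<close>

text \<open>The upper bound for linked walks and the lower bound from the spanning tree coincide at
  2q - 1 edges. The multiplicities are positive and add up to 2q, so exactly one edge has
  multiplicity 2 and all others have multiplicity 1.\<close>

lemma all_edges_top_pattern:
  assumes g: "g \<in> patterns 2 q" "1 \<le> q" and card: "card (g ` positions 2 q) = 2 * q"
  shows "card (all_edges 2 q g) = 2 * q - 1"
    and "(\<Prod>e\<in>all_edges 2 q g. W (edge_mult 2 q g e)) = W 1 ^ (2 * q - 2) * (W 2 :: real)"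
proof -
  let ?E = "all_edges 2 q g"
  have "linked 2 q g" using g by (simp add: patterns_def)
  then show cE: "card ?E = 2 * q - 1"
    using card_pattern_le(1)[OF g(1) _ g(2)] card_all_edges_linked[of 2 q g] card g(2) by simp
  have "(\<Sum>e\<in>?E. edge_mult 2 q g e - 1) = (\<Sum>e\<in>?E. edge_mult 2 q g e) - (\<Sum>e\<in>?E. 1)"
    by (rule sum_subtractf_nat) (rule edge_mult_pos)
  also have "\<dots> = 1" using cE g(2) by (simp add: sum_edge_mult)
  finally obtain e0 where e0: "e0 \<in> ?E" "edge_mult 2 q g e0 - 1 = 1" "\<And>e. e \<in> ?E \<Longrightarrow> e \<noteq> e0 \<Longrightarrow> edge_mult 2 q g e - 1 = 0"
    using sum_eq_1_iff[OF finite_all_edges, of "\<lambda>e. edge_mult 2 q g e - 1" 2 q g] by auto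
  have "(\<Prod>e\<in>?E. W (edge_mult 2 q g e)) = W (edge_mult 2 q g e0) * (\<Prod>e\<in>?E - {e0}. W (edge_mult 2 q g e))"
    using e0(1) finite_all_edges by (rule prod.remove[rotated])
  also have "edge_mult 2 q g e0 = 2" using e0(2) by simp
  also have "(\<Prod>e\<in>?E - {e0}. W (edge_mult 2 q g e)) = (\<Prod>e\<in>?E - {e0}. W 1)"
  proof (rule prod.cong[OF refl])
    fix e assume "e \<in> ?E - {e0}"
    then have "edge_mult 2 q g e = 1" using e0(3)[of e] edge_mult_pos[of e 2 q g] by auto
    then show "W (edge_mult 2 q g e) = W 1" by simp
  qed
  also have "\<dots> = W 1 ^ (2 * q - 2)" using e0(1) cE by (simp add: finite_all_edges numeral_2_eq_2)
  finally show "(\<Prod>e\<in>?E. W (edge_mult 2 q g e)) = W 1 ^ (2 * q - 2) * W 2" by simp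
qed

text \<open>Consecutive vertices differ, so with two vertices available every step uses the edge
  between them and its multiplicity is 2q.\<close>

lemma all_edges_single_edge_pattern:
  assumes g: "g \<in> patterns 2 q" "1 \<le> q" and card: "card (g ` positions 2 q) = 2"
  shows "card (all_edges 2 q g) = 1"
    and "(\<Prod>e\<in>all_edges 2 q g. W (edge_mult 2 q g e)) = (W (2 * q) :: real)"
proof -
  have p: "proper 2 q g" using g by (simp add: patterns_def)
  have "walk_edge g s = g ` positions 2 q" if s: "s \<in> {..<2} \<times> {..<q}" for s
  proof (rule card_subset_eq)
    show "walk_edge g s \<subseteq> g ` positions 2 q" using s by (auto simp: walk_edge_def positions_def)
    have "g s \<noteq> g (fst s, Suc (snd s))" using p s by (auto simp: proper_def)
    then show "card (walk_edge g s) = card (g ` positions 2 q)" by (simp add: walk_edge_def card)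
  qed (simp add: finite_positions)
  then have E: "all_edges 2 q g = {g ` positions 2 q}"
    using g(2) by (auto simp: all_edges_def image_iff intro!: exI[of _ 0])
  then show "card (all_edges 2 q g) = 1" by simp
  show "(\<Prod>e\<in>all_edges 2 q g. W (edge_mult 2 q g e)) = W (2 * q)"
    using sum_edge_mult[of 2 q g] unfolding E by simp
qed

lemma same_kernel_positions_2I:
  assumes "\<And>x y. x \<le> q \<Longrightarrow> y \<le> q \<Longrightarrow> f (0, x) = f (0, y) \<longleftrightarrow> g (0, x) = g (0, y)"
    and "\<And>x y. x \<le> q \<Longrightarrow> y \<le> q \<Longrightarrow> f (1, x) = f (1, y) \<longleftrightarrow> g (1, x) = g (1, y)"
    and "\<And>x y. x \<le> q \<Longrightarrow> y \<le> q \<Longrightarrow> f (0, x) = f (1, y) \<longleftrightarrow> g (0, x) = g (1, y)"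
  shows "same_kernel (positions 2 q) f g"
  unfolding same_kernel_def
proof (intro ballI)
  fix s t assume "s \<in> positions 2 q" "t \<in> positions 2 q"
  then obtain a x b y where "s = (a, x)" "t = (b, y)" "a = 0 \<or> a = 1" "b = 0 \<or> b = 1" "x \<le> q" "y \<le> q"
    by (auto simp: positions_def less_2_cases_iff)
  then show "f s = f t \<longleftrightarrow> g s = g t" using assms(1,2)[of x y] assms(3)[of x y] assms(3)[of y x] by metis
qed

text \<open>A proper walk on two vertices alternates, so its start determines it. The only freedom
  left is whether the second walk starts where the first does; \<open>f b\<close> is the parity
  colouring, with \<open>b\<close> true for opposite starts.\<close>

lemma card_single_edge_patterns:
  assumes "1 \<le> q"
  shows "card {g \<in> patterns 2 q. card (g ` positions 2 q) = 2} = 2"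
proof -
  define f where "f b = (\<lambda>(a, x). even (x + (if a = (1::nat) \<and> b then 1 else 0 :: nat)))" for b
  let ?I = "positions 2 q"
  have "inj_on (\<lambda>b. canon ?I (f b)) UNIV"
  proof (rule inj_onI)
    fix b b' assume "canon ?I (f b) = canon ?I (f b')"
    then have "same_kernel ?I (f b) (f b')" by (simp add: canon_eq_iff)
    then have "f b (0, 0) = f b (1, 0) \<longleftrightarrow> f b' (0, 0) = f b' (1, 0)" unfolding same_kernel_def by (simp add: positions_def)
    then show "b = b'" by (simp add: f_def split: if_splits)
  qed
  moreover have "(\<lambda>b. canon ?I (f b)) ` UNIV = {g \<in> patterns 2 q. card (g ` ?I) = 2}"
  proof (intro equalityI subsetI)
    fix g assume "g \<in> (\<lambda>b. canon ?I (f b)) ` UNIV"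
    then obtain b where g: "g = canon ?I (f b)" by auto
    have "proper 2 q (f b)" by (auto simp: proper_def f_def)
    moreover have "walk_edge (f b) s = UNIV" for s by (cases s) (auto simp: walk_edge_def f_def UNIV_bool)
    then have "linked 2 q (f b)" using assms unfolding linked_def by (auto intro!: exI[of _ 0])
    moreover have "f b ` ?I = UNIV"
    proof -
      have "f b (0, 0) \<in> f b ` ?I" "f b (0, 1) \<in> f b ` ?I" using assms by (auto simp: positions_def)
      then show ?thesis by (auto simp: f_def UNIV_bool)
    qed
    then have "card (g ` ?I) = 2"
      using same_kernel_card[OF same_kernel_canon, of ?I "f b"] by (simp add: g UNIV_bool)
    ultimately show "g \<in> {g \<in> patterns 2 q. card (g ` ?I) = 2}" using canon_in_patterns[of 2 q "f b"] by (simp add: g)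
  next
    fix g assume "g \<in> {g \<in> patterns 2 q. card (g ` ?I) = 2}"
    then have g: "canon ?I g = g" "proper 2 q g" "card (g ` ?I) = 2" by (auto simp: patterns_def)
    define A where "A = g (0, 0)"
    have "A \<in> g ` ?I" by (auto simp: A_def positions_def)
    then obtain B where B: "g ` ?I = {A, B}" "A \<noteq> B" using g(3) by (metis card_2_iff doubleton_eq_iff insertE singletonD)
    define b where "b \<longleftrightarrow> g (1, 0) \<noteq> A"
    have AB: "g (a, x) = A \<or> g (a, x) = B" if "a < 2" "x \<le> q" for a x
    proof -
      have "g (a, x) \<in> g ` ?I" using that by (auto simp: positions_def)
      then show ?thesis unfolding B by auto
    qed
    have form: "g (a, x) = (if f b (a, x) then A else B)" if "a < 2" "x \<le> q" for a x
      using that(2)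
    proof (induction x)
      case 0
      have "a = 0 \<or> a = 1" using that by auto
      then show ?case using AB[of a 0] that by (auto simp: f_def b_def A_def)
    next
      case (Suc x)
      have "g (a, x) \<noteq> g (a, Suc x)" using g(2) that Suc.prems by (auto simp: proper_def)
      then show ?case using Suc AB[of a "Suc x"] AB[of a x] that by (auto simp: f_def split: if_splits)
    qed
    have "same_kernel ?I g (f b)" unfolding same_kernel_def
    proof (intro ballI)
      fix s t assume "s \<in> ?I" "t \<in> ?I"
      then have "g s = (if f b s then A else B)" "g t = (if f b t then A else B)"
        using form[of "fst s" "snd s"] form[of "fst t" "snd t"] by (auto simp: positions_def)
      then show "g s = g t \<longleftrightarrow> f b s = f b t" using B(2) by auto
    qed
    then have "canon ?I (f b) = g" using canon_cong[of ?I g "f b"] g(1) by simp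
    then show "g \<in> (\<lambda>b. canon ?I (f b)) ` UNIV" by auto
  qed
  ultimately have "card {g \<in> patterns 2 q. card (g ` ?I) = 2} = card (UNIV :: bool set)"
    by (metis card_image)
  then show ?thesis by simp
qed

text \<open>A pattern of this size is determined by the step \<open>k\<close> of the first walk and
  the step \<open>l\<close> of the second on which they share their edge, and by whether the
  directions agree (\<open>b\<close>); this gives q times q times 2 choices. In the model
  \<open>f\<close> the first walk visits 0, ..., q, and the shift \<open>Suc q\<close> keeps the
  unshared vertices of the second walk fresh.\<close>

lemma card_top_patterns:
  assumes q: "1 \<le> q"
  shows "card {g \<in> patterns 2 q. card (g ` positions 2 q) = 2 * q} = 2 * q\<^sup>2"
proof -
  define f :: "nat \<times> nat \<times> bool \<Rightarrow> nat \<times> nat \<Rightarrow> nat" where "f = (\<lambda>(k, l, b) (a, x). if a = 0 then x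
    else if x = l then (if b then k else Suc k) else if x = Suc l then (if b then Suc k else k) else Suc q + x)"
  let ?I = "positions 2 q" and ?P = "{..<q} \<times> {..<q} \<times> (UNIV :: bool set)"
  have f0: "f (k, l, b) (0, x) = x" and f1: "f (k, l, b) (1, x) = (if x = l then (if b then k else Suc k) else if x = Suc l then (if b then Suc k else k) else Suc q + x)" for k l b x
    by (auto simp: f_def)
  have inj: "inj_on (\<lambda>p. canon ?I (f p)) ?P"
  proof (rule inj_onI)
    fix p p' assume pp: "p \<in> ?P" "p' \<in> ?P" "canon ?I (f p) = canon ?I (f p')"
    obtain k l b k' l' b' where p: "p = (k, l, b)" "p' = (k', l', b')" by (metis prod_cases3)
    have bd: "k < q" "l < q" "k' < q" "l' < q" using pp p by auto
    have "same_kernel ?I (f p) (f p')" using pp by (simp add: canon_eq_iff)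
    then have sk: "f p (0, x) = f p (1, y) \<longleftrightarrow> f p' (0, x) = f p' (1, y)" if "x \<le> q" "y \<le> q" for x y
      using that unfolding same_kernel_def by (simp add: positions_def)
    have 1: "x = (if y = l then (if b then k else Suc k) else if y = Suc l then (if b then Suc k else k) else Suc q + y)
      \<longleftrightarrow> x = (if y = l' then (if b' then k' else Suc k') else if y = Suc l' then (if b' then Suc k' else k') else Suc q + y)"
      if "x \<le> q" "y \<le> q" for x y
      using sk[OF that] unfolding p f0 f1 .
    \<comment> \<open>At such a \<open>y\<close> the second walk meets the first at the vertex
      inserted for \<open>x\<close>. An unshared vertex of the other model exceeds \<open>q\<close>
      and cannot do so, hence \<open>y\<close> is a shared position there too.\<close>
    have hit: "y = l' \<or> y = Suc l'" if "y = l \<or> y = Suc l" for y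
      using 1[of "if y = l then (if b then k else Suc k) else (if b then Suc k else k)" y] that bd
      by (cases b; cases b'; auto split: if_splits)
    have hit': "y = l \<or> y = Suc l" if "y = l' \<or> y = Suc l'" for y
      using 1[of "if y = l' then (if b' then k' else Suc k') else (if b' then Suc k' else k')" y] that bd
      by (cases b; cases b'; auto split: if_splits)
    have l: "l = l'" using hit[of l] hit[of "Suc l"] hit'[of l'] by auto
    have "(if b then k else Suc k) = (if b' then k' else Suc k')"
      using 1[of "if b then k else Suc k" l] bd l by (auto split: if_splits)
    moreover have "(if b then Suc k else k) = (if b' then Suc k' else k')"
      using 1[of "if b then Suc k else k" "Suc l"] bd l by (auto split: if_splits)
    ultimately show "p = p'" using l p by (auto split: if_splits)
  qed
  have img: "(\<lambda>p. canon ?I (f p)) ` ?P = {g \<in> patterns 2 q. card (g ` ?I) = 2 * q}"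
  proof (intro equalityI subsetI)
    fix g assume "g \<in> (\<lambda>p. canon ?I (f p)) ` ?P"
    then obtain k l b where g: "g = canon ?I (f (k, l, b))" and bd: "k < q" "l < q" by auto
    let ?f = "f (k, l, b)"
    have "proper 2 q ?f" using bd by (auto simp: proper_def f0 f1[unfolded One_nat_def] less_2_cases_iff)
    moreover have "walk_edge ?f (1, l) = walk_edge ?f (0, k)"
      by (auto simp: walk_edge_def f0 f1[unfolded One_nat_def])
    then have "linked 2 q ?f" using bd unfolding linked_def by (auto simp: less_2_cases_iff)
    moreover have "card (?f ` ?I) = 2 * q"
    proof -
      have "?f ` ?I = {..q} \<union> (\<lambda>x. Suc q + x) ` ({..q} - {l, Suc l})"
      proof (intro equalityI subsetI)
        fix y assume "y \<in> ?f ` ?I"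
        then obtain a x where y: "a = 0 \<or> a = 1" "x \<le> q" "y = ?f (a, x)" by (auto simp: positions_def less_2_cases_iff)
        show "y \<in> {..q} \<union> (\<lambda>x. Suc q + x) ` ({..q} - {l, Suc l})"
        proof (cases "a = 0 \<or> x = l \<or> x = Suc l")
          case True
          then have "y \<le> q" using y bd by (auto simp: f_def)
          then show ?thesis by simp
        next
          case False
          then have "y = Suc q + x" "x \<in> {..q} - {l, Suc l}" using y by (auto simp: f_def)
          then show ?thesis by blast
        qed
      next
        fix y assume "y \<in> {..q} \<union> (\<lambda>x. Suc q + x) ` ({..q} - {l, Suc l})"
        then consider "y \<le> q" | x where "x \<le> q" "x \<noteq> l" "x \<noteq> Suc l" "y = Suc q + x" by auto
        then show "y \<in> ?f ` ?I"
        proof cases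
          case 1
          then show ?thesis using f0[of k l b y] by (auto simp: positions_def intro!: image_eqI[of _ _ "(0, y)"])
        next
          case 2
          then show ?thesis using f1[of k l b x] by (auto simp: positions_def intro!: image_eqI[of _ _ "(1, x)"])
        qed
      qed
      also have "card \<dots> = card {..q} + card ((\<lambda>x. Suc q + x) ` ({..q} - {l, Suc l}))"
        by (rule card_Un_disjoint) auto
      also have "card ((\<lambda>x. Suc q + x) ` ({..q} - {l, Suc l})) = card ({..q} - {l, Suc l})"
        by (rule card_image) (auto simp: inj_on_def)
      also have "card ({..q} - {l, Suc l}) = q - 1" using bd by (subst card_Diff_subset) auto
      finally show ?thesis using q by simp
    qed
    then have "card (g ` ?I) = 2 * q"
      using same_kernel_card[OF same_kernel_canon, of ?I ?f] by (simp add: g)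
    ultimately show "g \<in> {g \<in> patterns 2 q. card (g ` ?I) = 2 * q}" using canon_in_patterns[of 2 q ?f] by (simp add: g)
  next
    fix g assume "g \<in> {g \<in> patterns 2 q. card (g ` ?I) = 2 * q}"
    then have g: "canon ?I g = g" "proper 2 q g" "linked 2 q g" "card (g ` ?I) = 2 * q" by (auto simp: patterns_def)
    define u v where "u x = g (0, x)" and "v x = g (1, x)" for x
    obtain l k where lk: "l < q" "k < q" "walk_edge g (1, l) = walk_edge g (0, k)"
      using g(3) unfolding linked_def by (metis less_one one_less_numeral_iff semiring_norm(76) zero_less_one)
    define e where "e = {u k, u (Suc k)}"
    have e': "e = {v l, v (Suc l)}" using lk(3) by (auto simp: walk_edge_def e_def u_def v_def)
    have ne: "u k \<noteq> u (Suc k)" "v l \<noteq> v (Suc l)" using g(2) lk by (auto simp: proper_def u_def v_def)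
    have ce: "card e = 2" using ne by (simp add: e_def)
    have "g ` ?I = u ` {..q} \<union> v ` {..q}"
      by (auto simp: positions_def u_def v_def less_2_cases_iff image_iff)
    \<comment> \<open>Each walk has at most q + 1 vertices and the two share at least the two ends
      of an edge. Inclusion-exclusion with 2q vertices in the union forces equality throughout: both
      walks are paths and they meet in these two vertices only.\<close>
    then have "card (u ` {..q}) + card (v ` {..q}) = 2 * q + card (u ` {..q} \<inter> v ` {..q})"
      using g(4) card_Un_Int[of "u ` {..q}" "v ` {..q}"] by simp
    moreover have "card (u ` {..q}) \<le> Suc q" "card (v ` {..q}) \<le> Suc q"
      using card_image_le[of "{..q}" u] card_image_le[of "{..q}" v] by auto
    moreover have esub: "e \<subseteq> u ` {..q} \<inter> v ` {..q}"
    proof -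
      have "e \<subseteq> u ` {..q}" using lk by (auto simp: e_def)
      moreover have "e \<subseteq> v ` {..q}" using lk by (auto simp: e')
      ultimately show ?thesis by simp
    qed
    moreover have "card e \<le> card (u ` {..q} \<inter> v ` {..q})" by (rule card_mono[OF _ esub]) simp
    ultimately have cu: "card (u ` {..q}) = Suc q" and cv: "card (v ` {..q}) = Suc q"
      and ci: "card (u ` {..q} \<inter> v ` {..q}) = 2" using ce by auto
    have iu: "u x = u y \<longleftrightarrow> x = y" if "x \<le> q" "y \<le> q" for x y
      using eq_card_imp_inj_on[of "{..q}" u] cu that by (auto simp: inj_on_def)
    have iv: "v x = v y \<longleftrightarrow> x = y" if "x \<le> q" "y \<le> q" for x y
      using eq_card_imp_inj_on[of "{..q}" v] cv that by (auto simp: inj_on_def)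
    have int: "u ` {..q} \<inter> v ` {..q} = e"
      using card_subset_eq[OF _ esub] ce ci by simp
    define b where "b \<longleftrightarrow> v l = u k"
    have "u k = v l \<and> u (Suc k) = v (Suc l) \<or> u k = v (Suc l) \<and> u (Suc k) = v l"
      using e' unfolding e_def by (simp only: doubleton_eq_iff)
    then have vl: "v l = (if b then u k else u (Suc k))" "v (Suc l) = (if b then u (Suc k) else u k)"
      unfolding b_def using ne(1) by (elim disjE conjE; simp)+
    have "same_kernel ?I g (f (k, l, b))"
    proof (rule same_kernel_positions_2I)
      fix x y assume xy: "x \<le> q" "y \<le> q"
      show "g (0, x) = g (0, y) \<longleftrightarrow> f (k, l, b) (0, x) = f (k, l, b) (0, y)"
        using iu[OF xy] by (simp add: f0 u_def)
      show "g (1, x) = g (1, y) \<longleftrightarrow> f (k, l, b) (1, x) = f (k, l, b) (1, y)"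
        using iv[OF xy] lk xy unfolding f1 v_def[symmetric] by auto
      show "g (0, x) = g (1, y) \<longleftrightarrow> f (k, l, b) (0, x) = f (k, l, b) (1, y)"
      proof (cases "y = l \<or> y = Suc l")
        case True
        then show ?thesis using vl iu[of x k] iu[of x "Suc k"] xy lk
          unfolding f0 f1 u_def[symmetric] v_def[symmetric] by auto
      next
        case False
        then have "v y \<notin> e" using iv[of y l] iv[of y "Suc l"] xy lk unfolding e' by auto
        moreover have "u x \<in> u ` {..q}" "v y \<in> v ` {..q}" using xy by auto
        ultimately have "u x \<noteq> v y" unfolding int[symmetric] by (metis IntI)
        then show ?thesis using False xy unfolding f0 f1 u_def[symmetric] v_def[symmetric] by auto
      qed
    qed
    then have "canon ?I (f (k, l, b)) = g" using canon_cong[of ?I g "f (k, l, b)"] g(1) by simp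
    moreover have "(k, l, b) \<in> ?P" using lk by simp
    ultimately show "g \<in> (\<lambda>p. canon ?I (f p)) ` ?P" by (intro image_eqI[of _ _ "(k, l, b)"]) simp_all
  qed
  have "card {g \<in> patterns 2 q. card (g ` ?I) = 2 * q} = card ?P"
    using card_image[OF inj] unfolding img .
  then show ?thesis by (simp add: power2_eq_square card_cartesian_product)
qed

section \<open>Asymptotics of pattern sums\<close>

definition lattice_segment :: "nat \<Rightarrow> int set" where
  "lattice_segment n = {- int n..int n}"

lemma finite_lattice_segment [simp]: "finite (lattice_segment n)"
  by (simp add: lattice_segment_def)

lemma card_lattice_segment [simp]: "card (lattice_segment n) = dim_N n"
  by (simp add: lattice_segment_def dim_N_def)

lemma dim_N_pos: "0 < real (dim_N n)"
  by (simp add: dim_N_def)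

definition edge_length :: "int set \<Rightarrow> real" where
  "edge_length e = real_of_int (Max e - Min e)"

lemma edge_length_doubleton: "edge_length {i, j} = real_of_int \<bar>i - j\<bar>"
  by (cases "i \<le> j") (auto simp: edge_length_def max_def min_def)

text \<open>Contribution of an edge traversed \<open>m\<close> times. A 0/1 variable equals its
  positive powers, so the probability enters once and the weight to the power \<open>m\<close>; for
  \<alpha> in {0, 1} that power is absorbed by the exponent of the profile, as
  \<open>kernel_eq\<close> confirms.\<close>

definition kernel :: "nat \<Rightarrow> (real \<Rightarrow> real) \<Rightarrow> nat \<Rightarrow> real \<Rightarrow> real \<Rightarrow> nat \<Rightarrow> int set \<Rightarrow> real" where
  "kernel \<alpha> \<psi> n c R m e = c / real (dim_N n) * profile \<psi> (\<alpha> * m) (edge_length e / R)"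

lemma kernel_nonneg: "0 \<le> c \<Longrightarrow> 0 \<le> kernel \<alpha> \<psi> n c R m e"
  unfolding kernel_def using profile_pos[of \<psi>] by (simp add: less_imp_le)

lemma kernel_le: "0 \<le> c \<Longrightarrow> kernel \<alpha> \<psi> n c R m e \<le> c / real (dim_N n) * real (\<alpha> * m) ^ (\<alpha> * m)"
  unfolding kernel_def by (intro mult_left_mono profile_le) auto

text \<open>Grouping by distance, with an indicator for not leaving the segment, makes the range of
  \<open>j\<close> independent of \<open>i\<close>, so that the sum over \<open>i\<close> can later
  be exchanged with it.\<close>

lemma sum_above:
  assumes "i \<in> lattice_segment n"
  shows "(\<Sum>z\<in>{z \<in> lattice_segment n. i < z}. G (nat \<bar>i - z\<bar>)) = (\<Sum>j=1..2 * n. of_bool (i + int j \<le> int n) * (G j :: real))"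
proof -
  have "(\<Sum>j=1..2 * n. of_bool (i + int j \<le> int n) * G j) = (\<Sum>j\<in>{j \<in> {1..2 * n}. i + int j \<le> int n}. G j)"
    unfolding sum.inter_filter[OF finite_atLeastAtMost] by (intro sum.cong refl) simp
  also have "(\<Sum>j\<in>{j \<in> {1..2 * n}. i + int j \<le> int n}. G j) = (\<Sum>z\<in>{z \<in> lattice_segment n. i < z}. G (nat \<bar>i - z\<bar>))"
    by (rule sum.reindex_bij_witness[of _ "\<lambda>z. nat (z - i)" "\<lambda>j. i + int j"])
      (use assms in \<open>auto simp: lattice_segment_def\<close>)
  finally show ?thesis by simp
qed

lemma sum_below:
  assumes "i \<in> lattice_segment n"
  shows "(\<Sum>z\<in>{z \<in> lattice_segment n. z < i}. G (nat \<bar>i - z\<bar>)) = (\<Sum>j=1..2 * n. of_bool (- i + int j \<le> int n) * (G j :: real))"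
proof -
  have "(\<Sum>z\<in>{z \<in> lattice_segment n. z < i}. G (nat \<bar>i - z\<bar>)) = (\<Sum>z\<in>{z \<in> lattice_segment n. - i < z}. G (nat \<bar>- i - z\<bar>))"
    by (rule sum.reindex_bij_witness[of _ uminus uminus]) (auto simp: lattice_segment_def)
  also have "\<dots> = (\<Sum>j=1..2 * n. of_bool (- i + int j \<le> int n) * G j)"
    using assms by (intro sum_above) (auto simp: lattice_segment_def)
  finally show ?thesis .
qed

lemma sum_off_diagonal:
  assumes "i \<in> lattice_segment n"
  shows "(\<Sum>z\<in>lattice_segment n - {i}. G (nat \<bar>i - z\<bar>)) =
    (\<Sum>j=1..2 * n. of_bool (i + int j \<le> int n) * (G j :: real)) + (\<Sum>j=1..2 * n. of_bool (- i + int j \<le> int n) * G j)"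
proof -
  have eq: "lattice_segment n - {i} = {z \<in> lattice_segment n. i < z} \<union> {z \<in> lattice_segment n. z < i}" by auto
  have "(\<Sum>z\<in>lattice_segment n - {i}. G (nat \<bar>i - z\<bar>)) =
    (\<Sum>z\<in>{z \<in> lattice_segment n. i < z}. G (nat \<bar>i - z\<bar>)) + (\<Sum>z\<in>{z \<in> lattice_segment n. z < i}. G (nat \<bar>i - z\<bar>))"
    unfolding eq by (rule sum.union_disjoint) auto
  then show ?thesis unfolding sum_above[OF assms] sum_below[OF assms] .
qed

lemma sum_off_diagonal_le:
  assumes "i \<in> lattice_segment n" "\<And>j. 0 \<le> (G j :: real)"
  shows "(\<Sum>z\<in>lattice_segment n - {i}. G (nat \<bar>i - z\<bar>)) \<le> 2 * (\<Sum>j=1..2 * n. G j)"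
  unfolding sum_off_diagonal[OF assms(1)] mult_2
  by (intro add_mono sum_mono) (simp_all add: assms(2))

text \<open>For each distance \<open>j\<close> there are exactly N - j sites with a partner on the
  right, and by reflection as many with a partner on the left.\<close>

lemma sum_all_off_diagonal:
  "(\<Sum>i\<in>lattice_segment n. \<Sum>z\<in>lattice_segment n - {i}. G (nat \<bar>i - z\<bar>)) =
    2 * (\<Sum>j=1..2 * n. (real (dim_N n) - real j) * (G j :: real))"
proof -
  have cnt: "(\<Sum>i\<in>lattice_segment n. of_bool (i + int j \<le> int n)) = real (dim_N n) - real j" if "j \<le> 2 * n" for j
  proof -
    have "(\<Sum>i\<in>lattice_segment n. of_bool (i + int j \<le> int n)) = real (card {- int n..int n - int j})"
    proof -
      have "lattice_segment n \<inter> {i. i + int j \<le> int n} = {- int n..int n - int j}"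
        by (auto simp: lattice_segment_def)
      then show ?thesis by (simp add: of_bool_def sum.If_cases Collect_conj_eq)
    qed
    then show ?thesis using that by (simp add: dim_N_def of_nat_diff)
  qed
  have cnt': "(\<Sum>i\<in>lattice_segment n. of_bool (- i + int j \<le> int n)) = real (dim_N n) - real j" if "j \<le> 2 * n" for j
    unfolding cnt[OF that, symmetric]
    by (rule sum.reindex_bij_witness[of _ uminus uminus]) (auto simp: lattice_segment_def)
  have "(\<Sum>i\<in>lattice_segment n. \<Sum>z\<in>lattice_segment n - {i}. G (nat \<bar>i - z\<bar>)) =
     (\<Sum>i\<in>lattice_segment n. \<Sum>j=1..2 * n. of_bool (i + int j \<le> int n) * G j) +
     (\<Sum>i\<in>lattice_segment n. \<Sum>j=1..2 * n. of_bool (- i + int j \<le> int n) * G j)"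
    by (subst sum.distrib[symmetric]) (intro sum.cong refl sum_off_diagonal)
  also have "(\<Sum>i\<in>lattice_segment n. \<Sum>j=1..2 * n. of_bool (i + int j \<le> int n) * G j) =
      (\<Sum>j=1..2 * n. (\<Sum>i\<in>lattice_segment n. of_bool (i + int j \<le> int n)) * G j)"
    unfolding sum_distrib_right by (rule sum.swap)
  also have "(\<Sum>i\<in>lattice_segment n. \<Sum>j=1..2 * n. of_bool (- i + int j \<le> int n) * G j) =
      (\<Sum>j=1..2 * n. (\<Sum>i\<in>lattice_segment n. of_bool (- i + int j \<le> int n)) * G j)"
    unfolding sum_distrib_right by (rule sum.swap)
  also have "(\<Sum>j=1..2 * n. (\<Sum>i\<in>lattice_segment n. of_bool (i + int j \<le> int n)) * G j) = (\<Sum>j=1..2 * n. (real (dim_N n) - real j) * G j)"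
    by (intro sum.cong refl) (simp only: atLeastAtMost_iff cnt)
  also have "(\<Sum>j=1..2 * n. (\<Sum>i\<in>lattice_segment n. of_bool (- i + int j \<le> int n)) * G j) = (\<Sum>j=1..2 * n. (real (dim_N n) - real j) * G j)"
    by (intro sum.cong refl) (simp only: atLeastAtMost_iff cnt')
  finally show ?thesis by (simp only: mult_2)
qed

section \<open>Asymptotics of the contribution of one pattern\<close>

definition pattern_sum :: "nat \<Rightarrow> (real \<Rightarrow> real) \<Rightarrow> nat \<Rightarrow> real \<Rightarrow> real \<Rightarrow> nat \<Rightarrow> nat \<Rightarrow> (nat \<times> nat \<Rightarrow> nat \<times> nat) \<Rightarrow> real" where
  "pattern_sum \<alpha> \<psi> n c R r q g = (\<Sum>h\<in>embeddings (g ` positions r q) (lattice_segment n).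
     edge_weight (\<lambda>e. kernel \<alpha> \<psi> n c R (edge_mult r q g e)) (all_edges r q g) h)"

lemma pattern_sum_nonneg: "0 \<le> c \<Longrightarrow> 0 \<le> pattern_sum \<alpha> \<psi> n c R r q g"
  unfolding pattern_sum_def by (intro sum_nonneg edge_weight_nonneg kernel_nonneg)

text \<open>Kept separate from the limiting transition because the finite random graph needs only
  these assumptions, while the limiting cumulants quantify over all transitions for one fixed
  profile.\<close>

locale walk_weights =
  fixes \<psi> :: "real \<Rightarrow> real" and \<alpha> :: nat
  assumes psi_even: "\<And>x. \<psi> (- x) = \<psi> x"
    and psi_cont: "continuous_on UNIV \<psi>"
    and psi_pos: "\<And>x. \<psi> x > 0"
    and psi_mono: "mono_on {0..} \<psi>"
    and profile_integrable: "\<And>m. integrable lborel (profile \<psi> m)"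
    and alpha: "\<alpha> \<in> {0, 1}"

locale walk_limit = walk_weights +
  fixes n :: "nat \<Rightarrow> nat" and c R :: "nat \<Rightarrow> real"
  assumes transition: "limiting_transition n c R"
begin

abbreviation N :: "nat \<Rightarrow> real" where "N k \<equiv> real (dim_N (n k))"
abbreviation D :: "nat \<Rightarrow> real" where "D k \<equiv> c k * R k / N k"
abbreviation W :: "nat \<Rightarrow> real" where "W m \<equiv> V \<psi> (\<alpha> * m)"

lemma c_pos: "0 < c k" and R_pos: "0 < R k" and c_le: "c k \<le> N k"
  and n_lim: "filterlim n at_top sequentially" and c_lim: "filterlim c at_top sequentially"
  and R_lim: "filterlim R at_top sequentially"
  using transition by (auto simp: limiting_transition_def)

lemma D_pos: "0 < D k"
  using c_pos R_pos dim_N_pos by simp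

lemma RN_lim: "(\<lambda>k. R k / N k) \<longlonglongrightarrow> 0" and cN_lim: "(\<lambda>k. c k / N k) \<longlonglongrightarrow> 0"
  using transition by (auto simp: limiting_transition_def intro!: smalloD_tendsto)

lemma cR_lim: "filterlim (\<lambda>k. c k * R k) at_top sequentially"
  by (rule filterlim_at_top_mult_at_top[OF c_lim R_lim])

lemma W_pos: "0 < W m"
  by (intro V_pos profile_integrable)

lemma kernel_doubleton:
  "kernel \<alpha> \<psi> (n k) (c k) (R k) m {i, z} = c k / N k * profile \<psi> (\<alpha> * m) (real (nat \<bar>i - z\<bar>) / R k)"
  by (simp add: kernel_def edge_length_doubleton)

lemma pattern_sum_limit:
  assumes g: "g \<in> patterns r q" and rq: "1 \<le> r" "1 \<le> q"
  defines "v \<equiv> card (g ` positions r q)"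
  shows "(\<lambda>k. pattern_sum \<alpha> \<psi> (n k) (c k) (R k) r q g / (N k * D k ^ (v - 1))) \<longlonglongrightarrow>
     (if card (all_edges r q g) = v - 1 then \<Prod>e\<in>all_edges r q g. W (edge_mult r q g e) else 0)"
proof -
  let ?I = "g ` positions r q" and ?E = "all_edges r q g" and ?L = "\<lambda>k. lattice_segment (n k)"
  let ?m = "edge_mult r q g"
  define \<kappa> where "\<kappa> k e = kernel \<alpha> \<psi> (n k) (c k) (R k) (?m e)" for k e
  \<comment> \<open>Both sides of a row are extended to the full range of distances, which bounds
    every row regardless of its position.\<close>
  define \<rho> where "\<rho> k e = 2 * (\<Sum>j=1..2 * n k. profile \<psi> (\<alpha> * ?m e) (real j / R k)) / R k" for k e
  define B where "B e = real (\<alpha> * ?m e) ^ (\<alpha> * ?m e)" for e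
  obtain T where T: "tree_on ?I T" "T \<subseteq> ?E"
    using pattern_spanning_tree[of r q g] g rq by (auto simp: patterns_def)
  have finT: "finite T" using T finite_all_edges finite_subset by blast
  have cT: "card T = v - 1" using tree_on_card[OF T(1)] by (simp add: v_def)
  note lims = profile_sum_limits[OF psi_even psi_cont psi_pos psi_mono profile_integrable R_pos R_lim RN_lim n_lim]
  have \<kappa>0: "0 \<le> \<kappa> k e s" for k e s unfolding \<kappa>_def using c_pos by (intro kernel_nonneg) (simp add: less_imp_le)
  have \<rho>0: "0 \<le> \<rho> k e" for k e unfolding \<rho>_def using R_pos profile_pos
    by (intro divide_nonneg_pos mult_nonneg_nonneg sum_nonneg) (auto simp: less_imp_le)
  have B0: "0 \<le> B e" for e by (simp add: B_def)
  have row: "(\<Sum>z\<in>?L k - {i}. \<kappa> k e {i, z}) \<le> D k * \<rho> k e" if "i \<in> ?L k" for k e i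
  proof -
    have "(\<Sum>z\<in>?L k - {i}. \<kappa> k e {i, z}) = c k / N k * (\<Sum>z\<in>?L k - {i}. profile \<psi> (\<alpha> * ?m e) (real (nat \<bar>i - z\<bar>) / R k))"
      unfolding \<kappa>_def kernel_doubleton sum_distrib_left ..
    also have "\<dots> \<le> c k / N k * (2 * (\<Sum>j=1..2 * n k. profile \<psi> (\<alpha> * ?m e) (real j / R k)))"
      using sum_off_diagonal_le[OF that, of "\<lambda>j. profile \<psi> (\<alpha> * ?m e) (real j / R k)"] profile_pos c_pos[of k]
      by (intro mult_left_mono) (auto simp: less_imp_le)
    also have "\<dots> = D k * \<rho> k e" using R_pos[of k] by (simp add: \<rho>_def)
    finally show ?thesis .
  qed
  have \<rho>lim: "(\<lambda>k. \<rho> k e) \<longlonglongrightarrow> W (?m e)" for e unfolding \<rho>_def by (rule lims(1))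
  \<comment> \<open>Since c / N equals D / R, a single kernel value is smaller than
    \<open>D k\<close> by the order of \<open>1 / R k\<close>. This makes coinciding vertices
    negligible in \<open>tree_sum_limit\<close>.\<close>
  have mx: "\<kappa> k e s \<le> D k * (B e / R k)" for k e s
    using kernel_le[of "c k" \<alpha> \<psi> "n k" "R k" "?m e" s] c_pos[of k] R_pos[of k] by (simp add: \<kappa>_def B_def)
  have \<eta>: "(\<lambda>k. B e / R k) \<longlonglongrightarrow> 0" for e
    by (rule tendsto_divide_0[OF tendsto_const filterlim_at_top_imp_at_infinity[OF R_lim]])
  have ps: "pattern_sum \<alpha> \<psi> (n k) (c k) (R k) r q g = (\<Sum>h\<in>embeddings ?I (?L k). edge_weight (\<kappa> k) ?E h)" for k
  proof -
    have "\<kappa> k = (\<lambda>e. kernel \<alpha> \<psi> (n k) (c k) (R k) (?m e))" by (rule ext) (simp add: \<kappa>_def)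
    then show ?thesis by (simp only: pattern_sum_def)
  qed
  show ?thesis
  proof (cases "card ?E = v - 1")
    case True
    then have TE: "T = ?E" using T(2) cT by (intro card_subset_eq finite_all_edges) auto
    have tot: "(\<lambda>k. (\<Sum>i\<in>?L k. \<Sum>z\<in>?L k - {i}. \<kappa> k e {i, z}) / (card (?L k) * D k)) \<longlonglongrightarrow> W (?m e)" for e
    proof -
      have "(\<Sum>i\<in>?L k. \<Sum>z\<in>?L k - {i}. \<kappa> k e {i, z}) / (card (?L k) * D k) =
        2 * (\<Sum>j=1..2 * n k. (1 - real j / N k) * profile \<psi> (\<alpha> * ?m e) (real j / R k)) / R k" for k
      proof -
        have "(\<Sum>i\<in>?L k. \<Sum>z\<in>?L k - {i}. \<kappa> k e {i, z}) = c k / N k * (2 * (\<Sum>j=1..2 * n k. (N k - real j) * profile \<psi> (\<alpha> * ?m e) (real j / R k)))"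
          unfolding \<kappa>_def kernel_doubleton sum_distrib_left[symmetric]
          by (subst sum_all_off_diagonal) simp
        also have "(\<Sum>j=1..2 * n k. (N k - real j) * profile \<psi> (\<alpha> * ?m e) (real j / R k)) =
          N k * (\<Sum>j=1..2 * n k. (1 - real j / N k) * profile \<psi> (\<alpha> * ?m e) (real j / R k))"
          unfolding sum_distrib_left using dim_N_pos[of "n k"] by (intro sum.cong refl) (simp add: field_simps)
        finally show ?thesis using c_pos[of k] R_pos[of k] dim_N_pos[of "n k"] by (simp add: field_simps)
      qed
      then show ?thesis using lims(2)[of "\<alpha> * ?m e"] by simp
    qed
    have "(\<lambda>k. (\<Sum>h\<in>embeddings ?I (?L k). edge_weight (\<kappa> k) ?E h) / (card (?L k) * D k ^ card ?E)) \<longlonglongrightarrow> (\<Prod>e\<in>?E. W (?m e))"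
      by (rule tree_sum_limit[where \<rho> = \<rho> and \<eta> = "\<lambda>k e. B e / R k"])
        (use T TE D_pos \<kappa>0 \<rho>0 B0 row \<rho>lim tot mx \<eta> R_pos in \<open>auto simp: lattice_segment_def less_imp_le\<close>)
    then show ?thesis using True by (simp add: ps)
  next
    case False
    then have nT: "?E - T \<noteq> {}" using T(2) cT by (metis Diff_eq_empty_iff card_mono card_subset_eq finT finite_all_edges le_antisym)
    \<comment> \<open>The edges of the spanning tree are summed as rows, and every edge outside it
      is replaced by the uniform bound of order \<open>c k / N k\<close>. At least one such edge
      exists in this case.\<close>
    define U where "U k = (\<Prod>e\<in>T. \<rho> k e) * (\<Prod>e\<in>?E - T. c k / N k * B e)" for k
    have "(\<lambda>k. pattern_sum \<alpha> \<psi> (n k) (c k) (R k) r q g / (N k * D k ^ (v - 1))) \<longlonglongrightarrow> 0"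
    proof (rule tendsto_sandwich[where f = "\<lambda>_. 0" and h = U])
      show "\<forall>\<^sub>F k in sequentially. 0 \<le> pattern_sum \<alpha> \<psi> (n k) (c k) (R k) r q g / (N k * D k ^ (v - 1))"
        using pattern_sum_nonneg c_pos R_pos dim_N_pos
        by (intro always_eventually allI divide_nonneg_nonneg mult_nonneg_nonneg zero_le_power) (auto simp: less_imp_le)
      show "\<forall>\<^sub>F k in sequentially. pattern_sum \<alpha> \<psi> (n k) (c k) (R k) r q g / (N k * D k ^ (v - 1)) \<le> U k"
      proof (intro always_eventually allI)
        fix k
        let ?b = "\<Prod>e\<in>?E - T. c k / N k * B e"
        have b0: "0 \<le> ?b" using c_pos[of k] B0 by (intro prod_nonneg) (auto simp: less_imp_le)
        have "pattern_sum \<alpha> \<psi> (n k) (c k) (R k) r q g \<le> (\<Sum>h\<in>embeddings ?I (?L k). edge_weight (\<kappa> k) T h * ?b)"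
          unfolding ps
        proof (rule sum_mono)
          fix h
          have "edge_weight (\<kappa> k) ?E h = edge_weight (\<kappa> k) T h * (\<Prod>e\<in>?E - T. \<kappa> k e (h ` e))"
            unfolding edge_weight_def using prod.subset_diff[OF T(2) finite_all_edges] by (simp add: mult.commute)
          also have "\<dots> \<le> edge_weight (\<kappa> k) T h * ?b"
            using kernel_le c_pos[of k] \<kappa>0 by (intro mult_left_mono prod_mono edge_weight_nonneg) (auto simp: \<kappa>_def B_def less_imp_le)
          finally show "edge_weight (\<kappa> k) ?E h \<le> edge_weight (\<kappa> k) T h * ?b" .
        qed
        also have "\<dots> \<le> real (card (?L k)) * (\<Prod>e\<in>T. D k * \<rho> k e) * ?b"
          unfolding sum_distrib_right[symmetric]
          using D_pos[of k] by (intro mult_right_mono tree_sum_le[OF T(1)] b0 \<kappa>0 row mult_nonneg_nonneg \<rho>0) (auto simp: less_imp_le)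
        also have "\<dots> = U k * (N k * D k ^ (v - 1))"
          unfolding U_def prod.distrib prod_constant cT by (simp only: card_lattice_segment mult_ac)
        finally show "pattern_sum \<alpha> \<psi> (n k) (c k) (R k) r q g / (N k * D k ^ (v - 1)) \<le> U k"
          using D_pos[of k] dim_N_pos[of "n k"] by (subst pos_divide_le_eq) auto
      qed
      have "U \<longlonglongrightarrow> (\<Prod>e\<in>T. W (?m e)) * (\<Prod>e\<in>?E - T. 0 * B e)"
        unfolding U_def by (intro tendsto_intros \<rho>lim cN_lim)
      moreover have "0 < card (?E - T)" using nT finite_all_edges[of r q g] by (simp add: card_gt_0_iff)
      ultimately show "U \<longlonglongrightarrow> 0" by (simp add: prod_constant zero_power)
    qed simp
    then show ?thesis using False by simp
  qed
qed

end

section \<open>Walks in the random graph\<close>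

lemma sum_PiE_insert:
  assumes "x \<notin> A" "finite A" "finite L"
  shows "(\<Sum>u\<in>insert x A \<rightarrow>\<^sub>E L. F u) = (\<Sum>u\<in>A \<rightarrow>\<^sub>E L. \<Sum>z\<in>L. F (u(x := z)))"
proof -
  have "(\<Sum>u\<in>A \<rightarrow>\<^sub>E L. \<Sum>z\<in>L. F (u(x := z))) = (\<Sum>(u, z)\<in>(A \<rightarrow>\<^sub>E L) \<times> L. F (u(x := z)))"
    by (rule sum.cartesian_product)
  also have "\<dots> = (\<Sum>u\<in>insert x A \<rightarrow>\<^sub>E L. F u)"
  proof (rule sum.reindex_bij_witness[of _ "\<lambda>u. (restrict u A, u x)" "\<lambda>(u, z). u(x := z)"])
    fix p assume "p \<in> (A \<rightarrow>\<^sub>E L) \<times> L"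
    then obtain u z where p: "p = (u, z)" "u \<in> A \<rightarrow>\<^sub>E L" "z \<in> L" by auto
    have "restrict (u(x := z)) A = u"
    proof
      fix y show "restrict (u(x := z)) A y = u y"
        using assms(1) PiE_arb[OF p(2), of y] by (cases "y \<in> A") auto
    qed
    then show "(restrict (case p of (u, z) \<Rightarrow> u(x := z)) A, (case p of (u, z) \<Rightarrow> u(x := z)) x) = p"
      by (simp add: p(1))
    show "(case p of (u, z) \<Rightarrow> u(x := z)) \<in> insert x A \<rightarrow>\<^sub>E L"
      unfolding p(1) prod.case
    proof (rule PiE_I)
      show "(u(x := z)) y \<in> L" if "y \<in> insert x A" for y using that p by auto
      show "(u(x := z)) y = undefined" if "y \<notin> insert x A" for y
        using that PiE_arb[OF p(2), of y] by auto
    qed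
  next
    fix u assume u: "u \<in> insert x A \<rightarrow>\<^sub>E L"
    show "(case (restrict u A, u x) of (u, z) \<Rightarrow> u(x := z)) = u"
    proof
      fix y show "(case (restrict u A, u x) of (u, z) \<Rightarrow> u(x := z)) y = u y"
        using PiE_arb[OF u, of y] by (cases "y \<in> A"; cases "y = x") auto
    qed
    show "(restrict u A, u x) \<in> (A \<rightarrow>\<^sub>E L) \<times> L" using u by auto
  qed (auto split: prod.split)
  finally show ?thesis by simp
qed

text \<open>The terminal function \<open>f\<close> makes the induction work: peeling off the last
  step replaces \<open>f\<close> by its image under \<open>G\<close>, so the hypothesis is needed
  for arbitrary \<open>f\<close>, although only the constant 1 is used in the end.\<close>

lemma sum_matrix_power:
  fixes G :: "int \<Rightarrow> int \<Rightarrow> real" and f :: "int \<Rightarrow> real" and n q :: nat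
  defines "A \<equiv> mat (dim_N n) (dim_N n) (\<lambda>(r, s). G (int r - int n) (int s - int n))"
  shows "(\<Sum>r<dim_N n. \<Sum>s<dim_N n. (A ^\<^sub>m q) $$ (r, s) * f (int s - int n)) =
    (\<Sum>u\<in>{..q} \<rightarrow>\<^sub>E lattice_segment n. (\<Prod>i<q. G (u i) (u (Suc i))) * f (u q))"
proof -
  let ?L = "lattice_segment n"
  have idx: "(\<Sum>t<dim_N n. H (int t - int n)) = (\<Sum>z\<in>?L. H z)" for H :: "int \<Rightarrow> real"
    by (rule sum.reindex_bij_witness[of _ "\<lambda>z. nat (z + int n)" "\<lambda>t. int t - int n"])
      (auto simp: lattice_segment_def dim_N_def)
  have dimA: "dim_row (A ^\<^sub>m q) = dim_N n" "dim_col (A ^\<^sub>m q) = dim_N n" for q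
    by (induction q) (auto simp: A_def)
  show ?thesis
  proof (induction q arbitrary: f)
    case 0
    have "(\<Sum>u\<in>insert (0::nat) {} \<rightarrow>\<^sub>E ?L. f (u 0)) = (\<Sum>z\<in>?L. f z)"
      by (subst sum_PiE_insert) auto
    then have "(\<Sum>u\<in>{..0::nat} \<rightarrow>\<^sub>E ?L. f (u 0)) = (\<Sum>z\<in>?L. f z)"
      by (simp only: atMost_0)
    moreover have "(\<Sum>r<dim_N n. \<Sum>s<dim_N n. (A ^\<^sub>m 0) $$ (r, s) * f (int s - int n)) = (\<Sum>r<dim_N n. f (int r - int n))"
      by (rule sum.cong[OF refl]) (simp add: A_def one_mat_def if_distrib[of "\<lambda>a. a * _"] cong: if_cong)
    ultimately show ?case by (simp add: idx)
  next
    case (Suc q)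
    have step: "(A ^\<^sub>m Suc q) $$ (r, t) = (\<Sum>s<dim_N n. (A ^\<^sub>m q) $$ (r, s) * G (int s - int n) (int t - int n))"
      if "r < dim_N n" "t < dim_N n" for r t
    proof -
      have "(A ^\<^sub>m Suc q) $$ (r, t) = row (A ^\<^sub>m q) r \<bullet> col A t" using that dimA by (simp add: A_def)
      also have "\<dots> = (\<Sum>s<dim_N n. (A ^\<^sub>m q) $$ (r, s) * A $$ (s, t))"
        unfolding scalar_prod_def atLeast0LessThan using that dimA by (intro sum.cong) (auto simp: A_def)
      finally show ?thesis using that by (simp add: A_def)
    qed
    have "(\<Sum>r<dim_N n. \<Sum>t<dim_N n. (A ^\<^sub>m Suc q) $$ (r, t) * f (int t - int n)) =
      (\<Sum>r<dim_N n. \<Sum>s<dim_N n. (A ^\<^sub>m q) $$ (r, s) * (\<Sum>t<dim_N n. G (int s - int n) (int t - int n) * f (int t - int n)))"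
    proof (rule sum.cong[OF refl])
      fix r assume r: "r \<in> {..<dim_N n}"
      have "(\<Sum>t<dim_N n. (A ^\<^sub>m Suc q) $$ (r, t) * f (int t - int n)) =
        (\<Sum>t<dim_N n. \<Sum>s<dim_N n. (A ^\<^sub>m q) $$ (r, s) * (G (int s - int n) (int t - int n) * f (int t - int n)))"
        using r by (intro sum.cong refl) (simp add: step sum_distrib_right mult.assoc del: pow_mat.simps)
      also have "\<dots> = (\<Sum>s<dim_N n. (A ^\<^sub>m q) $$ (r, s) * (\<Sum>t<dim_N n. G (int s - int n) (int t - int n) * f (int t - int n)))"
        unfolding sum_distrib_left by (rule sum.swap)
      finally show "(\<Sum>t<dim_N n. (A ^\<^sub>m Suc q) $$ (r, t) * f (int t - int n)) =
        (\<Sum>s<dim_N n. (A ^\<^sub>m q) $$ (r, s) * (\<Sum>t<dim_N n. G (int s - int n) (int t - int n) * f (int t - int n)))" .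
    qed
    also have "\<dots> = (\<Sum>r<dim_N n. \<Sum>s<dim_N n. (A ^\<^sub>m q) $$ (r, s) * (\<Sum>z\<in>?L. G (int s - int n) z * f z))"
      by (simp only: idx[of "\<lambda>z. G _ z * f z"])
    also have "\<dots> = (\<Sum>u\<in>{..q} \<rightarrow>\<^sub>E ?L. (\<Prod>i<q. G (u i) (u (Suc i))) * (\<Sum>z\<in>?L. G (u q) z * f z))"
      by (rule Suc.IH)
    also have "\<dots> = (\<Sum>u\<in>{..Suc q} \<rightarrow>\<^sub>E ?L. (\<Prod>i<Suc q. G (u i) (u (Suc i))) * f (u (Suc q)))"
    proof -
      have "(\<Sum>u\<in>insert (Suc q) {..q} \<rightarrow>\<^sub>E ?L. (\<Prod>i<Suc q. G (u i) (u (Suc i))) * f (u (Suc q))) =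
        (\<Sum>u\<in>{..q} \<rightarrow>\<^sub>E ?L. \<Sum>z\<in>?L. (\<Prod>i<q. G (u i) (u (Suc i))) * (G (u q) z * f z))"
        by (subst sum_PiE_insert) (auto intro!: sum.cong prod.cong)
      then show ?thesis by (simp only: atMost_Suc sum_distrib_left)
    qed
    finally show ?case .
  qed
qed

text \<open>Carries independence from ordered pairs to unordered edges. Along an injection, a finite
  product of events over \<open>J\<close> is the corresponding product over the image of
  \<open>J\<close>.\<close>

lemma (in prob_space) indep_vars_reindex_inj:
  assumes inj: "inj_on f I" and ind: "indep_vars (\<lambda>_. N) Z (f ` I)"
  shows "indep_vars (\<lambda>_. N) (\<lambda>i. Z (f i)) I"
  unfolding indep_vars_def2
proof (intro conjI ballI)
  show "random_variable N (Z (f i))" if "i \<in> I" for i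
    using ind that by (auto simp: indep_vars_def2)
  have IS: "indep_sets (\<lambda>i. {Z i -` A \<inter> space M |A. A \<in> sets N}) (f ` I)"
    using ind by (simp add: indep_vars_def2)
  show "indep_sets (\<lambda>i. {Z (f i) -` A \<inter> space M |A. A \<in> sets N}) I"
    unfolding indep_sets_def
  proof (intro conjI ballI allI impI)
    show "{Z (f i) -` A \<inter> space M |A. A \<in> sets N} \<subseteq> events" if "i \<in> I" for i
      using IS that by (auto simp: indep_sets_def)
    fix J A assume J: "J \<subseteq> I" "J \<noteq> {}" "finite J" and A: "A \<in> Pi J (\<lambda>i. {Z (f i) -` A \<inter> space M |A. A \<in> sets N})"
    have injJ: "inj_on f J" using inj J(1) by (rule inj_on_subset)
    define A' where "A' j = A (inv_into J f j)" for j
    have A'f: "A' (f i) = A i" if "i \<in> J" for i using injJ that by (simp add: A'_def)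
    have "prob (\<Inter>j\<in>f ` J. A' j) = (\<Prod>j\<in>f ` J. prob (A' j))"
    proof (rule indep_setsD[OF IS])
      show "\<forall>j\<in>f ` J. A' j \<in> {Z j -` A \<inter> space M |A. A \<in> sets N}"
        using A A'f by (auto simp: Pi_def)
    qed (use J in auto)
    then show "prob (\<Inter>j\<in>J. A j) = (\<Prod>j\<in>J. prob (A j))"
      using A'f by (simp add: prod.reindex[OF injJ] image_image)
  qed
qed

section \<open>The random graph at fixed size and moments of walk products\<close>

locale edge_model = walk_weights + prob_space M for M :: "'w measure" +
  fixes n q :: nat and c R :: real and a :: "int \<Rightarrow> int \<Rightarrow> 'w \<Rightarrow> real"
  assumes edge_vars: "edge_variables M \<psi> n c R a"
    and c_pos: "0 < c" and c_le: "c \<le> real (dim_N n)"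
begin

abbreviation "L \<equiv> lattice_segment n"

definition edge_sets :: "int set set" where
  "edge_sets = {{i, j} |i j. i \<in> L \<and> j \<in> L \<and> i \<noteq> j}"

text \<open>Walks traverse edges in both directions, so the variables are indexed by unordered
  edges; minimum and maximum recover the ordered pair for which \<open>a\<close> is
  specified.\<close>

definition \<xi> :: "int set \<Rightarrow> 'w \<Rightarrow> real" where
  "\<xi> e = a (Min e) (Max e)"

definition ep :: "int set \<Rightarrow> real" where
  "ep e = c / real (dim_N n) * exp (- (\<psi> (edge_length e / R))\<^sup>2)"

definition ew :: "int set \<Rightarrow> real" where
  "ew e = 1 + real \<alpha> * (\<psi> (edge_length e / R))\<^sup>2"

definition walks :: "(nat \<Rightarrow> int) set" where
  "walks = {u \<in> {..q} \<rightarrow>\<^sub>E L. \<forall>i<q. u i \<noteq> u (Suc i)}"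

text \<open>A set, because repeated factors of a 0/1 variable collapse; the number of traversals is
  remembered only by \<open>weight\<close>.\<close>

definition trace :: "(nat \<Rightarrow> int) \<Rightarrow> int set set" where
  "trace u = (\<lambda>i. {u i, u (Suc i)}) ` {..<q}"

definition weight :: "(nat \<Rightarrow> int) \<Rightarrow> real" where
  "weight u = (\<Prod>i<q. ew {u i, u (Suc i)})"

definition pr :: "int set set \<Rightarrow> real" where
  "pr S = (\<Prod>e\<in>S. ep e)"

definition T :: "(nat \<Rightarrow> int) \<Rightarrow> 'w \<Rightarrow> real" where
  "T u \<omega> = weight u * (\<Prod>e\<in>trace u. \<xi> e \<omega>)"

lemma finite_walks: "finite walks"
  unfolding walks_def by (simp add: finite_PiE)

lemma finite_edge_sets: "finite edge_sets"
proof (rule finite_subset)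
  show "edge_sets \<subseteq> Pow L" by (auto simp: edge_sets_def)
qed simp

lemma trace_subset: "u \<in> walks \<Longrightarrow> trace u \<subseteq> edge_sets"
proof
  fix e assume u: "u \<in> walks" and "e \<in> trace u"
  then obtain i where i: "i < q" "e = {u i, u (Suc i)}" by (auto simp: trace_def)
  then have "u i \<in> L" "u (Suc i) \<in> L" "u i \<noteq> u (Suc i)" using u by (auto simp: walks_def)
  then show "e \<in> edge_sets" using i unfolding edge_sets_def by blast
qed

lemma finite_trace: "finite (trace u)"
  by (simp add: trace_def)

lemma edge_setsE:
  assumes "e \<in> edge_sets"
  obtains i j where "e = {i, j}" "(i, j) \<in> edges n" "Min e = i" "Max e = j"
proof -
  obtain i j where ij: "e = {i, j}" "i \<in> L" "j \<in> L" "i \<noteq> j" using assms by (auto simp: edge_sets_def)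
  show ?thesis
  proof (cases "i < j")
    case True
    have "Min e = i" "Max e = j" unfolding ij(1) using True by simp_all
    moreover have "(i, j) \<in> edges n" using ij(2,3) True by (simp add: edges_def lattice_segment_def)
    ultimately show ?thesis by (intro that[OF ij(1)])
  next
    case False
    then have lt: "j < i" using ij(4) by simp
    have "Min e = j" "Max e = i" unfolding ij(1) using lt by simp_all
    moreover have "(j, i) \<in> edges n" using ij(2,3) lt by (simp add: edges_def lattice_segment_def)
    moreover have "e = {j, i}" unfolding ij(1) by (rule insert_commute)
    ultimately show ?thesis by (intro that)
  qed
qed

lemma edge_variable_law:
  assumes "(i, j) \<in> edges n"
  shows "\<omega> \<in> space M \<Longrightarrow> a i j \<omega> \<in> {0, 1}"
    and "prob {\<omega> \<in> space M. a i j \<omega> = 1} = edge_prob \<psi> n c R (i, j)"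
proof -
  have "\<forall>(i, j)\<in>edges n. (\<forall>\<omega>\<in>space M. a i j \<omega> \<in> {0, 1}) \<and> prob {\<omega> \<in> space M. a i j \<omega> = 1} = edge_prob \<psi> n c R (i, j)"
    using edge_vars unfolding edge_variables_def by (elim conjE)
  from bspec[OF this assms]
  have *: "(\<forall>\<omega>\<in>space M. a i j \<omega> \<in> {0, 1}) \<and> prob {\<omega> \<in> space M. a i j \<omega> = 1} = edge_prob \<psi> n c R (i, j)"
    unfolding prod.case .
  show "\<omega> \<in> space M \<Longrightarrow> a i j \<omega> \<in> {0, 1}" by (rule bspec[OF conjunct1[OF *]])
  show "prob {\<omega> \<in> space M. a i j \<omega> = 1} = edge_prob \<psi> n c R (i, j)" by (rule conjunct2[OF *])
qed

lemma \<xi>_01: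
  assumes "e \<in> edge_sets" "\<omega> \<in> space M"
  shows "\<xi> e \<omega> = 0 \<or> \<xi> e \<omega> = 1"
proof -
  obtain i j where e: "(i, j) \<in> edges n" "Min e = i" "Max e = j" by (rule edge_setsE[OF assms(1)])
  have "a i j \<omega> \<in> {0, 1}" by (rule edge_variable_law(1)[OF e(1) assms(2)])
  then show ?thesis by (simp add: \<xi>_def e(2,3))
qed

lemma prob_\<xi>:
  assumes "e \<in> edge_sets"
  shows "prob {\<omega> \<in> space M. \<xi> e \<omega> = 1} = ep e"
proof -
  obtain i j where e: "e = {i, j}" "(i, j) \<in> edges n" "Min e = i" "Max e = j" by (rule edge_setsE[OF assms(1)])
  have "edge_length e / R = - (real_of_int (i - j) / R)"
    unfolding edge_length_def e(3,4) by (simp add: diff_divide_distrib)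
  then have "\<psi> (real_of_int (i - j) / R) = \<psi> (edge_length e / R)" by (simp only: psi_even)
  moreover have "prob {\<omega> \<in> space M. a i j \<omega> = 1} = edge_prob \<psi> n c R (i, j)"
    by (rule edge_variable_law(2)[OF e(2)])
  ultimately show ?thesis unfolding \<xi>_def edge_prob_def ep_def e(3,4) prod.case by (simp only:)
qed

lemma indep_\<xi>: "indep_vars (\<lambda>_. borel) \<xi> edge_sets"
proof -
  let ?f = "\<lambda>e. (Min e, Max e) :: int \<times> int"
  have inj: "inj_on ?f edge_sets"
  proof (rule inj_onI)
    fix e e' assume e: "e \<in> edge_sets" "e' \<in> edge_sets" "?f e = ?f e'"
    have "e = {Min e, Max e}" by (rule edge_setsE[OF e(1)]) simp
    also have "\<dots> = {Min e', Max e'}" using e(3) by simp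
    also have "\<dots> = e'" by (rule edge_setsE[OF e(2)]) simp
    finally show "e = e'" .
  qed
  have sub: "?f ` edge_sets \<subseteq> edges n"
  proof
    fix p assume "p \<in> ?f ` edge_sets"
    then obtain e where e: "e \<in> edge_sets" "p = ?f e" by blast
    show "p \<in> edges n" by (rule edge_setsE[OF e(1)]) (simp add: e(2))
  qed
  have "indep_vars (\<lambda>_. borel) (\<lambda>(i, j). a i j) (edges n)"
    using edge_vars by (simp add: edge_variables_def)
  from indep_vars_reindex_inj[OF inj indep_vars_subset[OF this sub]]
  have "indep_vars (\<lambda>_. borel) (\<lambda>e. (\<lambda>(i, j). a i j) (?f e)) edge_sets" .
  then show ?thesis by (simp add: \<xi>_def[abs_def])
qed

lemma bounded_rv_\<xi>: "e \<in> edge_sets \<Longrightarrow> bounded_rv M (\<xi> e)"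
  unfolding bounded_rv_def
proof
  assume e: "e \<in> edge_sets"
  show "\<xi> e \<in> borel_measurable M" using indep_\<xi> e by (simp add: indep_vars_def)
  have "norm (\<xi> e \<omega>) \<le> 1" if "\<omega> \<in> space M" for \<omega> using \<xi>_01[OF e that] by auto
  then show "\<exists>B. \<forall>\<omega>\<in>space M. norm (\<xi> e \<omega>) \<le> B" by blast
qed

lemma ep_bounds: "0 < ep e" "ep e \<le> c / real (dim_N n)"
proof -
  show "0 < ep e" using c_pos dim_N_pos[of n] by (simp add: ep_def)
  have "ep e \<le> c / real (dim_N n) * 1"
    unfolding ep_def using c_pos dim_N_pos[of n] by (intro mult_left_mono) auto
  then show "ep e \<le> c / real (dim_N n)" by simp
qed

lemma ep_le_1: "ep e \<le> 1"
  using ep_bounds(2)[of e] c_le dim_N_pos[of n] by (meson divide_le_eq_1_pos order_trans)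

lemma ew_ge_1: "1 \<le> ew e"
  by (simp add: ew_def)

lemma weight_nonneg: "0 \<le> weight u"
  unfolding weight_def using ew_ge_1 by (intro prod_nonneg) (auto intro: order_trans[OF zero_le_one])

lemma pr_nonneg: "0 \<le> pr S"
  unfolding pr_def using ep_bounds by (intro prod_nonneg) (auto simp: less_imp_le)

lemma expectation_\<xi>: "e \<in> edge_sets \<Longrightarrow> expectation (\<xi> e) = ep e"
proof -
  assume e: "e \<in> edge_sets"
  have m: "{\<omega> \<in> space M. \<xi> e \<omega> = 1} \<in> events" using bounded_rvD[OF bounded_rv_\<xi>[OF e]] by measurable
  have "expectation (\<xi> e) = expectation (indicator {\<omega> \<in> space M. \<xi> e \<omega> = 1})"
    using \<xi>_01[OF e] by (intro Bochner_Integration.integral_cong) (auto simp: indicator_def)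
  also have "\<dots> = ep e" using m prob_\<xi>[OF e] by simp
  finally show ?thesis .
qed

lemma prod_\<xi>: "S \<subseteq> edge_sets \<Longrightarrow> \<omega> \<in> space M \<Longrightarrow> finite S \<Longrightarrow> (\<Prod>e\<in>S. \<xi> e \<omega>) = of_bool (\<forall>e\<in>S. \<xi> e \<omega> = 1)"
proof -
  assume S: "S \<subseteq> edge_sets" "\<omega> \<in> space M" "finite S"
  show ?thesis
  proof (cases "\<forall>e\<in>S. \<xi> e \<omega> = 1")
    case False
    then obtain e where "e \<in> S" "\<xi> e \<omega> = 0" using \<xi>_01 S by blast
    then have "(\<Prod>e\<in>S. \<xi> e \<omega>) = 0" using S(3) by (auto intro: prod_zero)
    then show ?thesis using False by simp
  qed simp
qed

text \<open>Shared edges occur twice on the left, which is harmless because the variables are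
  idempotent. Joint moments of walks thus reduce to \<open>pr\<close> of a union of traces.\<close>

lemma prod_\<xi>_Un:
  assumes "S \<subseteq> edge_sets" "S' \<subseteq> edge_sets" "\<omega> \<in> space M" "finite S" "finite S'"
  shows "(\<Prod>e\<in>S. \<xi> e \<omega>) * (\<Prod>e\<in>S'. \<xi> e \<omega>) = (\<Prod>e\<in>S \<union> S'. \<xi> e \<omega>)"
  using assms by (simp add: prod_\<xi> ball_Un flip: of_bool_conj)

lemma expectation_prod_\<xi>: "S \<subseteq> edge_sets \<Longrightarrow> expectation (\<lambda>\<omega>. \<Prod>e\<in>S. \<xi> e \<omega>) = pr S"
proof -
  assume S: "S \<subseteq> edge_sets"
  have "expectation (\<lambda>\<omega>. \<Prod>e\<in>S. \<xi> e \<omega>) = (\<Prod>e\<in>S. expectation (\<xi> e))"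
    using S finite_subset[OF S finite_edge_sets] bounded_rv_\<xi>
    by (intro indep_vars_lebesgue_integral[OF _ indep_vars_subset[OF indep_\<xi> S]]) (auto intro: integrable_bounded_rv)
  also have "\<dots> = pr S" unfolding pr_def using S by (intro prod.cong refl expectation_\<xi>) auto
  finally show ?thesis .
qed

lemma bounded_rv_T: "u \<in> walks \<Longrightarrow> bounded_rv M (T u)"
  unfolding T_def[abs_def] using trace_subset bounded_rv_\<xi> by (intro bounded_rv_intros) auto

lemma expectation_T: "u \<in> walks \<Longrightarrow> expectation (T u) = weight u * pr (trace u)"
  unfolding T_def[abs_def] using expectation_prod_\<xi>[OF trace_subset] by simp

lemma T_mult:
  "u \<in> walks \<Longrightarrow> v \<in> walks \<Longrightarrow> \<omega> \<in> space M \<Longrightarrow> T u \<omega> * T v \<omega> = weight u * weight v * (\<Prod>e\<in>trace u \<union> trace v. \<xi> e \<omega>)"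
  unfolding T_def using prod_\<xi>_Un[OF trace_subset trace_subset _ finite_trace finite_trace, of u v \<omega>] by (simp add: mult_ac)

lemma expectation_T2:
  assumes "u \<in> walks" "v \<in> walks"
  shows "expectation (\<lambda>\<omega>. T u \<omega> * T v \<omega>) = weight u * weight v * pr (trace u \<union> trace v)"
proof -
  have "expectation (\<lambda>\<omega>. T u \<omega> * T v \<omega>) = expectation (\<lambda>\<omega>. weight u * weight v * (\<Prod>e\<in>trace u \<union> trace v. \<xi> e \<omega>))"
    by (intro Bochner_Integration.integral_cong refl T_mult assms)
  then show ?thesis using expectation_prod_\<xi>[of "trace u \<union> trace v"] trace_subset assms by simp
qed

lemma expectation_T3:
  assumes "u \<in> walks" "v \<in> walks" "z \<in> walks"
  shows "expectation (\<lambda>\<omega>. T u \<omega> * T v \<omega> * T z \<omega>) = weight u * weight v * weight z * pr (trace u \<union> trace v \<union> trace z)"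
proof -
  have "expectation (\<lambda>\<omega>. T u \<omega> * T v \<omega> * T z \<omega>) = expectation (\<lambda>\<omega>. weight u * weight v * weight z * (\<Prod>e\<in>trace u \<union> trace v \<union> trace z. \<xi> e \<omega>))"
  proof (intro Bochner_Integration.integral_cong refl)
    fix \<omega> assume w: "\<omega> \<in> space M"
    show "T u \<omega> * T v \<omega> * T z \<omega> = weight u * weight v * weight z * (\<Prod>e\<in>trace u \<union> trace v \<union> trace z. \<xi> e \<omega>)"
      unfolding T_mult[OF assms(1,2) w] unfolding T_def
      using prod_\<xi>_Un[of "trace u \<union> trace v" "trace z" \<omega>] trace_subset[OF assms(1)] trace_subset[OF assms(2)] trace_subset[OF assms(3)] w finite_trace
      by (simp add: mult_ac)
  qed
  then show ?thesis using expectation_prod_\<xi>[of "trace u \<union> trace v \<union> trace z"] trace_subset assms by simp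
qed

lemma pr_mult_le: "finite S \<Longrightarrow> finite S' \<Longrightarrow> pr S * pr S' \<le> pr (S \<union> S')"
proof -
  assume f: "finite S" "finite S'"
  have "pr S * pr S' = pr (S \<union> S') * pr (S \<inter> S')"
    unfolding pr_def using prod.union_inter[OF f, of ep] by simp
  also have "\<dots> \<le> pr (S \<union> S') * 1"
    unfolding pr_def using ep_bounds ep_le_1 by (intro mult_left_mono prod_le_1 prod_nonneg) (auto simp: less_imp_le)
  finally show ?thesis by simp
qed

text \<open>The quotient of the two sides of inclusion-exclusion is \<open>pr\<close> of the
  intersection, and one common edge makes it at most c / N. Products of means are therefore
  negligible against joint moments of walks that share an edge.\<close>

lemma pr_mult_le_linked:
  assumes f: "finite S" "finite S'" and ne: "S \<inter> S' \<noteq> {}"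
  shows "pr S * pr S' \<le> c / real (dim_N n) * pr (S \<union> S')"
proof -
  obtain e where e: "e \<in> S \<inter> S'" using ne by auto
  have "pr S * pr S' = pr (S \<union> S') * pr (S \<inter> S')"
    unfolding pr_def using prod.union_inter[OF f, of ep] by simp
  also have "\<dots> \<le> pr (S \<union> S') * (c / real (dim_N n))"
  proof (rule mult_left_mono[OF _ pr_nonneg])
    have "pr (S \<inter> S') = ep e * pr (S \<inter> S' - {e})" unfolding pr_def using f e by (intro prod.remove) auto
    also have "\<dots> \<le> c / real (dim_N n) * 1"
      using ep_bounds ep_le_1 c_pos unfolding pr_def by (intro mult_mono prod_le_1 prod_nonneg) (auto simp: less_imp_le)
    finally show "pr (S \<inter> S') \<le> c / real (dim_N n)" by simp
  qed
  finally show ?thesis by (simp add: mult.commute)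
qed

lemma indep_expectation:
  fixes f g :: "(int set \<Rightarrow> real) \<Rightarrow> complex"
  assumes AB: "A \<inter> B = {}" "A \<subseteq> edge_sets" "B \<subseteq> edge_sets"
    and meas: "f \<in> borel_measurable (PiM A (\<lambda>_. borel))" "g \<in> borel_measurable (PiM B (\<lambda>_. borel))"
    and bd: "bounded_rv M (\<lambda>\<omega>. f (\<lambda>e\<in>A. \<xi> e \<omega>))" "bounded_rv M (\<lambda>\<omega>. g (\<lambda>e\<in>B. \<xi> e \<omega>))"
  shows "expectation (\<lambda>\<omega>. f (\<lambda>e\<in>A. \<xi> e \<omega>) * g (\<lambda>e\<in>B. \<xi> e \<omega>)) = expectation (\<lambda>\<omega>. f (\<lambda>e\<in>A. \<xi> e \<omega>)) * expectation (\<lambda>\<omega>. g (\<lambda>e\<in>B. \<xi> e \<omega>))"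
  using indep_var_lebesgue_integral[OF indep_var_compose[OF indep_var_restrict[OF indep_\<xi> AB] meas]] bd
  by (simp add: comp_def integrable_bounded_rv)

end

context edge_model
begin

section \<open>Tuples of walks as functions on positions\<close>

definition pattern_total :: "nat \<Rightarrow> real" where
  "pattern_total r = (\<Sum>g\<in>patterns r q. pattern_sum \<alpha> \<psi> n c R r q g)"

definition join :: "nat \<Rightarrow> (nat \<Rightarrow> nat \<Rightarrow> int) \<Rightarrow> nat \<times> nat \<Rightarrow> int" where
  "join r w = (\<lambda>s\<in>positions r q. w (fst s) (snd s))"

definition split_walk :: "(nat \<times> nat \<Rightarrow> int) \<Rightarrow> nat \<Rightarrow> nat \<Rightarrow> int" where
  "split_walk f b = (\<lambda>i\<in>{..q}. f (b, i))"

definition chained :: "nat \<Rightarrow> (nat \<Rightarrow> nat \<Rightarrow> int) \<Rightarrow> bool" where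
  "chained r w \<longleftrightarrow> (\<forall>b<r. 0 < b \<longrightarrow> trace (w b) \<inter> (\<Union>b'<b. trace (w b')) \<noteq> {})"

lemma chained_2: "chained 2 w \<longleftrightarrow> trace (w 1) \<inter> trace (w 0) \<noteq> {}"
proof -
  have "(\<forall>b<2. 0 < b \<longrightarrow> P b) \<longleftrightarrow> P 1" for P :: "nat \<Rightarrow> bool" by (auto simp: less_2_cases_iff)
  moreover have "{..<1::nat} = {0}" by auto
  ultimately show ?thesis unfolding chained_def by simp
qed

lemma chained_3:
  "chained 3 w \<longleftrightarrow> trace (w 1) \<inter> trace (w 0) \<noteq> {} \<and> trace (w 2) \<inter> (trace (w 0) \<union> trace (w 1)) \<noteq> {}"
proof -
  have "b < 3 \<longleftrightarrow> b = 0 \<or> b = 1 \<or> b = 2" for b :: nat by auto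
  then have "(\<forall>b<3. 0 < b \<longrightarrow> P b) \<longleftrightarrow> P 1 \<and> P 2" for P :: "nat \<Rightarrow> bool" by auto
  moreover have "{..<1::nat} = {0}" "{..<2::nat} = {0, 1}" by auto
  ultimately show ?thesis unfolding chained_def by simp
qed

lemma kernel_eq: "kernel \<alpha> \<psi> n c R m e = ep e * ew e ^ m"
  using alpha by (auto simp: kernel_def profile_def ep_def ew_def mult_ac)

lemma walk_edge_join: "b < r \<Longrightarrow> i < q \<Longrightarrow> walk_edge (join r w) (b, i) = {w b i, w b (Suc i)}"
  by (simp add: walk_edge_def join_def positions_def)

lemma all_edges_join: "all_edges r q (join r w) = (\<Union>b<r. trace (w b))"
proof -
  have "all_edges r q (join r w) = (\<Union>b<r. (\<lambda>i. walk_edge (join r w) (b, i)) ` {..<q})"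
    unfolding all_edges_def by auto
  also have "\<dots> = (\<Union>b<r. trace (w b))"
    unfolding trace_def by (intro SUP_cong refl image_cong) (auto simp: walk_edge_join)
  finally show ?thesis .
qed

text \<open>The weights taken step by step are regrouped by the edge traversed; the multiplicity of
  that edge becomes the exponent inside \<open>kernel\<close>.\<close>

lemma edge_product_join:
  "(\<Prod>e\<in>all_edges r q (join r w). kernel \<alpha> \<psi> n c R (edge_mult r q (join r w) e) e) =
     pr (\<Union>b<r. trace (w b)) * (\<Prod>b<r. weight (w b))"
proof -
  let ?f = "join r w"
  have "(\<Prod>e\<in>all_edges r q ?f. ew e ^ edge_mult r q ?f e) = (\<Prod>s\<in>{..<r} \<times> {..<q}. ew (walk_edge ?f s))"
  proof -
    have "(\<Prod>s\<in>{..<r} \<times> {..<q}. ew (walk_edge ?f s)) =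
      (\<Prod>e\<in>walk_edge ?f ` ({..<r} \<times> {..<q}). \<Prod>s\<in>{s \<in> {..<r} \<times> {..<q}. walk_edge ?f s = e}. ew (walk_edge ?f s))"
      by (rule prod.image_gen) simp
    also have "\<dots> = (\<Prod>e\<in>all_edges r q ?f. ew e ^ edge_mult r q ?f e)"
      unfolding all_edges_def edge_mult_def by (intro prod.cong refl) simp
    finally show ?thesis by simp
  qed
  also have "\<dots> = (\<Prod>b<r. \<Prod>i<q. ew (walk_edge ?f (b, i)))"
    by (simp add: prod.cartesian_product)
  also have "\<dots> = (\<Prod>b<r. weight (w b))"
    unfolding weight_def by (intro prod.cong refl) (simp add: walk_edge_join)
  finally show ?thesis
    unfolding kernel_eq prod.distrib by (simp add: all_edges_join pr_def)
qed

lemma linked_join: "linked r q (join r w) \<longleftrightarrow> chained r w"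
proof -
  have "(\<exists>i<q. \<exists>b'<b. \<exists>j<q. walk_edge (join r w) (b, i) = walk_edge (join r w) (b', j)) \<longleftrightarrow>
      trace (w b) \<inter> (\<Union>b'<b. trace (w b')) \<noteq> {}" if "b < r" for b
  proof -
    have "(\<exists>i<q. \<exists>b'<b. \<exists>j<q. walk_edge (join r w) (b, i) = walk_edge (join r w) (b', j)) \<longleftrightarrow>
      (\<exists>i<q. \<exists>b'<b. \<exists>j<q. {w b i, w b (Suc i)} = {w b' j, w b' (Suc j)})"
      using that by (simp add: walk_edge_join cong: conj_cong)
    also have "\<dots> \<longleftrightarrow> trace (w b) \<inter> (\<Union>b'<b. trace (w b')) \<noteq> {}"
    proof -
      have ne: "A \<inter> B \<noteq> {} \<longleftrightarrow> (\<exists>x\<in>A. x \<in> B)" for A B :: "int set set" by blast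
      have m: "e \<in> trace u \<longleftrightarrow> (\<exists>i<q. {u i, u (Suc i)} = e)" for e u by (auto simp: trace_def)
      show ?thesis unfolding ne m UN_iff Bex_def lessThan_iff by metis
    qed
    finally show ?thesis .
  qed
  then show ?thesis unfolding linked_def chained_def by simp
qed

lemma join_mem: "(\<And>b. b < r \<Longrightarrow> w b \<in> walks) \<Longrightarrow> join r w \<in> positions r q \<rightarrow>\<^sub>E L \<and> proper r q (join r w)"
proof
  assume w: "\<And>b. b < r \<Longrightarrow> w b \<in> walks"
  have wL: "w b i \<in> L" if "b < r" "i \<le> q" for b i
    using w[OF that(1)] that(2) PiE_mem[of "w b" "{..q}" "\<lambda>_. L" i] by (simp add: walks_def)
  show "join r w \<in> positions r q \<rightarrow>\<^sub>E L"
    unfolding join_def by (intro restrict_PiE_iff[THEN iffD2] ballI) (simp add: wL positions_def mem_Times_iff)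
  have "w b i \<noteq> w b (Suc i)" if "b < r" "i < q" for b i using w[OF that(1)] that(2) by (simp add: walks_def)
  then show "proper r q (join r w)" by (simp add: proper_def join_def positions_def)
qed

lemma split_join:
  assumes "b < r" "w b \<in> walks" shows "split_walk (join r w) b = w b"
proof
  fix i
  have "w b \<in> {..q} \<rightarrow>\<^sub>E L" using assms(2) by (simp add: walks_def)
  from PiE_arb[OF this, of i] show "split_walk (join r w) b i = w b i"
    using assms(1) by (cases "i \<le> q") (simp_all add: split_walk_def join_def positions_def)
qed

lemma join_split:
  assumes "f \<in> positions r q \<rightarrow>\<^sub>E L" shows "join r (split_walk f) = f"
proof
  fix s show "join r (split_walk f) s = f s"
    using PiE_arb[OF assms, of s] by (cases s; cases "s \<in> positions r q") (simp_all add: split_walk_def join_def positions_def)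
qed

lemma split_walk_walks:
  assumes "f \<in> positions r q \<rightarrow>\<^sub>E L" "proper r q f" "b < r" shows "split_walk f b \<in> walks"
  unfolding walks_def
proof (intro CollectI conjI allI impI)
  show "split_walk f b \<in> {..q} \<rightarrow>\<^sub>E L"
    unfolding split_walk_def
  proof (intro restrict_PiE_iff[THEN iffD2] ballI)
    fix i assume "i \<in> {..q}"
    then show "f (b, i) \<in> L" using PiE_mem[OF assms(1), of "(b, i)"] assms(3) by (simp add: positions_def)
  qed
  fix i assume "i < q"
  then show "split_walk f b i \<noteq> split_walk f b (Suc i)"
    using assms(2,3) by (simp add: split_walk_def proper_def)
qed

lemma join_cong: "(\<And>b. b < r \<Longrightarrow> w b = w' b) \<Longrightarrow> join r w = join r w'"
  by (auto simp: join_def positions_def intro!: restrict_ext)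

definition nbhd :: "(nat \<Rightarrow> int) \<Rightarrow> (nat \<Rightarrow> int) set" where
  "nbhd u = {v \<in> walks. trace u \<inter> trace v \<noteq> {}}"

lemma nbhd_subset: "nbhd u \<subseteq> walks"
  by (auto simp: nbhd_def)

lemma finite_nbhd: "finite (nbhd u)"
  using nbhd_subset finite_walks by (rule finite_subset)

lemma pattern_total_eq:
  assumes "1 \<le> r"
  shows "pattern_total r = (\<Sum>f\<in>{f \<in> positions r q \<rightarrow>\<^sub>E L. proper r q f \<and> linked r q f}.
    \<Prod>e\<in>all_edges r q f. kernel \<alpha> \<psi> n c R (edge_mult r q f e) e)"
  unfolding sum_over_patterns[OF finite_lattice_segment] pattern_total_def pattern_sum_def
proof (intro sum.cong refl)
  fix g :: "nat \<times> nat \<Rightarrow> nat \<times> nat" and h assume "h \<in> embeddings (g ` positions r q) L"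
  then have "inj_on h (g ` positions r q)" by (simp add: embeddings_def)
  from edge_product_embedding[OF this assms, of "kernel \<alpha> \<psi> n c R"]
  show "edge_weight (\<lambda>e. kernel \<alpha> \<psi> n c R (edge_mult r q g e)) (all_edges r q g) h =
    (\<Prod>e\<in>all_edges r q (\<lambda>x\<in>positions r q. h (g x)). kernel \<alpha> \<psi> n c R (edge_mult r q (\<lambda>x\<in>positions r q. h (g x)) e) e)"
    by simp
qed

lemma sum_linked_pairs:
  "(\<Sum>u\<in>walks. \<Sum>v\<in>nbhd u. weight u * weight v * pr (trace u \<union> trace v)) = pattern_total 2"
proof -
  \<comment> \<open>Every index other than 0 repeats the second walk, so all values are walks;
    \<open>join 2\<close> reads only the indices 0 and 1.\<close>
  define w where "w p b = (if b = (0::nat) then fst p else snd p)" for p :: "(nat \<Rightarrow> int) \<times> (nat \<Rightarrow> int)" and b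
  have "(\<Sum>u\<in>walks. \<Sum>v\<in>nbhd u. weight u * weight v * pr (trace u \<union> trace v)) =
     (\<Sum>p\<in>Sigma walks nbhd. weight (fst p) * weight (snd p) * pr (trace (fst p) \<union> trace (snd p)))"
    by (subst sum.Sigma) (auto simp: finite_walks finite_nbhd case_prod_beta)
  also have "\<dots> = pattern_total 2"
    unfolding pattern_total_eq[of 2, simplified]
  proof (rule sum.reindex_bij_witness[of _ "\<lambda>f. (split_walk f 0, split_walk f 1)" "\<lambda>p. join 2 (w p)"])
    fix p assume p: "p \<in> Sigma walks nbhd"
    then have ww: "w p b \<in> walks" for b by (auto simp: w_def nbhd_def)
    show "(split_walk (join 2 (w p)) 0, split_walk (join 2 (w p)) 1) = p"
      using split_join[of _ 2 "w p"] ww by (simp add: w_def)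
    have "chained 2 (w p)" using p unfolding chained_2 by (auto simp: nbhd_def w_def)
    then show "join 2 (w p) \<in> {f \<in> positions 2 q \<rightarrow>\<^sub>E L. proper 2 q f \<and> linked 2 q f}"
      using join_mem[of 2 "w p"] ww by (simp add: linked_join)
    have "(\<Union>b<2. trace (w p b)) = trace (fst p) \<union> trace (snd p)" by (auto simp: w_def less_2_cases_iff)
    moreover have "(\<Prod>b<2. weight (w p b)) = weight (fst p) * weight (snd p)" by (simp add: w_def numeral_2_eq_2)
    ultimately show "(\<Prod>e\<in>all_edges 2 q (join 2 (w p)). kernel \<alpha> \<psi> n c R (edge_mult 2 q (join 2 (w p)) e) e) =
      weight (fst p) * weight (snd p) * pr (trace (fst p) \<union> trace (snd p))"
      unfolding edge_product_join by simp
  next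
    fix f assume f: "f \<in> {f \<in> positions 2 q \<rightarrow>\<^sub>E L. proper 2 q f \<and> linked 2 q f}"
    have "join 2 (w (split_walk f 0, split_walk f 1)) = join 2 (split_walk f)"
      by (rule join_cong) (auto simp: w_def less_2_cases_iff)
    then show *: "join 2 (w (split_walk f 0, split_walk f 1)) = f" using f join_split by simp
    have "chained 2 (w (split_walk f 0, split_walk f 1))" unfolding linked_join[symmetric] * using f by simp
    then have "trace (split_walk f 1) \<inter> trace (split_walk f 0) \<noteq> {}"
      unfolding chained_2 by (simp add: w_def)
    then show "(split_walk f 0, split_walk f 1) \<in> Sigma walks nbhd"
      using split_walk_walks[of f 2] f by (auto simp: nbhd_def)
  qed
  finally show ?thesis .
qed

text \<open>The third walk ranges over the union of both neighbourhoods, which matches a chain in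
  which it meets either of the earlier two walks. The sum thereby equals the full pattern total for
  three walks, not merely a bound by it.\<close>

lemma sum_linked_triples:
  "(\<Sum>u\<in>walks. \<Sum>v\<in>nbhd u. \<Sum>z\<in>nbhd u \<union> nbhd v. weight u * weight v * weight z * pr (trace u \<union> trace v \<union> trace z)) = pattern_total 3"
proof -
  define w where "w p b = (if b = (0::nat) then fst p else if b = 1 then fst (snd p) else snd (snd p))"
    for p :: "(nat \<Rightarrow> int) \<times> (nat \<Rightarrow> int) \<times> (nat \<Rightarrow> int)" and b
  let ?S = "Sigma walks (\<lambda>u. Sigma (nbhd u) (\<lambda>v. nbhd u \<union> nbhd v))"
  have l3: "b < 3 \<longleftrightarrow> b = 0 \<or> b = 1 \<or> b = 2" for b :: nat by auto
  have "(\<Sum>u\<in>walks. \<Sum>v\<in>nbhd u. \<Sum>z\<in>nbhd u \<union> nbhd v. weight u * weight v * weight z * pr (trace u \<union> trace v \<union> trace z)) =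
     (\<Sum>p\<in>?S. weight (fst p) * weight (fst (snd p)) * weight (snd (snd p)) * pr (trace (fst p) \<union> trace (fst (snd p)) \<union> trace (snd (snd p))))"
    by (simp add: sum.Sigma finite_walks finite_nbhd case_prod_beta)
  also have "\<dots> = pattern_total 3"
    unfolding pattern_total_eq[of 3, simplified]
  proof (rule sum.reindex_bij_witness[of _ "\<lambda>f. (split_walk f 0, split_walk f 1, split_walk f 2)" "\<lambda>p. join 3 (w p)"])
    fix p assume p: "p \<in> ?S"
    then have ww: "w p b \<in> walks" for b by (auto simp: w_def nbhd_def)
    show "(split_walk (join 3 (w p)) 0, split_walk (join 3 (w p)) 1, split_walk (join 3 (w p)) 2) = p"
      using split_join[of _ 3 "w p"] ww by (simp add: w_def)
    have "trace (w p 1) \<inter> trace (w p 0) \<noteq> {}" "trace (w p 2) \<inter> (trace (w p 0) \<union> trace (w p 1)) \<noteq> {}"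
      using p by (auto simp: w_def nbhd_def)
    then have "chained 3 (w p)" unfolding chained_3 by simp
    then show "join 3 (w p) \<in> {f \<in> positions 3 q \<rightarrow>\<^sub>E L. proper 3 q f \<and> linked 3 q f}"
      using join_mem[of 3 "w p"] ww by (simp add: linked_join)
    have "(\<Union>b<3. trace (w p b)) = trace (fst p) \<union> trace (fst (snd p)) \<union> trace (snd (snd p))" by (auto simp: w_def l3)
    moreover have "(\<Prod>b<3. weight (w p b)) = weight (fst p) * weight (fst (snd p)) * weight (snd (snd p))" by (simp add: w_def numeral_3_eq_3)
    ultimately show "(\<Prod>e\<in>all_edges 3 q (join 3 (w p)). kernel \<alpha> \<psi> n c R (edge_mult 3 q (join 3 (w p)) e) e) =
      weight (fst p) * weight (fst (snd p)) * weight (snd (snd p)) * pr (trace (fst p) \<union> trace (fst (snd p)) \<union> trace (snd (snd p)))"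
      unfolding edge_product_join by simp
  next
    fix f assume f: "f \<in> {f \<in> positions 3 q \<rightarrow>\<^sub>E L. proper 3 q f \<and> linked 3 q f}"
    let ?p = "(split_walk f 0, split_walk f 1, split_walk f 2)"
    have "join 3 (w ?p) = join 3 (split_walk f)"
      by (rule join_cong) (auto simp: w_def l3)
    then show *: "join 3 (w ?p) = f" using f join_split by simp
    have "chained 3 (w ?p)" unfolding linked_join[symmetric] * using f by simp
    then have "trace (split_walk f 1) \<inter> trace (split_walk f 0) \<noteq> {}"
      "trace (split_walk f 2) \<inter> (trace (split_walk f 0) \<union> trace (split_walk f 1)) \<noteq> {}"
      unfolding chained_3 by (simp_all add: w_def)
    then show "?p \<in> ?S"
      using split_walk_walks[of f 3] f by (auto simp: nbhd_def)
  qed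
  finally show ?thesis .
qed

text \<open>The zero diagonal removes all vertex sequences with a repeated consecutive vertex, and
  idempotence of the edge variables turns the product over steps into a product over the
  trace.\<close>

lemma Y_eq_sum:
  assumes \<omega>: "\<omega> \<in> space M"
  shows "Y \<alpha> q \<psi> n R (\<lambda>i j. a i j \<omega>) = (\<Sum>u\<in>walks. T u \<omega>)"
proof -
  define G where "G i j = (if i = j then 0 else ew {i, j} * \<xi> {i, j} \<omega>)" for i j
  have wa: "weighted_adjacency \<alpha> \<psi> n R (\<lambda>i j. a i j \<omega>) = mat (dim_N n) (dim_N n) (\<lambda>(r, s). G (int r - int n) (int s - int n))"
    unfolding weighted_adjacency_def Let_def
  proof (intro arg_cong[of _ _ "mat (dim_N n) (dim_N n)"] ext, clarify)
    fix r s :: nat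
    let ?i = "int r - int n" and ?j = "int s - int n"
    have *: "(1 + real \<alpha> * (\<psi> (real_of_int (i - j) / R))\<^sup>2) * a i j \<omega> = ew {i, j} * \<xi> {i, j} \<omega>" if "i < j" for i j
    proof -
      have "edge_length {i, j} / R = - (real_of_int (i - j) / R)"
        using that by (simp add: edge_length_doubleton diff_divide_distrib)
      then have "\<psi> (real_of_int (i - j) / R) = \<psi> (edge_length {i, j} / R)" by (simp only: psi_even)
      then show ?thesis using that by (simp add: ew_def \<xi>_def)
    qed
    show "(if ?i < ?j then (1 + real \<alpha> * (\<psi> (real_of_int (?i - ?j) / R))\<^sup>2) * a ?i ?j \<omega>
       else if ?j < ?i then (1 + real \<alpha> * (\<psi> (real_of_int (?j - ?i) / R))\<^sup>2) * a ?j ?i \<omega> else 0) = G ?i ?j"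
      unfolding G_def using *[of ?i ?j] *[of ?j ?i] by (cases ?i ?j rule: linorder_cases) (simp_all only: insert_commute if_True if_False, simp_all)
  qed
  have "Y \<alpha> q \<psi> n R (\<lambda>i j. a i j \<omega>) = (\<Sum>u\<in>{..q} \<rightarrow>\<^sub>E L. \<Prod>i<q. G (u i) (u (Suc i)))"
    using sum_matrix_power[where G = G and n = n and q = q and f = "\<lambda>_. 1"] by (simp add: Y_def wa)
  also have "\<dots> = (\<Sum>u\<in>walks. \<Prod>i<q. G (u i) (u (Suc i)))"
  proof (rule sum.mono_neutral_right)
    show "\<forall>u\<in>({..q} \<rightarrow>\<^sub>E L) - walks. (\<Prod>i<q. G (u i) (u (Suc i))) = 0"
    proof
      fix u assume "u \<in> ({..q} \<rightarrow>\<^sub>E L) - walks"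
      then obtain i where "i < q" "u i = u (Suc i)" by (auto simp: walks_def)
      then show "(\<Prod>i<q. G (u i) (u (Suc i))) = 0" by (intro prod_zero) (auto simp: G_def)
    qed
  qed (auto simp: walks_def finite_PiE)
  also have "\<dots> = (\<Sum>u\<in>walks. T u \<omega>)"
  proof (rule sum.cong[OF refl])
    fix u assume u: "u \<in> walks"
    have "(\<Prod>i<q. G (u i) (u (Suc i))) = (\<Prod>i<q. ew {u i, u (Suc i)} * \<xi> {u i, u (Suc i)} \<omega>)"
      using u by (intro prod.cong refl) (auto simp: G_def walks_def)
    also have "\<dots> = weight u * (\<Prod>i<q. \<xi> {u i, u (Suc i)} \<omega>)" by (simp add: prod.distrib weight_def)
    also have "(\<Prod>i<q. \<xi> {u i, u (Suc i)} \<omega>) = of_bool (\<forall>e\<in>trace u. \<xi> e \<omega> = 1)"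
    proof (cases "\<forall>e\<in>trace u. \<xi> e \<omega> = 1")
      case True
      then have "(\<Prod>i<q. \<xi> {u i, u (Suc i)} \<omega>) = (\<Prod>i<q. 1)" by (intro prod.cong refl) (auto simp: trace_def)
      then show ?thesis using True by simp
    next
      case False
      then obtain i where "i < q" "\<xi> {u i, u (Suc i)} \<omega> \<noteq> 1" by (auto simp: trace_def)
      moreover have "{u i, u (Suc i)} \<in> edge_sets" using trace_subset[OF u] \<open>i < q\<close> by (auto simp: trace_def)
      ultimately have "\<xi> {u i, u (Suc i)} \<omega> = 0" using \<xi>_01[OF _ \<omega>] by blast
      then have z: "(\<Prod>i<q. \<xi> {u i, u (Suc i)} \<omega>) = 0" using \<open>i < q\<close> by (intro prod_zero) auto
      show ?thesis unfolding z using False by simp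
    qed
    also have "\<dots> = (\<Prod>e\<in>trace u. \<xi> e \<omega>)" using prod_\<xi>[OF trace_subset[OF u] \<omega> finite_trace] by simp
    finally show "(\<Prod>i<q. G (u i) (u (Suc i))) = T u \<omega>" by (simp add: T_def)
  qed
  finally show ?thesis .
qed

section \<open>Covariances of walks and the variance of their sum\<close>

definition mean :: "(nat \<Rightarrow> int) \<Rightarrow> real" where
  "mean u = weight u * pr (trace u)"

definition covar :: "(nat \<Rightarrow> int) \<Rightarrow> (nat \<Rightarrow> int) \<Rightarrow> real" where
  "covar u v = weight u * weight v * pr (trace u \<union> trace v) - mean u * mean v"

lemma mean_nonneg: "0 \<le> mean u"
  unfolding mean_def by (intro mult_nonneg_nonneg weight_nonneg pr_nonneg)

lemma expectation_centered:
  assumes "u \<in> walks" "v \<in> walks"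
  shows "expectation (\<lambda>\<omega>. (T u \<omega> - mean u) * (T v \<omega> - mean v)) = covar u v"
proof -
  note i = integrable_bounded_rv[OF bounded_rv_T[OF assms(1)]] integrable_bounded_rv[OF bounded_rv_T[OF assms(2)]]
    integrable_bounded_rv[OF bounded_rv_mult[OF bounded_rv_T[OF assms(1)] bounded_rv_T[OF assms(2)]]]
  have "expectation (\<lambda>\<omega>. (T u \<omega> - mean u) * (T v \<omega> - mean v)) =
    expectation (\<lambda>\<omega>. T u \<omega> * T v \<omega> - mean v * T u \<omega> - mean u * T v \<omega> + mean u * mean v)"
    by (simp add: algebra_simps)
  also have "\<dots> = expectation (\<lambda>\<omega>. T u \<omega> * T v \<omega>) - mean v * expectation (T u) - mean u * expectation (T v) + mean u * mean v"
    using i by (simp add: prob_space)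
  also have "\<dots> = covar u v"
    by (simp add: expectation_T2[OF assms] expectation_T assms covar_def mean_def algebra_simps)
  finally show ?thesis .
qed

lemma covar_unlinked:
  assumes "u \<in> walks" "v \<in> walks" "v \<notin> nbhd u"
  shows "covar u v = 0"
proof -
  have "trace u \<inter> trace v = {}" using assms by (auto simp: nbhd_def)
  then have "pr (trace u \<union> trace v) = pr (trace u) * pr (trace v)"
    unfolding pr_def by (intro prod.union_disjoint finite_trace)
  then show ?thesis by (simp add: covar_def mean_def)
qed

text \<open>The product of the means is nonnegative and at most c / N times the joint moment. Since
  c = o(N), the variance is asymptotically the pattern total for pairs, and its covariances need not
  be evaluated exactly.\<close>

lemma covar_linked:
  assumes "v \<in> nbhd u"
  shows "covar u v \<le> weight u * weight v * pr (trace u \<union> trace v)"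
    and "(1 - c / real (dim_N n)) * (weight u * weight v * pr (trace u \<union> trace v)) \<le> covar u v"
proof -
  show "covar u v \<le> weight u * weight v * pr (trace u \<union> trace v)"
    using mult_nonneg_nonneg[OF mean_nonneg[of u] mean_nonneg[of v]] by (simp add: covar_def)
  have "trace u \<inter> trace v \<noteq> {}" using assms by (simp add: nbhd_def)
  from pr_mult_le_linked[OF finite_trace finite_trace this]
  have "weight u * weight v * (pr (trace u) * pr (trace v)) \<le> weight u * weight v * (c / real (dim_N n) * pr (trace u \<union> trace v))"
    by (intro mult_left_mono mult_nonneg_nonneg weight_nonneg)
  then show "(1 - c / real (dim_N n)) * (weight u * weight v * pr (trace u \<union> trace v)) \<le> covar u v"
    by (simp add: covar_def mean_def algebra_simps)
qed

definition Yv :: "'w \<Rightarrow> real" where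
  "Yv \<omega> = Y \<alpha> q \<psi> n R (\<lambda>i j. a i j \<omega>)"

lemma bounded_rv_Yv: "bounded_rv M Yv"
proof -
  have "bounded_rv M (\<lambda>\<omega>. \<Sum>u\<in>walks. T u \<omega>)" by (intro bounded_rv_intros bounded_rv_T)
  moreover have "Yv \<omega> = (\<Sum>u\<in>walks. T u \<omega>)" if "\<omega> \<in> space M" for \<omega>
    unfolding Yv_def by (rule Y_eq_sum[OF that])
  ultimately show ?thesis unfolding bounded_rv_def by (simp cong: measurable_cong)
qed

lemma centered_Yv:
  assumes "\<omega> \<in> space M"
  shows "Yv \<omega> - expectation Yv = (\<Sum>u\<in>walks. T u \<omega> - mean u)"
proof -
  have "expectation Yv = expectation (\<lambda>\<omega>. \<Sum>u\<in>walks. T u \<omega>)"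
    unfolding Yv_def by (intro Bochner_Integration.integral_cong refl Y_eq_sum)
  also have "\<dots> = (\<Sum>u\<in>walks. expectation (T u))"
    by (intro Bochner_Integration.integral_sum integrable_bounded_rv bounded_rv_T)
  also have "\<dots> = (\<Sum>u\<in>walks. mean u)" by (intro sum.cong refl) (simp add: expectation_T mean_def)
  finally show ?thesis using Y_eq_sum[OF assms] by (simp add: Yv_def sum_subtractf)
qed

lemma variance_Yv: "variance Yv = (\<Sum>u\<in>walks. \<Sum>v\<in>nbhd u. covar u v)"
proof -
  have "variance Yv = expectation (\<lambda>\<omega>. \<Sum>u\<in>walks. \<Sum>v\<in>walks. (T u \<omega> - mean u) * (T v \<omega> - mean v))"
    by (intro Bochner_Integration.integral_cong refl) (simp add: centered_Yv power2_eq_square sum_product)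
  also have "\<dots> = (\<Sum>u\<in>walks. expectation (\<lambda>\<omega>. \<Sum>v\<in>walks. (T u \<omega> - mean u) * (T v \<omega> - mean v)))"
    by (intro Bochner_Integration.integral_sum integrable_bounded_rv bounded_rv_intros bounded_rv_T)
  also have "\<dots> = (\<Sum>u\<in>walks. \<Sum>v\<in>walks. covar u v)"
  proof (rule sum.cong[OF refl])
    fix u assume u: "u \<in> walks"
    have "expectation (\<lambda>\<omega>. \<Sum>v\<in>walks. (T u \<omega> - mean u) * (T v \<omega> - mean v)) =
       (\<Sum>v\<in>walks. expectation (\<lambda>\<omega>. (T u \<omega> - mean u) * (T v \<omega> - mean v)))"
      using u by (intro Bochner_Integration.integral_sum integrable_bounded_rv bounded_rv_intros bounded_rv_T)
    then show "expectation (\<lambda>\<omega>. \<Sum>v\<in>walks. (T u \<omega> - mean u) * (T v \<omega> - mean v)) = (\<Sum>v\<in>walks. covar u v)"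
      using u by (simp add: expectation_centered)
  qed
  also have "\<dots> = (\<Sum>u\<in>walks. \<Sum>v\<in>nbhd u. covar u v)"
    by (intro sum.cong refl sum.mono_neutral_right finite_walks nbhd_subset) (auto simp: covar_unlinked)
  finally show ?thesis .
qed

lemma variance_bounds:
  shows "variance Yv \<le> pattern_total 2" "(1 - c / real (dim_N n)) * pattern_total 2 \<le> variance Yv"
  unfolding variance_Yv sum_linked_pairs[symmetric] sum_distrib_left
  by (intro sum_mono covar_linked; assumption)+

end

section \<open>Normal approximation of the walk sum\<close>

context edge_model
begin

definition scaled :: "real \<Rightarrow> (nat \<Rightarrow> int) \<Rightarrow> 'w \<Rightarrow> real" where
  "scaled s u \<omega> = (T u \<omega> - mean u) / s"

text \<open>The same quantity as \<open>scaled\<close>, read as a function of an edge configuration: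
  independence of disjoint edge sets is a statement about functions of restricted
  configurations.\<close>

definition scaled_poly :: "real \<Rightarrow> (nat \<Rightarrow> int) \<Rightarrow> (int set \<Rightarrow> real) \<Rightarrow> real" where
  "scaled_poly s u x = (weight u * (\<Prod>e\<in>trace u. x e) - mean u) / s"

lemma bounded_rv_scaled: "u \<in> walks \<Longrightarrow> bounded_rv M (scaled s u)"
  unfolding scaled_def[abs_def] by (intro bounded_rv_intros bounded_rv_T)

lemma scaled_poly_restrict: "trace u \<subseteq> A \<Longrightarrow> scaled_poly s u (\<lambda>e\<in>A. \<xi> e \<omega>) = scaled s u \<omega>"
proof -
  assume "trace u \<subseteq> A"
  then have "(\<Prod>e\<in>trace u. (\<lambda>e\<in>A. \<xi> e \<omega>) e) = (\<Prod>e\<in>trace u. \<xi> e \<omega>)" by (intro prod.cong refl) auto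
  then show ?thesis unfolding scaled_poly_def scaled_def T_def by simp
qed

lemma measurable_scaled_poly: "trace u \<subseteq> A \<Longrightarrow> scaled_poly s u \<in> borel_measurable (PiM A (\<lambda>_. borel))"
proof -
  assume A: "trace u \<subseteq> A"
  have "(\<lambda>x. x e) \<in> borel_measurable (PiM A (\<lambda>_. borel :: real measure))" if "e \<in> trace u" for e
    by (rule measurable_component_singleton) (use that A in auto)
  then show ?thesis unfolding scaled_poly_def[abs_def]
    by (intro borel_measurable_divide borel_measurable_diff borel_measurable_times borel_measurable_prod borel_measurable_const)
qed

lemma expectation_scaled: "u \<in> walks \<Longrightarrow> expectation (scaled s u) = 0"
  unfolding scaled_def[abs_def]
  using integrable_bounded_rv[OF bounded_rv_T[of u]] by (simp add: expectation_T mean_def prob_space)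

lemma expectation_scaled_mult:
  "u \<in> walks \<Longrightarrow> v \<in> walks \<Longrightarrow> expectation (\<lambda>\<omega>. scaled s u \<omega> * scaled s v \<omega>) = covar u v / s\<^sup>2"
  using expectation_centered[of u v] by (simp add: scaled_def power2_eq_square)

text \<open>A walk avoiding \<open>A\<close> is a function of the edges in the complement of
  \<open>A\<close>, so the exponential factor is independent of anything determined by the edges in
  \<open>A\<close>.\<close>

lemma indep_walks:
  assumes A: "A \<subseteq> edge_sets" and S: "S \<subseteq> walks" "\<And>v. v \<in> S \<Longrightarrow> trace v \<inter> A = {}"
    and f: "f \<in> borel_measurable (PiM A (\<lambda>_. borel))" "bounded_rv M (\<lambda>\<omega>. f (\<lambda>e\<in>A. \<xi> e \<omega>))"
  shows "expectation (\<lambda>\<omega>. of_real (f (\<lambda>e\<in>A. \<xi> e \<omega>)) * iexp (t * (\<Sum>v\<in>S. scaled s v \<omega>))) =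
    of_real (expectation (\<lambda>\<omega>. f (\<lambda>e\<in>A. \<xi> e \<omega>))) * expectation (\<lambda>\<omega>. iexp (t * (\<Sum>v\<in>S. scaled s v \<omega>)))"
proof -
  let ?B = "edge_sets - A"
  define g where "g x = iexp (t * (\<Sum>v\<in>S. scaled_poly s v x))" for x
  have tr: "trace v \<subseteq> ?B" if "v \<in> S" for v using trace_subset S that by blast
  have gx: "g (\<lambda>e\<in>?B. \<xi> e \<omega>) = iexp (t * (\<Sum>v\<in>S. scaled s v \<omega>))" for \<omega>
    unfolding g_def using tr by (simp add: scaled_poly_restrict cong: sum.cong)
  have bs: "bounded_rv M (\<lambda>\<omega>. iexp (t * (\<Sum>v\<in>S. scaled s v \<omega>)))"
    using S by (intro bounded_rv_intros bounded_rv_scaled) auto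
  have "(\<lambda>x. t * (\<Sum>v\<in>S. scaled_poly s v x)) \<in> borel_measurable (PiM ?B (\<lambda>_. borel))"
    using tr by (intro borel_measurable_times borel_measurable_const borel_measurable_sum measurable_scaled_poly)
  then have gm: "g \<in> borel_measurable (PiM ?B (\<lambda>_. borel))" unfolding g_def by measurable
  have "expectation (\<lambda>\<omega>. of_real (f (\<lambda>e\<in>A. \<xi> e \<omega>)) * g (\<lambda>e\<in>?B. \<xi> e \<omega>)) =
    expectation (\<lambda>\<omega>. complex_of_real (f (\<lambda>e\<in>A. \<xi> e \<omega>))) * expectation (\<lambda>\<omega>. g (\<lambda>e\<in>?B. \<xi> e \<omega>))"
    by (rule indep_expectation[where f = "\<lambda>x. complex_of_real (f x)" and g = g])
      (use A f gm bs gx in \<open>auto intro!: bounded_rv_of_real borel_measurable_of_real\<close>)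
  then show ?thesis unfolding gx by simp
qed

text \<open>Since \<open>T\<close> and its mean are nonnegative, their difference is at most their
  sum in absolute value. The product of three such sums has eight terms, each with expectation at
  most \<open>K\<close> because merging traces can only increase \<open>pr\<close>. The mixed term
  gives 4 times 2, again eight, which explains the constant 16.\<close>

lemma expectation_abs_scaled_le:
  assumes u: "u \<in> walks" and v: "v \<in> walks" and z: "z \<in> walks" and s: "0 < s"
  shows "expectation (\<lambda>\<omega>. \<bar>scaled s u \<omega> * scaled s v \<omega> * scaled s z \<omega>\<bar>)
      + expectation (\<lambda>\<omega>. \<bar>scaled s u \<omega> * scaled s v \<omega>\<bar>) * expectation (\<lambda>\<omega>. \<bar>scaled s z \<omega>\<bar>)
     \<le> 16 / s ^ 3 * (weight u * weight v * weight z * pr (trace u \<union> trace v \<union> trace z))"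
proof -
  let ?P = "\<lambda>\<omega>. T u \<omega> * T v \<omega> * T z \<omega> + mean z * (T u \<omega> * T v \<omega>) + mean v * (T u \<omega> * T z \<omega>)
     + mean u * (T v \<omega> * T z \<omega>) + mean v * mean z * T u \<omega> + mean u * mean z * T v \<omega> + mean u * mean v * T z \<omega> + mean u * mean v * mean z"
  let ?Q = "\<lambda>\<omega>. T u \<omega> * T v \<omega> + mean v * T u \<omega> + mean u * T v \<omega> + mean u * mean v"
  let ?A = "\<lambda>\<omega>. \<bar>scaled s u \<omega> * scaled s v \<omega> * scaled s z \<omega>\<bar>" and ?B = "\<lambda>\<omega>. \<bar>scaled s u \<omega> * scaled s v \<omega>\<bar>"
  define K where "K = weight u * weight v * weight z * pr (trace u \<union> trace v \<union> trace z)"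
  have ww: "0 \<le> weight u * weight v * weight z" by (intro mult_nonneg_nonneg weight_nonneg)
  note fin = finite_UnI[OF finite_trace finite_trace] finite_trace
  have uvz: "pr (trace u \<union> trace v) * pr (trace z) \<le> pr (trace u \<union> trace v \<union> trace z)"
    by (intro pr_mult_le fin)
  have uzv: "pr (trace u \<union> trace z) * pr (trace v) \<le> pr (trace u \<union> trace v \<union> trace z)"
    using pr_mult_le[of "trace u \<union> trace z" "trace v"] fin by (simp add: Un_ac)
  have vzu: "pr (trace v \<union> trace z) * pr (trace u) \<le> pr (trace u \<union> trace v \<union> trace z)"
    using pr_mult_le[of "trace v \<union> trace z" "trace u"] fin by (simp add: Un_ac)
  have uv: "pr (trace u) * pr (trace v) \<le> pr (trace u \<union> trace v)" by (intro pr_mult_le fin)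
  have ppp: "pr (trace u) * pr (trace v) * pr (trace z) \<le> pr (trace u \<union> trace v \<union> trace z)"
    by (rule order_trans[OF mult_right_mono[OF uv pr_nonneg] uvz])
  have k1: "weight u * weight v * pr (trace u \<union> trace v) * mean z \<le> K"
    using mult_left_mono[OF uvz ww] by (simp add: K_def mean_def mult_ac)
  have k2: "weight u * weight z * pr (trace u \<union> trace z) * mean v \<le> K"
    using mult_left_mono[OF uzv ww] by (simp add: K_def mean_def mult_ac)
  have k3: "weight v * weight z * pr (trace v \<union> trace z) * mean u \<le> K"
    using mult_left_mono[OF vzu ww] by (simp add: K_def mean_def mult_ac)
  have k4: "mean u * mean v * mean z \<le> K"
    using mult_left_mono[OF ppp ww] by (simp add: K_def mean_def mult_ac)
  have Tn: "0 \<le> T w \<omega>" if "w \<in> walks" "\<omega> \<in> space M" for w \<omega>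
    unfolding T_def using prod_\<xi>[OF trace_subset[OF that(1)] that(2) finite_trace] weight_nonneg by simp
  have ab: "\<bar>T w \<omega> - mean w\<bar> \<le> T w \<omega> + mean w" if "w \<in> walks" "\<omega> \<in> space M" for w \<omega>
    using Tn[OF that] mean_nonneg[of w] by linarith
  note bi = integrable_bounded_rv bounded_rv_intros bounded_rv_T bounded_rv_scaled
  note E2 = expectation_T2 and E3 = expectation_T3[OF u v z]
  have E1: "expectation (T w) = mean w" if "w \<in> walks" for w using expectation_T[OF that] by (simp add: mean_def)
  have i1: "integrable M (T w)" if "w \<in> walks" for w by (intro bi that)
  have i2: "integrable M (\<lambda>\<omega>. T w \<omega> * T w' \<omega>)" if "w \<in> walks" "w' \<in> walks" for w w' by (intro bi that)
  have i3: "integrable M (\<lambda>\<omega>. T u \<omega> * T v \<omega> * T z \<omega>)" by (intro bi u v z)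
  have part1: "expectation (\<lambda>\<omega>. ?A \<omega>) \<le> 8 * K / s ^ 3"
  proof -
    have "expectation (\<lambda>\<omega>. ?A \<omega>) \<le>
       expectation (\<lambda>\<omega>. ?P \<omega> / s ^ 3)"
    proof (rule integral_mono)
      show "integrable M (\<lambda>\<omega>. ?A \<omega>)" by (intro bi u v z)
      show "integrable M (\<lambda>\<omega>. ?P \<omega> / s ^ 3)"
        by (intro bi u v z)
      fix \<omega> assume w: "\<omega> \<in> space M"
      have "?A \<omega> = \<bar>T u \<omega> - mean u\<bar> * \<bar>T v \<omega> - mean v\<bar> * \<bar>T z \<omega> - mean z\<bar> / s ^ 3"
        using s by (simp add: scaled_def abs_mult power3_eq_cube)
      also have "\<dots> \<le> (T u \<omega> + mean u) * (T v \<omega> + mean v) * (T z \<omega> + mean z) / s ^ 3"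
        using s ab[OF u w] ab[OF v w] ab[OF z w] Tn[OF u w] Tn[OF v w] mean_nonneg
        by (intro divide_right_mono mult_mono mult_nonneg_nonneg) auto
      also have "\<dots> = ?P \<omega> / s ^ 3"
        by (simp add: algebra_simps)
      finally show "?A \<omega> \<le> ?P \<omega> / s ^ 3" .
    qed
    also have "\<dots> = (K + mean z * (weight u * weight v * pr (trace u \<union> trace v)) + mean v * (weight u * weight z * pr (trace u \<union> trace z))
        + mean u * (weight v * weight z * pr (trace v \<union> trace z)) + 4 * (mean u * mean v * mean z)) / s ^ 3"
      using u v z by (simp add: i1 i2 i3 E1 E2 E3 prob_space K_def)
    also have "\<dots> \<le> 8 * K / s ^ 3"
      using k1 k2 k3 k4 s by (intro divide_right_mono) (auto simp: mult_ac)
    finally show ?thesis .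
  qed
  have part2: "expectation (\<lambda>\<omega>. ?B \<omega>) \<le>
      (weight u * weight v * pr (trace u \<union> trace v) + 3 * (mean u * mean v)) / s\<^sup>2"
  proof -
    have "expectation (\<lambda>\<omega>. ?B \<omega>) \<le>
      expectation (\<lambda>\<omega>. ?Q \<omega> / s\<^sup>2)"
    proof (rule integral_mono)
      show "integrable M (\<lambda>\<omega>. ?B \<omega>)" by (intro bi u v)
      show "integrable M (\<lambda>\<omega>. ?Q \<omega> / s\<^sup>2)"
        by (intro bi u v)
      fix \<omega> assume w: "\<omega> \<in> space M"
      have "?B \<omega> = \<bar>T u \<omega> - mean u\<bar> * \<bar>T v \<omega> - mean v\<bar> / s\<^sup>2"
        using s by (simp add: scaled_def abs_mult power2_eq_square)
      also have "\<dots> \<le> (T u \<omega> + mean u) * (T v \<omega> + mean v) / s\<^sup>2"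
        using s ab[OF u w] ab[OF v w] Tn[OF u w] mean_nonneg
        by (intro divide_right_mono mult_mono) auto
      also have "\<dots> = ?Q \<omega> / s\<^sup>2"
        by (simp add: algebra_simps)
      finally show "?B \<omega> \<le> ?Q \<omega> / s\<^sup>2" .
    qed
    also have "\<dots> = (weight u * weight v * pr (trace u \<union> trace v) + 3 * (mean u * mean v)) / s\<^sup>2"
      using u v by (simp add: i1 i2 E1 E2 prob_space)
    finally show ?thesis .
  qed
  have part3: "expectation (\<lambda>\<omega>. \<bar>scaled s z \<omega>\<bar>) \<le> 2 * mean z / s"
  proof -
    have "expectation (\<lambda>\<omega>. \<bar>scaled s z \<omega>\<bar>) \<le> expectation (\<lambda>\<omega>. (T z \<omega> + mean z) / s)"
    proof (rule integral_mono)
      show "integrable M (\<lambda>\<omega>. \<bar>scaled s z \<omega>\<bar>)" by (intro bi z)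
      show "integrable M (\<lambda>\<omega>. (T z \<omega> + mean z) / s)" by (intro bi z)
      fix \<omega> assume w: "\<omega> \<in> space M"
      show "\<bar>scaled s z \<omega>\<bar> \<le> (T z \<omega> + mean z) / s"
        using ab[OF z w] s by (simp add: scaled_def divide_right_mono)
    qed
    also have "\<dots> = 2 * mean z / s" using z by (simp add: i1 E1 prob_space)
    finally show ?thesis .
  qed
  have "expectation (\<lambda>\<omega>. ?B \<omega>) * expectation (\<lambda>\<omega>. \<bar>scaled s z \<omega>\<bar>) \<le>
     ((weight u * weight v * pr (trace u \<union> trace v) + 3 * (mean u * mean v)) / s\<^sup>2) * (2 * mean z / s)"
    by (intro mult_mono part2 part3 integral_nonneg_AE divide_nonneg_nonneg add_nonneg_nonneg mult_nonneg_nonneg weight_nonneg pr_nonneg mean_nonneg) auto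
  also have "\<dots> = (2 * (weight u * weight v * pr (trace u \<union> trace v) * mean z) + 6 * (mean u * mean v * mean z)) / s ^ 3"
    by (simp add: power2_eq_square power3_eq_cube algebra_simps add_divide_distrib)
  also have "\<dots> \<le> 8 * K / s ^ 3" using k1 k4 s by (intro divide_right_mono) auto
  finally have "expectation (\<lambda>\<omega>. ?B \<omega>) * expectation (\<lambda>\<omega>. \<bar>scaled s z \<omega>\<bar>) \<le> 8 * K / s ^ 3" .
  with part1 have "expectation (\<lambda>\<omega>. ?A \<omega>)
      + expectation (\<lambda>\<omega>. ?B \<omega>) * expectation (\<lambda>\<omega>. \<bar>scaled s z \<omega>\<bar>) \<le> 8 * K / s ^ 3 + 8 * K / s ^ 3"
    by (rule add_mono)
  also have "\<dots> = 16 / s ^ 3 * K" by simp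
  finally show ?thesis unfolding K_def .
qed

text \<open>Walks that share no edge are independent, so walks meeting a given one form its
  neighbourhood. The scale \<open>s\<close> is left free because the final normalisation is by
  \<open>b\<close> and not by the standard deviation; the comparison Gaussian therefore has variance
  \<open>variance Yv / s\<^sup>2\<close>.\<close>

lemma char_Yv_bound:
  assumes s: "0 < s"
  shows "cmod (expectation (\<lambda>\<omega>. iexp (t * ((Yv \<omega> - expectation Yv) / s))) - exp (- of_real (variance Yv / s\<^sup>2 * t\<^sup>2 / 2)))
    \<le> \<bar>t\<bar> ^ 3 * (16 / s ^ 3 * pattern_total 3)"
proof -
  have "expectation (\<lambda>\<omega>. iexp (t * ((Yv \<omega> - expectation Yv) / s))) = expectation (\<lambda>\<omega>. iexp (t * (\<Sum>u\<in>walks. scaled s u \<omega>)))"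
  proof (intro Bochner_Integration.integral_cong refl)
    fix \<omega> assume "\<omega> \<in> space M"
    then have "(Yv \<omega> - expectation Yv) / s = (\<Sum>u\<in>walks. scaled s u \<omega>)"
      by (simp only: centered_Yv scaled_def sum_divide_distrib)
    then show "iexp (t * ((Yv \<omega> - expectation Yv) / s)) = iexp (t * (\<Sum>u\<in>walks. scaled s u \<omega>))" by (simp only:)
  qed
  moreover have "cmod (expectation (\<lambda>\<omega>. iexp (t * (\<Sum>u\<in>walks. scaled s u \<omega>))) - exp (- of_real (variance Yv / s\<^sup>2 * t\<^sup>2 / 2)))
    \<le> \<bar>t\<bar> ^ 3 * (16 / s ^ 3 * pattern_total 3)"
  proof (rule char_dissociated_sum_bound[OF finite_walks, where Nb = nbhd])
    show "bounded_rv M (scaled s u)" if "u \<in> walks" for u by (rule bounded_rv_scaled[OF that])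
    show "nbhd u \<subseteq> walks" for u by (rule nbhd_subset)
    show "expectation (\<lambda>\<omega>. of_real (scaled s u \<omega>) * iexp (t * (\<Sum>j\<in>walks - nbhd u. scaled s j \<omega>))) = 0" if u: "u \<in> walks" for u t
    proof -
      have r: "scaled_poly s u (\<lambda>e\<in>trace u. \<xi> e \<omega>) = scaled s u \<omega>" for \<omega> by (rule scaled_poly_restrict) simp
      have "expectation (\<lambda>\<omega>. of_real (scaled_poly s u (\<lambda>e\<in>trace u. \<xi> e \<omega>)) * iexp (t * (\<Sum>j\<in>walks - nbhd u. scaled s j \<omega>))) =
        of_real (expectation (\<lambda>\<omega>. scaled_poly s u (\<lambda>e\<in>trace u. \<xi> e \<omega>))) * expectation (\<lambda>\<omega>. iexp (t * (\<Sum>j\<in>walks - nbhd u. scaled s j \<omega>)))"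
      proof (rule indep_walks[OF trace_subset[OF u]])
        show "trace j \<inter> trace u = {}" if "j \<in> walks - nbhd u" for j using that by (auto simp: nbhd_def)
        show "scaled_poly s u \<in> borel_measurable (PiM (trace u) (\<lambda>_. borel))" by (rule measurable_scaled_poly) simp
        show "bounded_rv M (\<lambda>\<omega>. scaled_poly s u (\<lambda>e\<in>trace u. \<xi> e \<omega>))"
          unfolding r by (rule bounded_rv_scaled[OF u])
      qed auto
      then show ?thesis unfolding r using expectation_scaled[OF u] by simp
    qed
    show "expectation (\<lambda>\<omega>. of_real (scaled s u \<omega> * scaled s v \<omega>) * iexp (t * (\<Sum>j\<in>walks - (nbhd u \<union> nbhd v). scaled s j \<omega>))) =
       of_real (expectation (\<lambda>\<omega>. scaled s u \<omega> * scaled s v \<omega>)) * expectation (\<lambda>\<omega>. iexp (t * (\<Sum>j\<in>walks - (nbhd u \<union> nbhd v). scaled s j \<omega>)))"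
      if u: "u \<in> walks" and v': "v \<in> nbhd u" for u v t
    proof -
      have v: "v \<in> walks" using v' nbhd_subset by blast
      let ?A = "trace u \<union> trace v"
      have r: "scaled_poly s u (\<lambda>e\<in>?A. \<xi> e \<omega>) = scaled s u \<omega>" "scaled_poly s v (\<lambda>e\<in>?A. \<xi> e \<omega>) = scaled s v \<omega>" for \<omega>
        by (rule scaled_poly_restrict; simp)+
      have "expectation (\<lambda>\<omega>. of_real (scaled_poly s u (\<lambda>e\<in>?A. \<xi> e \<omega>) * scaled_poly s v (\<lambda>e\<in>?A. \<xi> e \<omega>)) * iexp (t * (\<Sum>j\<in>walks - (nbhd u \<union> nbhd v). scaled s j \<omega>))) =
        of_real (expectation (\<lambda>\<omega>. scaled_poly s u (\<lambda>e\<in>?A. \<xi> e \<omega>) * scaled_poly s v (\<lambda>e\<in>?A. \<xi> e \<omega>))) * expectation (\<lambda>\<omega>. iexp (t * (\<Sum>j\<in>walks - (nbhd u \<union> nbhd v). scaled s j \<omega>)))"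
      proof (rule indep_walks[where f = "\<lambda>x. scaled_poly s u x * scaled_poly s v x"])
        show "?A \<subseteq> edge_sets" using trace_subset u v by blast
        show "trace j \<inter> ?A = {}" if "j \<in> walks - (nbhd u \<union> nbhd v)" for j using that by (auto simp: nbhd_def)
        show "(\<lambda>x. scaled_poly s u x * scaled_poly s v x) \<in> borel_measurable (PiM ?A (\<lambda>_. borel))"
          by (intro borel_measurable_times measurable_scaled_poly) auto
        show "bounded_rv M (\<lambda>\<omega>. scaled_poly s u (\<lambda>e\<in>?A. \<xi> e \<omega>) * scaled_poly s v (\<lambda>e\<in>?A. \<xi> e \<omega>))"
          unfolding r by (intro bounded_rv_mult bounded_rv_scaled u v)
      qed auto
      then show ?thesis unfolding r .
    qed
    have "(\<Sum>u\<in>walks. \<Sum>v\<in>nbhd u. expectation (\<lambda>\<omega>. scaled s u \<omega> * scaled s v \<omega>)) = (\<Sum>u\<in>walks. \<Sum>v\<in>nbhd u. covar u v / s\<^sup>2)"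
      using nbhd_subset by (intro sum.cong refl expectation_scaled_mult) auto
    then show "(\<Sum>u\<in>walks. \<Sum>v\<in>nbhd u. expectation (\<lambda>\<omega>. scaled s u \<omega> * scaled s v \<omega>)) = variance Yv / s\<^sup>2"
      by (simp add: variance_Yv sum_divide_distrib)
    show "0 \<le> variance Yv / s\<^sup>2" by (intro divide_nonneg_nonneg variance_positive) auto
    have "(\<Sum>u\<in>walks. \<Sum>v\<in>nbhd u. \<Sum>z\<in>nbhd u \<union> nbhd v. expectation (\<lambda>\<omega>. \<bar>scaled s u \<omega> * scaled s v \<omega> * scaled s z \<omega>\<bar>)
      + expectation (\<lambda>\<omega>. \<bar>scaled s u \<omega> * scaled s v \<omega>\<bar>) * expectation (\<lambda>\<omega>. \<bar>scaled s z \<omega>\<bar>)) \<le>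
      (\<Sum>u\<in>walks. \<Sum>v\<in>nbhd u. \<Sum>z\<in>nbhd u \<union> nbhd v. 16 / s ^ 3 * (weight u * weight v * weight z * pr (trace u \<union> trace v \<union> trace z)))"
      using nbhd_subset s by (intro sum_mono expectation_abs_scaled_le) auto
    also have "\<dots> = 16 / s ^ 3 * pattern_total 3"
      unfolding sum_linked_triples[symmetric] sum_distrib_left ..
    finally show "(\<Sum>u\<in>walks. \<Sum>v\<in>nbhd u. \<Sum>z\<in>nbhd u \<union> nbhd v. expectation (\<lambda>\<omega>. \<bar>scaled s u \<omega> * scaled s v \<omega> * scaled s z \<omega>\<bar>)
      + expectation (\<lambda>\<omega>. \<bar>scaled s u \<omega> * scaled s v \<omega>\<bar>) * expectation (\<lambda>\<omega>. \<bar>scaled s z \<omega>\<bar>)) \<le> 16 / s ^ 3 * pattern_total 3" .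
  qed
  ultimately show ?thesis by (simp only:)
qed

end

section \<open>The normal limit law\<close>

lemma char_centered_normal:
  assumes "0 < v"
  shows "char (centered_normal v) t = exp (- of_real (v * t\<^sup>2 / 2))"
proof -
  define \<sigma> where "\<sigma> = sqrt v"
  have \<sigma>: "0 < \<sigma>" "\<sigma>\<^sup>2 = v" using assms by (auto simp: \<sigma>_def)
  have "char (centered_normal v) t = (CLINT x|lborel. normal_density 0 \<sigma> x *\<^sub>R iexp (t * x))"
    unfolding char_def centered_normal_def \<sigma>_def[symmetric] by (subst integral_density) (use \<sigma> in auto)
  also have "\<dots> = \<bar>\<sigma>\<bar> *\<^sub>R (CLINT x|lborel. normal_density 0 \<sigma> (0 + \<sigma> * x) *\<^sub>R iexp (t * (0 + \<sigma> * x)))"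
    by (rule lborel_integral_real_affine) (use \<sigma> in auto)
  also have "\<dots> = (CLINT x|lborel. \<sigma> *\<^sub>R (normal_density 0 \<sigma> (\<sigma> * x) *\<^sub>R iexp (t * (\<sigma> * x))))"
    using \<sigma> by (simp only: add_0_left abs_of_pos integral_scaleR_right)
  also have "\<dots> = (CLINT x|lborel. std_normal_density x *\<^sub>R iexp ((t * \<sigma>) * x))"
  proof (intro Bochner_Integration.integral_cong refl)
    fix x
    have "\<sigma> * normal_density 0 \<sigma> (\<sigma> * x) = std_normal_density x"
      using \<sigma>(1) by (simp add: normal_density_def real_sqrt_mult power_mult_distrib)
    then show "\<sigma> *\<^sub>R (normal_density 0 \<sigma> (\<sigma> * x) *\<^sub>R iexp (t * (\<sigma> * x))) = std_normal_density x *\<^sub>R iexp ((t * \<sigma>) * x)"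
      by (simp only: scaleR_scaleR mult.assoc)
  qed
  also have "\<dots> = char std_normal_distribution (t * \<sigma>)"
    unfolding char_def by (subst integral_density) auto
  also have "\<dots> = of_real (exp (- (v * t\<^sup>2 / 2)))"
    unfolding char_std_normal_distribution using \<sigma>(2) by (simp add: power_mult_distrib mult.commute)
  finally show ?thesis unfolding exp_of_real[symmetric] of_real_minus .
qed

lemma real_distribution_centered_normal: "0 < v \<Longrightarrow> real_distribution (centered_normal v)"
  unfolding centered_normal_def real_distribution_def real_distribution_axioms_def
  by (auto intro!: prob_space_normal_density)

section \<open>The three regimes\<close>

definition pattern_limit :: "nat \<Rightarrow> (real \<Rightarrow> real) \<Rightarrow> nat \<Rightarrow> nat \<Rightarrow> (nat \<times> nat \<Rightarrow> nat \<times> nat) \<Rightarrow> real" where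
  "pattern_limit \<alpha> \<psi> r q g = (if card (all_edges r q g) = card (g ` positions r q) - 1
     then \<Prod>e\<in>all_edges r q g. V \<psi> (\<alpha> * edge_mult r q g e) else 0)"

text \<open>Explicit value of the limiting second cumulants. The exponent is the number v - 1 of
  edges of a tree on v vertices, lowered by one through the normalisation by N times D.\<close>

definition variance_limit :: "nat \<Rightarrow> nat \<Rightarrow> (real \<Rightarrow> real) \<Rightarrow> real \<Rightarrow> real" where
  "variance_limit \<alpha> q \<psi> s = (\<Sum>g\<in>patterns 2 q. s ^ (card (g ` positions 2 q) - 2) * pattern_limit \<alpha> \<psi> 2 q g)"

lemma power_ratio_cancel: "0 < (d::real) \<Longrightarrow> d ^ j / d ^ p * (S / (m * d ^ j)) = S / (m * d ^ p)"
  by simp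

lemma power_ratio_inverse:
  fixes d :: real
  assumes "0 < d" "i \<le> j"
  shows "d ^ i / d ^ j = inverse d ^ (j - i)"
proof -
  have "d ^ j = d ^ i * d ^ (j - i)" using assms by (simp flip: power_add)
  then show ?thesis using assms by (simp add: power_inverse divide_inverse)
qed

lemma power_square_cube: "(m * d ^ j)\<^sup>2 * (m * d) = m ^ 3 * (d ^ (j * 2) * d)" for m d :: real
  by (simp add: power_mult_distrib power_mult power2_eq_square power3_eq_cube mult_ac)

lemma power_ratio_one: "0 < (d::real) \<Longrightarrow> 2 \<le> j \<Longrightarrow> d ^ (j - 1) / d ^ 1 = d ^ (j - 2)"
proof -
  assume d: "0 < d" "2 \<le> j"
  then have "j - 1 = Suc (j - 2)" by simp
  then show ?thesis using d by simp
qed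

section \<open>Totals over pairs and triples in the three regimes\<close>

context walk_limit
begin

abbreviation total :: "nat \<Rightarrow> nat \<Rightarrow> nat \<Rightarrow> real" where
  "total r q k \<equiv> (\<Sum>g\<in>patterns r q. pattern_sum \<alpha> \<psi> (n k) (c k) (R k) r q g)"

lemma pattern_ratio_limit:
  assumes "g \<in> patterns r q" "1 \<le> r" "1 \<le> q"
  shows "(\<lambda>k. pattern_sum \<alpha> \<psi> (n k) (c k) (R k) r q g / (N k * D k ^ (card (g ` positions r q) - 1))) \<longlonglongrightarrow> pattern_limit \<alpha> \<psi> r q g"
  using pattern_sum_limit[OF assms] by (simp add: pattern_limit_def)

text \<open>Each pattern, divided by its own order, converges and is therefore bounded, whatever
  \<open>D\<close> does. The powers of \<open>D\<close> that occur have exponents between 1 and 3q -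
  2, and any such power is dominated by the smallest one if \<open>D\<close> is at most 1 and by the
  largest one otherwise.\<close>

lemma total_triples_bound:
  assumes q: "1 \<le> q"
  shows "\<exists>C. 0 \<le> C \<and> (\<forall>k. total 3 q k \<le> C * (N k * (D k + D k ^ (3 * q - 2))))"
proof -
  let ?r = "\<lambda>g k. pattern_sum \<alpha> \<psi> (n k) (c k) (R k) 3 q g / (N k * D k ^ (card (g ` positions 3 q) - 1))"
  have "\<exists>B. \<forall>k. ?r g k \<le> B" if "g \<in> patterns 3 q" for g
  proof -
    have "Bseq (?r g)" using pattern_ratio_limit[OF that _ q] by (intro convergent_imp_Bseq convergentI) simp
    then obtain B where B: "\<forall>k. norm (?r g k) \<le> B" by (auto simp only: Bseq_def)
    have "?r g k \<le> B" for k using spec[OF B, of k] unfolding real_norm_def by (rule order_trans[OF abs_ge_self])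
    then show ?thesis by (intro exI allI)
  qed
  then have "\<forall>g\<in>patterns 3 q. \<exists>B. \<forall>k. ?r g k \<le> B" by (rule ballI)
  from bchoice[OF this] obtain B where B': "\<forall>g\<in>patterns 3 q. \<forall>k. ?r g k \<le> B g" by (rule exE)
  have B: "?r g k \<le> B g" if "g \<in> patterns 3 q" for g k
    by (rule spec[OF bspec[OF B' that]])
  have pos: "0 < N k" "0 < D k" for k using D_pos dim_N_pos by auto
  have pw: "D k ^ j \<le> D k + D k ^ m" if "1 \<le> j" "j \<le> m" for k j m
  proof (cases "D k \<le> 1")
    case True
    have "D k ^ j \<le> D k ^ 1" using True pos(2)[of k] that by (intro power_decreasing) auto
    moreover have "0 \<le> D k ^ m" using pos(2)[of k] by (intro zero_le_power) simp
    ultimately show ?thesis by simp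
  next
    case False
    then have "D k ^ j \<le> D k ^ m" using that by (intro power_increasing) auto
    then show ?thesis using pos(2)[of k] by simp
  qed
  have termwise: "pattern_sum \<alpha> \<psi> (n k) (c k) (R k) 3 q g \<le> \<bar>B g\<bar> * (N k * (D k + D k ^ (3 * q - 2)))" if g: "g \<in> patterns 3 q" for g k
  proof -
    let ?v = "card (g ` positions 3 q)"
    have "proper 3 q g" using g by (simp add: patterns_def)
    then have v: "2 \<le> ?v" "?v + 3 \<le> 3 * q + 2"
      using proper_card_ge2[of 3 q g] card_pattern_le(2)[OF g _ q] q by auto
    have "pattern_sum \<alpha> \<psi> (n k) (c k) (R k) 3 q g \<le> B g * (N k * D k ^ (?v - 1))"
      using B[OF g, of k] pos[of k] by (subst (asm) pos_divide_le_eq) auto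
    also have "\<dots> \<le> \<bar>B g\<bar> * (N k * (D k + D k ^ (3 * q - 2)))"
    proof (rule mult_mono)
      show "N k * D k ^ (?v - 1) \<le> N k * (D k + D k ^ (3 * q - 2))"
        using pos(1)[of k] v by (intro mult_left_mono pw) auto
      show "0 \<le> N k * D k ^ (?v - 1)" using pos[of k] by (intro mult_nonneg_nonneg zero_le_power) auto
    qed auto
    finally show ?thesis .
  qed
  show ?thesis
  proof (intro exI conjI allI)
    show "0 \<le> (\<Sum>g\<in>patterns 3 q. \<bar>B g\<bar>)" by (intro sum_nonneg) auto
    show "total 3 q k \<le> (\<Sum>g\<in>patterns 3 q. \<bar>B g\<bar>) * (N k * (D k + D k ^ (3 * q - 2)))" for k
      unfolding sum_distrib_right by (intro sum_mono termwise)
  qed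
qed

text \<open>The regime enters only through the limits \<open>w g\<close> of the ratios of powers of
  \<open>D\<close>; the limits of the individual patterns are the same in all regimes.\<close>

lemma total_pairs_scaled:
  assumes q: "1 \<le> q"
    and lim: "\<And>g. g \<in> patterns 2 q \<Longrightarrow> (\<lambda>k. D k ^ (card (g ` positions 2 q) - 1) / D k ^ p) \<longlonglongrightarrow> w g"
  shows "(\<lambda>k. total 2 q k / (N k * D k ^ p)) \<longlonglongrightarrow> (\<Sum>g\<in>patterns 2 q. w g * pattern_limit \<alpha> \<psi> 2 q g)"
proof -
  have "(\<lambda>k. \<Sum>g\<in>patterns 2 q. D k ^ (card (g ` positions 2 q) - 1) / D k ^ p *
      (pattern_sum \<alpha> \<psi> (n k) (c k) (R k) 2 q g / (N k * D k ^ (card (g ` positions 2 q) - 1)))) \<longlonglongrightarrow>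
     (\<Sum>g\<in>patterns 2 q. w g * pattern_limit \<alpha> \<psi> 2 q g)"
    using q by (intro tendsto_sum tendsto_mult lim pattern_ratio_limit) auto
  moreover have "(\<Sum>g\<in>patterns 2 q. D k ^ (card (g ` positions 2 q) - 1) / D k ^ p *
      (pattern_sum \<alpha> \<psi> (n k) (c k) (R k) 2 q g / (N k * D k ^ (card (g ` positions 2 q) - 1)))) = total 2 q k / (N k * D k ^ p)" for k
    unfolding sum_divide_distrib by (intro sum.cong refl power_ratio_cancel D_pos)
  ultimately show ?thesis by simp
qed

lemma pattern_card_bounds:
  assumes g: "g \<in> patterns 2 q" and q: "1 \<le> q"
  shows "2 \<le> card (g ` positions 2 q)" "card (g ` positions 2 q) \<le> 2 * q"
  using proper_card_ge2[of 2 q g] card_pattern_le(2)[OF g _ q] q g by (auto simp: patterns_def)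

lemma total_pairs_dense:
  assumes q: "1 \<le> q" and lim: "filterlim D at_top sequentially"
  shows "(\<lambda>k. total 2 q k / (N k * D k ^ (2 * q - 1))) \<longlonglongrightarrow> 2 * (real q)\<^sup>2 * W 1 ^ (2 * q - 2) * W 2"
proof -
  have "(\<lambda>k. total 2 q k / (N k * D k ^ (2 * q - 1))) \<longlonglongrightarrow>
    (\<Sum>g\<in>patterns 2 q. of_bool (card (g ` positions 2 q) = 2 * q) * pattern_limit \<alpha> \<psi> 2 q g)"
  proof (rule total_pairs_scaled[OF q])
    fix g assume g: "g \<in> patterns 2 q"
    let ?v = "card (g ` positions 2 q)"
    note v = pattern_card_bounds[OF g q]
    have eq: "D k ^ (?v - 1) / D k ^ (2 * q - 1) = inverse (D k) ^ (2 * q - ?v)" for k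
    proof -
      have "2 * q - 1 - (?v - 1) = 2 * q - ?v" using v by simp
      then show ?thesis using power_ratio_inverse[OF D_pos[of k], of "?v - 1" "2 * q - 1"] v by simp
    qed
    have "(\<lambda>k. inverse (D k)) \<longlonglongrightarrow> 0" by (rule tendsto_inverse_0_at_top[OF lim])
    then have "(\<lambda>k. inverse (D k) ^ (2 * q - ?v)) \<longlonglongrightarrow> 0 ^ (2 * q - ?v)" by (rule tendsto_power)
    \<comment> \<open>The convention \<open>0 ^ 0 = 1\<close> selects precisely the patterns with
      the maximal number of vertices.\<close>
    moreover have "(0::real) ^ (2 * q - ?v) = of_bool (?v = 2 * q)" using v by (cases "?v = 2 * q") auto
    ultimately show "(\<lambda>k. D k ^ (?v - 1) / D k ^ (2 * q - 1)) \<longlonglongrightarrow> of_bool (?v = 2 * q)" unfolding eq by simp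
  qed
  also have "(\<Sum>g\<in>patterns 2 q. of_bool (card (g ` positions 2 q) = 2 * q) * pattern_limit \<alpha> \<psi> 2 q g) =
    (\<Sum>g\<in>{g \<in> patterns 2 q. card (g ` positions 2 q) = 2 * q}. W 1 ^ (2 * q - 2) * W 2)"
    unfolding sum.inter_filter[OF finite_patterns]
  proof (intro sum.cong refl)
    fix g assume g: "g \<in> patterns 2 q"
    show "of_bool (card (g ` positions 2 q) = 2 * q) * pattern_limit \<alpha> \<psi> 2 q g =
       (if card (g ` positions 2 q) = 2 * q then W 1 ^ (2 * q - 2) * W 2 else 0)"
      using all_edges_top_pattern(1)[OF g q] all_edges_top_pattern(2)[OF g q, of W] by (simp add: pattern_limit_def)
  qed
  also have "\<dots> = 2 * (real q)\<^sup>2 * W 1 ^ (2 * q - 2) * W 2"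
    by (simp add: card_top_patterns[OF q])
  finally show ?thesis .
qed

lemma total_pairs_sparse:
  assumes q: "1 \<le> q" and lim: "D \<longlonglongrightarrow> 0"
  shows "(\<lambda>k. total 2 q k / (N k * D k ^ 1)) \<longlonglongrightarrow> 2 * W (2 * q)"
proof -
  have "(\<lambda>k. total 2 q k / (N k * D k ^ 1)) \<longlonglongrightarrow>
    (\<Sum>g\<in>patterns 2 q. of_bool (card (g ` positions 2 q) = 2) * pattern_limit \<alpha> \<psi> 2 q g)"
  proof (rule total_pairs_scaled[OF q])
    fix g assume g: "g \<in> patterns 2 q"
    let ?v = "card (g ` positions 2 q)"
    note v = pattern_card_bounds[OF g q]
    have eq: "D k ^ (?v - 1) / D k ^ 1 = D k ^ (?v - 2)" for k
      by (rule power_ratio_one[OF D_pos v(1)])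
    have "(\<lambda>k. D k ^ (?v - 2)) \<longlonglongrightarrow> 0 ^ (?v - 2)" by (rule tendsto_power[OF lim])
    \<comment> \<open>Here \<open>0 ^ 0 = 1\<close> keeps precisely the patterns with two
      vertices.\<close>
    moreover have "(0::real) ^ (?v - 2) = of_bool (?v = 2)" using v by (cases "?v = 2") auto
    ultimately show "(\<lambda>k. D k ^ (?v - 1) / D k ^ 1) \<longlonglongrightarrow> of_bool (?v = 2)" unfolding eq by simp
  qed
  also have "(\<Sum>g\<in>patterns 2 q. of_bool (card (g ` positions 2 q) = 2) * pattern_limit \<alpha> \<psi> 2 q g) =
    (\<Sum>g\<in>{g \<in> patterns 2 q. card (g ` positions 2 q) = 2}. W (2 * q))"
    unfolding sum.inter_filter[OF finite_patterns]
  proof (intro sum.cong refl)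
    fix g assume g: "g \<in> patterns 2 q"
    show "of_bool (card (g ` positions 2 q) = 2) * pattern_limit \<alpha> \<psi> 2 q g =
       (if card (g ` positions 2 q) = 2 then W (2 * q) else 0)"
      using all_edges_single_edge_pattern(1)[OF g q] all_edges_single_edge_pattern(2)[OF g q, of W] by (simp add: pattern_limit_def)
  qed
  also have "\<dots> = 2 * W (2 * q)"
    by (simp add: card_single_edge_patterns[OF q])
  finally show ?thesis .
qed

lemma total_pairs_critical:
  assumes q: "1 \<le> q" and D: "\<And>k. D k = s"
  shows "(\<lambda>k. total 2 q k / (N k * D k ^ 1)) \<longlonglongrightarrow> variance_limit \<alpha> q \<psi> s"
  unfolding variance_limit_def
proof (rule total_pairs_scaled[OF q])
  fix g assume g: "g \<in> patterns 2 q"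
  let ?v = "card (g ` positions 2 q)"
  show "(\<lambda>k. D k ^ (?v - 1) / D k ^ 1) \<longlonglongrightarrow> s ^ (?v - 2)"
    unfolding power_ratio_one[OF D_pos pattern_card_bounds(1)[OF g q]] unfolding D by (rule tendsto_const)
qed

end

text \<open>All terms are nonnegative, and a single-edge pattern contributes a positive moment
  \<open>V\<close>. Positivity matters because \<open>centered_normal\<close> describes a normal law
  only for positive variance.\<close>

lemma (in walk_weights) variance_limit_pos:
  assumes q: "1 \<le> q" and s: "0 < s"
  shows "0 < variance_limit \<alpha> q \<psi> s"
proof -
  have Vp: "0 < V \<psi> m" for m by (intro V_pos profile_integrable)
  have nn: "0 \<le> s ^ (card (g ` positions 2 q) - 2) * pattern_limit \<alpha> \<psi> 2 q g" for g
    using s Vp unfolding pattern_limit_def by (auto intro!: mult_nonneg_nonneg prod_nonneg simp: less_imp_le)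
  have "card {g \<in> patterns 2 q. card (g ` positions 2 q) = 2} \<noteq> 0" using card_single_edge_patterns[OF q] by simp
  then obtain g where g: "g \<in> patterns 2 q" "card (g ` positions 2 q) = 2"
    by (metis (mono_tags, lifting) Collect_empty_eq card.empty)
  have "0 < pattern_limit \<alpha> \<psi> 2 q g"
    unfolding pattern_limit_def using all_edges_single_edge_pattern[OF g(1) q g(2)] g(2) Vp by (auto intro!: prod_pos)
  then have "0 < s ^ (card (g ` positions 2 q) - 2) * pattern_limit \<alpha> \<psi> 2 q g" using s by simp
  also have "\<dots> \<le> variance_limit \<alpha> q \<psi> s"
    unfolding variance_limit_def using g(1) nn finite_patterns by (intro member_le_sum) auto
  finally show ?thesis .
qed

section \<open>Reduction of the limit theorem to totals over pairs and triples\<close>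

context walk_limit
begin

lemma edge_modelI:
  assumes "edge_variables M \<psi> (n k) (c k) (R k) a"
  shows "edge_model \<psi> \<alpha> M (n k) (c k) (R k) a"
proof -
  have "prob_space M" using assms by (simp add: edge_variables_def)
  then show ?thesis
    using assms c_pos c_le walk_weights_axioms by (intro edge_model.intro edge_model_axioms.intro)
qed

text \<open>The sandwich is stated for arbitrary probability spaces since it serves twice: for the
  given edge variables, and for the canonical model in which the cumulants are defined.\<close>

lemma variance_ratio_limit:
  fixes M :: "nat \<Rightarrow> 'w measure"
  assumes ev: "\<And>k. edge_variables (M k) \<psi> (n k) (c k) (R k) (a k)"
    and b: "\<And>k. 0 < b k" and lim: "(\<lambda>k. total 2 q k / b k) \<longlonglongrightarrow> v"
  shows "(\<lambda>k. prob_space.variance (M k) (\<lambda>\<omega>. Y \<alpha> q \<psi> (n k) (R k) (\<lambda>i j. a k i j \<omega>)) / b k) \<longlonglongrightarrow> v"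
    (is "(\<lambda>k. ?Var k / b k) \<longlonglongrightarrow> v")
proof (rule tendsto_sandwich[where f = "\<lambda>k. (1 - c k / N k) * (total 2 q k / b k)" and h = "\<lambda>k. total 2 q k / b k"])
  have "(1 - c k / N k) * total 2 q k \<le> ?Var k
    \<and> ?Var k \<le> total 2 q k" for k
  proof -
    interpret E: edge_model \<psi> \<alpha> "M k" "n k" q "c k" "R k" "a k" by (rule edge_modelI[OF ev])
    show ?thesis using E.variance_bounds unfolding E.Yv_def[abs_def] E.pattern_total_def by simp
  qed
  note * = conjunct1[OF this] conjunct2[OF this]
  show "\<forall>\<^sub>F k in sequentially. (1 - c k / N k) * (total 2 q k / b k) \<le> ?Var k / b k"
  proof (intro always_eventually allI)
    fix k
    show "(1 - c k / N k) * (total 2 q k / b k) \<le> ?Var k / b k"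
      using divide_right_mono[OF *(1)[of k], of "b k"] b[of k] by simp
  qed
  show "\<forall>\<^sub>F k in sequentially. ?Var k / b k \<le> total 2 q k / b k"
  proof (intro always_eventually allI)
    fix k
    show "?Var k / b k \<le> total 2 q k / b k"
      using divide_right_mono[OF *(2)[of k], of "b k"] b[of k] by simp
  qed
  have "(\<lambda>k. (1 - c k / N k) * (total 2 q k / b k)) \<longlonglongrightarrow> (1 - 0) * v"
    by (intro tendsto_intros cN_lim lim)
  then show "(\<lambda>k. (1 - c k / N k) * (total 2 q k / b k)) \<longlonglongrightarrow> v" by simp
qed (rule lim)

text \<open>By Levy's continuity theorem it suffices to compare characteristic functions. The Stein
  error is a multiple of the triple total over \<open>sqrt (b k) ^ 3\<close>, and the comparison
  Gaussian follows the variance ratio to its limit.\<close>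

lemma convergence_to_normal:
  fixes M :: "nat \<Rightarrow> 'w measure"
  assumes ev: "\<And>k. edge_variables (M k) \<psi> (n k) (c k) (R k) (a k)"
    and b: "\<And>k. 0 < b k" and v: "0 < v" and lim2: "(\<lambda>k. total 2 q k / b k) \<longlonglongrightarrow> v"
    and lim3: "(\<lambda>k. total 3 q k / sqrt (b k) ^ 3) \<longlonglongrightarrow> 0"
  shows "converges_to_centered_normal M (\<lambda>k \<omega>. Y \<alpha> q \<psi> (n k) (R k) (\<lambda>i j. a k i j \<omega>)) b v"
  unfolding converges_to_centered_normal_def
proof (rule levy_continuity)
  let ?X = "\<lambda>k \<omega>. Y \<alpha> q \<psi> (n k) (R k) (\<lambda>i j. a k i j \<omega>)"
  let ?Z = "\<lambda>k \<omega>. (?X k \<omega> - prob_space.expectation (M k) (?X k)) / sqrt (b k)"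
  let ?\<sigma> = "\<lambda>k. prob_space.variance (M k) (?X k) / b k"
  have meas: "?Z k \<in> borel_measurable (M k)" for k
  proof -
    interpret E: edge_model \<psi> \<alpha> "M k" "n k" q "c k" "R k" "a k" by (rule edge_modelI[OF ev])
    have "?X k \<in> borel_measurable (M k)" using bounded_rvD[OF E.bounded_rv_Yv] unfolding E.Yv_def[abs_def] .
    then show ?thesis by measurable
  qed
  show "real_distribution (distr (M k) borel (?Z k))" for k
  proof -
    interpret E: edge_model \<psi> \<alpha> "M k" "n k" q "c k" "R k" "a k" by (rule edge_modelI[OF ev])
    show ?thesis using meas[of k] by (rule E.real_distribution_distr)
  qed
  show "real_distribution (centered_normal v)" by (rule real_distribution_centered_normal[OF v])
  fix t
  have bound: "cmod (char (distr (M k) borel (?Z k)) t - exp (- of_real (?\<sigma> k * t\<^sup>2 / 2))) \<le> \<bar>t\<bar> ^ 3 * (16 * (total 3 q k / sqrt (b k) ^ 3))" for k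
  proof -
    interpret E: edge_model \<psi> \<alpha> "M k" "n k" q "c k" "R k" "a k" by (rule edge_modelI[OF ev])
    have "char (distr (M k) borel (?Z k)) t = E.expectation (\<lambda>\<omega>. iexp (t * ?Z k \<omega>))"
      unfolding char_def by (rule integral_distr[OF meas]) measurable
    moreover have "0 < sqrt (b k)" "(sqrt (b k))\<^sup>2 = b k" using b[of k] by auto
    ultimately show ?thesis
      using E.char_Yv_bound[of "sqrt (b k)" t] unfolding E.Yv_def[abs_def] E.pattern_total_def by simp
  qed
  have "(\<lambda>k. char (distr (M k) borel (?Z k)) t - exp (- of_real (?\<sigma> k * t\<^sup>2 / 2))) \<longlonglongrightarrow> 0"
  proof (rule Lim_null_comparison[OF always_eventually[OF allI[OF bound]]])
    have "(\<lambda>k. \<bar>t\<bar> ^ 3 * (16 * (total 3 q k / sqrt (b k) ^ 3))) \<longlonglongrightarrow> \<bar>t\<bar> ^ 3 * (16 * 0)"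
      by (intro tendsto_mult tendsto_const lim3)
    then show "(\<lambda>k. \<bar>t\<bar> ^ 3 * (16 * (total 3 q k / sqrt (b k) ^ 3))) \<longlonglongrightarrow> 0" by simp
  qed
  moreover have "(\<lambda>k. exp (- complex_of_real (?\<sigma> k * t\<^sup>2 / 2))) \<longlonglongrightarrow> exp (- complex_of_real (v * t\<^sup>2 / 2))"
    by (intro tendsto_exp tendsto_minus tendsto_of_real tendsto_divide tendsto_mult tendsto_const variance_ratio_limit[OF ev b lim2]) simp
  ultimately have "(\<lambda>k. char (distr (M k) borel (?Z k)) t - exp (- of_real (?\<sigma> k * t\<^sup>2 / 2)) + exp (- of_real (?\<sigma> k * t\<^sup>2 / 2))) \<longlonglongrightarrow> 0 + exp (- complex_of_real (v * t\<^sup>2 / 2))"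
    by (rule tendsto_add)
  then show "(\<lambda>k. char (distr (M k) borel (?Z k)) t) \<longlonglongrightarrow> char (centered_normal v) t"
    unfolding char_centered_normal[OF v] by simp
qed

text \<open>For each \<open>k\<close> the triple bound is governed by its smaller or its larger
  power of \<open>D\<close>, according to whether \<open>D k\<close> is at most 1. In either case
  its square times \<open>c k * R k\<close> is the cube of the corresponding pair order, hence at
  most a constant times \<open>b k ^ 3\<close>, and a square root leaves the factor
  \<open>1 / sqrt (c k * R k)\<close>. The constant \<open>B\<close> absorbs the difference between
  the pair order and the chosen normalisation.\<close>

lemma triples_negligible:
  assumes q: "1 \<le> q" and b: "\<And>k. 0 < b k"
    and ev: "\<forall>\<^sub>F k in sequentially. (D k \<le> 1 \<longrightarrow> N k * D k \<le> B * b k) \<and> (1 < D k \<longrightarrow> N k * D k ^ (2 * q - 1) \<le> B * b k)"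
  shows "(\<lambda>k. total 3 q k / sqrt (b k) ^ 3) \<longlonglongrightarrow> 0"
proof -
  obtain C where C: "0 \<le> C" "\<And>k. total 3 q k \<le> C * (N k * (D k + D k ^ (3 * q - 2)))"
    using total_triples_bound[OF q] by blast
  have main: "norm (total 3 q k / sqrt (b k) ^ 3) \<le> 2 * C * sqrt B ^ 3 * (1 / sqrt (c k * R k))"
    if Bk: "(D k \<le> 1 \<longrightarrow> N k * D k \<le> B * b k) \<and> (1 < D k \<longrightarrow> N k * D k ^ (2 * q - 1) \<le> B * b k)" for k
  proof -
    note B = Bk[THEN conjunct1, rule_format] Bk[THEN conjunct2, rule_format]
    have pos: "0 < N k" "0 < D k" "0 < b k" using D_pos[of k] dim_N_pos[of "n k"] b[of k] by auto
    have ND: "N k * D k = c k * R k" using pos(1) by simp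
    have tn: "0 \<le> total 3 q k" using c_pos by (intro sum_nonneg pattern_sum_nonneg) (simp add: less_imp_le)
    \<comment> \<open>\<open>x\<close> is the dominant one of the two triple terms, N D or N D to
      the power 3q - 2.\<close>
    obtain x where x: "0 < x" "N k * (D k + D k ^ (3 * q - 2)) \<le> 2 * x" "x\<^sup>2 * (c k * R k) \<le> (B * b k) ^ 3"
    proof (cases "D k \<le> 1")
      case True
      have le: "D k ^ (3 * q - 2) \<le> D k" using power_decreasing[of 1 "3 * q - 2" "D k"] True pos q by simp
      have 1: "N k * (D k + D k ^ (3 * q - 2)) \<le> 2 * (N k * D k)"
        unfolding mult_2 distrib_left by (rule add_left_mono[OF mult_left_mono[OF le less_imp_le[OF pos(1)]]])
      have "(N k * D k)\<^sup>2 * (c k * R k) = (N k * D k) ^ 3" unfolding ND by (simp add: power2_eq_square power3_eq_cube)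
      also have "\<dots> \<le> (B * b k) ^ 3" using B(1)[OF True] pos by (intro power_mono mult_nonneg_nonneg) auto
      finally have 3: "(N k * D k)\<^sup>2 * (c k * R k) \<le> (B * b k) ^ 3" .
      show ?thesis by (rule that[OF mult_pos_pos[OF pos(1,2)] 1 3])
    next
      case False
      then have D1: "1 < D k" by simp
      have le: "D k \<le> D k ^ (3 * q - 2)" using power_increasing[of 1 "3 * q - 2" "D k"] D1 q by simp
      have 1: "N k * (D k + D k ^ (3 * q - 2)) \<le> 2 * (N k * D k ^ (3 * q - 2))"
        unfolding mult_2 distrib_left by (rule add_right_mono[OF mult_left_mono[OF le less_imp_le[OF pos(1)]]])
      \<comment> \<open>The exponent identity that matches the densest triples with the densest
        pairs; the additional 1 comes from \<open>c k * R k = N k * D k\<close>.\<close>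
      have e: "(3 * q - 2) * 2 + 1 = (2 * q - 1) * 3" using q by simp
      have "(N k * D k ^ (3 * q - 2))\<^sup>2 * (c k * R k) = N k ^ 3 * (D k ^ ((3 * q - 2) * 2) * D k)"
        using power_square_cube[of "N k" "D k" "3 * q - 2"] unfolding ND .
      also have "D k ^ ((3 * q - 2) * 2) * D k = D k ^ ((3 * q - 2) * 2 + 1)" by (simp only: power_add power_one_right)
      also have "\<dots> = (D k ^ (2 * q - 1)) ^ 3" unfolding e power_mult ..
      also have "N k ^ 3 * (D k ^ (2 * q - 1)) ^ 3 = (N k * D k ^ (2 * q - 1)) ^ 3" by (simp only: power_mult_distrib)
      also have "\<dots> \<le> (B * b k) ^ 3" using B(2)[OF D1] pos by (intro power_mono mult_nonneg_nonneg zero_le_power) auto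
      finally have 3: "(N k * D k ^ (3 * q - 2))\<^sup>2 * (c k * R k) \<le> (B * b k) ^ 3" .
      show ?thesis by (rule that[OF mult_pos_pos[OF pos(1) zero_less_power[OF pos(2)]] 1 3])
    qed
    have cR: "0 < c k * R k" using c_pos R_pos by simp
    have "sqrt (x\<^sup>2 * (c k * R k)) \<le> sqrt ((B * b k) ^ 3)" using x(3) by (rule real_sqrt_le_mono)
    then have y: "x * sqrt (c k * R k) \<le> sqrt B ^ 3 * sqrt (b k) ^ 3"
      using x(1) by (simp add: real_sqrt_mult real_sqrt_power power_mult_distrib)
    have "total 3 q k \<le> C * (2 * x)" using C(2)[of k] x(2) C(1) by (meson mult_left_mono order_trans)
    also have "\<dots> = 2 * C * x" by simp
    also have "\<dots> \<le> 2 * C * (sqrt B ^ 3 * sqrt (b k) ^ 3 / sqrt (c k * R k))"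
      using y cR C(1) by (intro mult_left_mono) (auto simp: pos_le_divide_eq)
    finally have "total 3 q k / sqrt (b k) ^ 3 \<le> 2 * C * (sqrt B ^ 3 * sqrt (b k) ^ 3 / sqrt (c k * R k)) / sqrt (b k) ^ 3"
      using pos by (intro divide_right_mono) auto
    also have "\<dots> = 2 * C * sqrt B ^ 3 * (1 / sqrt (c k * R k))" using pos by simp
    finally show ?thesis using tn pos by simp
  qed
  show ?thesis
  proof (rule Lim_null_comparison[OF eventually_mono[OF ev main]])
    have "filterlim (\<lambda>k. sqrt (c k * R k)) at_top sequentially"
      by (rule filterlim_compose[OF sqrt_at_top cR_lim])
    then have "(\<lambda>k. 1 / sqrt (c k * R k)) \<longlonglongrightarrow> 0"
      by (intro tendsto_divide_0[OF tendsto_const] filterlim_at_top_imp_at_infinity)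
    then have "(\<lambda>k. 2 * C * sqrt B ^ 3 * (1 / sqrt (c k * R k))) \<longlonglongrightarrow> 2 * C * sqrt B ^ 3 * 0"
      by (intro tendsto_mult tendsto_const)
    then show "(\<lambda>k. 2 * C * sqrt B ^ 3 * (1 / sqrt (c k * R k))) \<longlonglongrightarrow> 0" by simp
  qed
qed

end

section \<open>Evaluation of the limiting second cumulants\<close>

text \<open>Without such a transition the condition defining \<open>Cum2_limit\<close> would hold
  vacuously for every number, and uniqueness would fail. The symmetric choice, with \<open>c\<close>
  and \<open>R\<close> both equal to the square root of s N, tends to infinity and is o(N).\<close>

lemma limiting_transition_exists:
  assumes s: "0 < s"
  shows "\<exists>n c R. limiting_transition n c R \<and> (\<forall>k. c k * R k / real (dim_N (n k)) = s)"
proof -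
  \<comment> \<open>The shift by the ceiling of \<open>s\<close> ensures \<open>s \<le> N k\<close>
    for every \<open>k\<close>, which is what \<open>c k \<le> N k\<close> requires.\<close>
  define n where "n k = k + nat \<lceil>s\<rceil>" for k
  define N where "N k = real (dim_N (n k))" for k
  define c where "c k = sqrt (s * N k)" for k
  have Npos: "0 < N k" for k by (simp add: N_def dim_N_def)
  have sN: "s \<le> N k" for k
  proof -
    have "s \<le> real (nat \<lceil>s\<rceil>)" using s by linarith
    also have "\<dots> \<le> N k" by (simp add: N_def dim_N_def n_def)
    finally show ?thesis .
  qed
  have nlim: "filterlim n at_top sequentially"
    by (rule filterlim_at_top_mono[OF filterlim_ident]) (simp add: n_def)
  have Nlim: "filterlim N at_top sequentially"
    by (rule filterlim_at_top_mono[OF filterlim_compose[OF filterlim_real_sequentially nlim]]) (simp add: N_def dim_N_def)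
  have clim: "filterlim c at_top sequentially"
    unfolding c_def by (intro filterlim_compose[OF sqrt_at_top] filterlim_tendsto_pos_mult_at_top[OF tendsto_const s Nlim])
  have cpos: "0 < c k" for k using s Npos[of k] by (simp add: c_def)
  have cle: "c k \<le> N k" for k
  proof -
    have "s * N k \<le> (N k)\<^sup>2" using sN[of k] Npos[of k] by (simp add: power2_eq_square)
    then show ?thesis unfolding c_def using Npos[of k] by (intro real_le_lsqrt) auto
  qed
  have small: "c \<in> o(N)"
  proof (rule smalloI_tendsto)
    have "c k / N k = sqrt s * (1 / sqrt (N k))" for k
      using Npos[of k] by (simp add: c_def real_sqrt_mult field_simps)
    moreover have "(\<lambda>k. sqrt s * (1 / sqrt (N k))) \<longlonglongrightarrow> sqrt s * 0"
      by (intro tendsto_mult tendsto_const tendsto_divide_0[OF tendsto_const] filterlim_at_top_imp_at_infinity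
          filterlim_compose[OF sqrt_at_top Nlim])
    ultimately show "(\<lambda>k. c k / N k) \<longlonglongrightarrow> 0" by simp
    show "\<forall>\<^sub>F k in sequentially. N k \<noteq> 0" using Npos by (intro always_eventually allI) (simp add: less_imp_neq[symmetric])
  qed
  have "limiting_transition n c c"
    unfolding limiting_transition_def N_def[symmetric] using nlim clim cpos cle small by (simp add: N_def[abs_def])
  moreover have "c k * c k / real (dim_N (n k)) = s" for k
    using Npos[of k] s by (simp add: c_def N_def[symmetric])
  ultimately show ?thesis by blast
qed

lemma (in walk_limit) Cum2_Y_limit:
  assumes q: "1 \<le> q" and D: "\<And>k. D k = s"
  shows "(\<lambda>k. Cum2_Y \<alpha> q \<psi> (n k) (c k) (R k) / (c k * R k)) \<longlonglongrightarrow> variance_limit \<alpha> q \<psi> s"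
  unfolding Cum2_Y_def
proof (rule variance_ratio_limit)
  show "edge_variables (measure_pmf (edge_pmf \<psi> (n k) (c k) (R k))) \<psi> (n k) (c k) (R k) (\<lambda>i j g. of_bool (g (i, j)))" for k
    by (rule edge_variables_edge_pmf[OF c_pos c_le])
  have "N k * D k ^ 1 = c k * R k" for k using dim_N_pos[of "n k"] by simp
  then show "(\<lambda>k. total 2 q k / (c k * R k)) \<longlonglongrightarrow> variance_limit \<alpha> q \<psi> s"
    using total_pairs_critical[OF q D] by (simp only:)
  show "0 < c k * R k" for k using c_pos R_pos by simp
qed

text \<open>The critical asymptotics apply to every transition with ratio \<open>s\<close>, which
  gives existence; evaluating a competing limit along one such transition gives uniqueness.\<close>

lemma (in walk_weights) Cum2_limit_eq:
  assumes q: "1 \<le> q" and s: "0 < s"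
  shows "Cum2_limit \<alpha> q \<psi> s = variance_limit \<alpha> q \<psi> s"
  unfolding Cum2_limit_def
proof (rule the_equality)
  have lim: "(\<lambda>k. Cum2_Y \<alpha> q \<psi> (n k) (c k) (R k) / (c k * R k)) \<longlonglongrightarrow> variance_limit \<alpha> q \<psi> s"
    if t: "limiting_transition n c R" and D: "\<forall>k. c k * R k / real (dim_N (n k)) = s" for n c R
  proof -
    interpret L: walk_limit \<psi> \<alpha> n c R by unfold_locales (rule t)
    show ?thesis by (rule L.Cum2_Y_limit[OF q spec[OF D]])
  qed
  then show "\<forall>n c R. limiting_transition n c R \<longrightarrow> (\<forall>k. c k * R k / real (dim_N (n k)) = s) \<longrightarrow>
      (\<lambda>k. Cum2_Y \<alpha> q \<psi> (n k) (c k) (R k) / (c k * R k)) \<longlonglongrightarrow> variance_limit \<alpha> q \<psi> s"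
    by (intro allI impI)
  fix K assume K: "\<forall>n c R. limiting_transition n c R \<longrightarrow> (\<forall>k. c k * R k / real (dim_N (n k)) = s) \<longrightarrow>
      (\<lambda>k. Cum2_Y \<alpha> q \<psi> (n k) (c k) (R k) / (c k * R k)) \<longlonglongrightarrow> K"
  obtain n c R where t: "limiting_transition n c R" "\<forall>k. c k * R k / real (dim_N (n k)) = s"
    using limiting_transition_exists[OF s] by (elim exE conjE)
  show "K = variance_limit \<alpha> q \<psi> s"
    by (rule LIMSEQ_unique[OF K[rule_format, OF t(1) spec[OF t(2)]] lim[OF t]])
qed

theorem theorem6p1:
  fixes \<psi> :: "real \<Rightarrow> real"
    and q \<alpha> :: nat
    and n :: "nat \<Rightarrow> nat"
    and c R :: "nat \<Rightarrow> real"
    and M :: "nat \<Rightarrow> 'w measure"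
    and a :: "nat \<Rightarrow> int \<Rightarrow> int \<Rightarrow> 'w \<Rightarrow> real"
  assumes psi_even: "\<And>x. \<psi> (- x) = \<psi> x"
    and psi_cont: "continuous_on UNIV \<psi>"
    and psi_pos: "\<And>x. \<psi> x > 0"
    and psi_mono: "mono_on {0..} \<psi>"
    and psi_int: "\<And>m. integrable lborel (\<lambda>t. (1 + (\<psi> t)\<^sup>2) ^ m * exp (- (\<psi> t)\<^sup>2))"
    and q: "q \<ge> 1"
    and alpha: "\<alpha> \<in> {0, 1}"
    and trans: "limiting_transition n c R"
    and edge_vars: "\<And>k. edge_variables (M k) \<psi> (n k) (c k) (R k) (a k)"
  shows "let N = (\<lambda>k. real (dim_N (n k)));
             X = (\<lambda>k \<omega>. Y \<alpha> q \<psi> (n k) (R k) (\<lambda>i j. a k i j \<omega>))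
         in
           (filterlim (\<lambda>k. c k * R k / N k) at_top sequentially \<longrightarrow>
              converges_to_centered_normal M X
                (\<lambda>k. (c k * R k) ^ (2 * q - 1) / N k ^ (2 * q - 2))
                (if \<alpha> = 0 then 2 * (real q)\<^sup>2 * V \<psi> 0 ^ (2 * q - 1)
                 else 2 * (real q)\<^sup>2 * V \<psi> 1 ^ (2 * q - 2) * V \<psi> 2)) \<and>
           (\<forall>s > 0. (\<forall>k. c k * R k = s * N k) \<longrightarrow>
              converges_to_centered_normal M X
                (\<lambda>k. c k * R k)
                (if \<alpha> = 0 then Phi2 q \<psi> s else Xi2 q \<psi> s)) \<and>
           ((\<lambda>k. c k * R k / N k) \<longlonglongrightarrow> 0 \<longrightarrow>
              converges_to_centered_normal M X
                (\<lambda>k. c k * R k)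
                (if \<alpha> = 0 then 2 * V \<psi> 0 else 2 * V \<psi> (2 * q)))"
proof -
  interpret walk_limit \<psi> \<alpha> n c R
    by unfold_locales (use assms in \<open>simp_all add: profile_def[abs_def]\<close>)
  let ?X = "\<lambda>k \<omega>. Y \<alpha> q \<psi> (n k) (R k) (\<lambda>i j. a k i j \<omega>)"
  have cR: "N k * D k ^ 1 = c k * R k" for k using dim_N_pos[of "n k"] by simp
  have cR_pos: "0 < c k * R k" for k using c_pos R_pos by simp
  have al: "\<alpha> = 0 \<or> \<alpha> = 1" using alpha by simp
  have dense: "converges_to_centered_normal M ?X (\<lambda>k. (c k * R k) ^ (2 * q - 1) / N k ^ (2 * q - 2))
      (2 * (real q)\<^sup>2 * W 1 ^ (2 * q - 2) * W 2)" if D: "filterlim D at_top sequentially"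
  proof -
    \<comment> \<open>Expressed through \<open>D\<close>, the dense normalisation is the order of
      the largest pair patterns.\<close>
    have b: "(c k * R k) ^ (2 * q - 1) / N k ^ (2 * q - 2) = N k * D k ^ (2 * q - 1)" for k
    proof -
      have "2 * q - 1 = Suc (2 * q - 2)" using q by simp
      then have "N k ^ (2 * q - 1) = N k * N k ^ (2 * q - 2)" by (simp only: power_Suc)
      then show ?thesis using dim_N_pos[of "n k"] by (simp add: power_divide)
    qed
    have pos: "0 < N k * D k ^ (2 * q - 1)" for k
      by (intro mult_pos_pos zero_less_power D_pos dim_N_pos)
    have v: "0 < 2 * (real q)\<^sup>2 * W 1 ^ (2 * q - 2) * W 2"
      using q by (intro mult_pos_pos zero_less_power W_pos) auto
    have ev: "\<forall>\<^sub>F k in sequentially. (D k \<le> 1 \<longrightarrow> N k * D k \<le> 1 * (N k * D k ^ (2 * q - 1))) \<and>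
        (1 < D k \<longrightarrow> N k * D k ^ (2 * q - 1) \<le> 1 * (N k * D k ^ (2 * q - 1)))"
      using filterlim_at_top_dense[THEN iffD1, OF D, rule_format, of 1] by (rule eventually_mono) simp
    show ?thesis unfolding b
      by (rule convergence_to_normal[OF edge_vars pos v total_pairs_dense[OF q D] triples_negligible[OF q pos ev]])
  qed
  have critical: "converges_to_centered_normal M ?X (\<lambda>k. c k * R k) (Cum2_limit \<alpha> q \<psi> s)"
    if s: "0 < s" and D: "\<And>k. D k = s" for s
  proof -
    have lim: "(\<lambda>k. total 2 q k / (c k * R k)) \<longlonglongrightarrow> Cum2_limit \<alpha> q \<psi> s"
      using total_pairs_critical[OF q D] unfolding cR Cum2_limit_eq[OF q s] .
    have v: "0 < Cum2_limit \<alpha> q \<psi> s" unfolding Cum2_limit_eq[OF q s] by (rule variance_limit_pos[OF q s])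
    \<comment> \<open>With \<open>D\<close> constantly \<open>s\<close>, the larger pair order is
      \<open>s ^ (2 * q - 2)\<close> times \<open>c k * R k\<close>; adding 1 gives a constant that
      covers both sides of \<open>D k = 1\<close>.\<close>
    have ev: "\<forall>\<^sub>F k in sequentially. (D k \<le> 1 \<longrightarrow> N k * D k \<le> (1 + s ^ (2 * q - 2)) * (c k * R k)) \<and>
        (1 < D k \<longrightarrow> N k * D k ^ (2 * q - 1) \<le> (1 + s ^ (2 * q - 2)) * (c k * R k))"
    proof (intro always_eventually allI conjI impI)
      fix k
      have Ns: "c k * R k = N k * s" using cR[of k] unfolding D by simp
      have "2 * q - 1 = Suc (2 * q - 2)" using q by simp
      then have p: "s ^ (2 * q - 1) = s * s ^ (2 * q - 2)" by (simp only: power_Suc)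
      have "0 \<le> N k * s" "0 \<le> s ^ (2 * q - 2)" using s by simp_all
      then have le: "1 * (N k * s) \<le> (1 + s ^ (2 * q - 2)) * (N k * s)"
        "s ^ (2 * q - 2) * (N k * s) \<le> (1 + s ^ (2 * q - 2)) * (N k * s)"
        by (intro mult_right_mono; simp)+
      show "N k * D k \<le> (1 + s ^ (2 * q - 2)) * (c k * R k)"
        unfolding D unfolding Ns using le(1) by (simp only: mult_1)
      show "N k * D k ^ (2 * q - 1) \<le> (1 + s ^ (2 * q - 2)) * (c k * R k)"
        unfolding D p unfolding Ns using le(2) by (simp only: mult_ac)
    qed
    show ?thesis
      by (rule convergence_to_normal[OF edge_vars cR_pos v lim triples_negligible[OF q cR_pos ev]])
  qed
  have sparse: "converges_to_centered_normal M ?X (\<lambda>k. c k * R k) (2 * W (2 * q))" if D: "D \<longlonglongrightarrow> 0"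
  proof -
    have lim: "(\<lambda>k. total 2 q k / (c k * R k)) \<longlonglongrightarrow> 2 * W (2 * q)"
      using total_pairs_sparse[OF q D] unfolding cR .
    have v: "0 < 2 * W (2 * q)" using W_pos by simp
    have "\<forall>\<^sub>F k in sequentially. D k < 1" by (rule order_tendstoD(2)[OF D]) simp
    then have ev: "\<forall>\<^sub>F k in sequentially. (D k \<le> 1 \<longrightarrow> N k * D k \<le> 1 * (c k * R k)) \<and>
        (1 < D k \<longrightarrow> N k * D k ^ (2 * q - 1) \<le> 1 * (c k * R k))"
    proof (rule eventually_mono)
      fix k assume "D k < 1"
      moreover have "N k * D k = c k * R k" using cR[of k] by (simp only: power_one_right)
      ultimately show "(D k \<le> 1 \<longrightarrow> N k * D k \<le> 1 * (c k * R k)) \<and> (1 < D k \<longrightarrow> N k * D k ^ (2 * q - 1) \<le> 1 * (c k * R k))"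
        by (simp only: mult_1 order_refl) simp
    qed
    show ?thesis
      by (rule convergence_to_normal[OF edge_vars cR_pos v lim triples_negligible[OF q cR_pos ev]])
  qed
  \<comment> \<open>For \<alpha> = 0 all moments \<open>W m\<close> coincide with
    \<open>V \<psi> 0\<close>, so the last factor merges into the power 2q - 1.\<close>
  have e1: "(if \<alpha> = 0 then 2 * (real q)\<^sup>2 * V \<psi> 0 ^ (2 * q - 1) else 2 * (real q)\<^sup>2 * V \<psi> 1 ^ (2 * q - 2) * V \<psi> 2) =
      2 * (real q)\<^sup>2 * W 1 ^ (2 * q - 2) * W 2"
  proof -
    have "2 * q - 1 = Suc (2 * q - 2)" using q by simp
    then have "V \<psi> 0 ^ (2 * q - 1) = V \<psi> 0 ^ (2 * q - 2) * V \<psi> 0" by (simp only: power_Suc2)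
    then show ?thesis using al by auto
  qed
  have e2: "(if \<alpha> = 0 then Phi2 q \<psi> s else Xi2 q \<psi> s) = Cum2_limit \<alpha> q \<psi> s" for s
    using al by (auto simp: Phi2_def Xi2_def)
  have e3: "(if \<alpha> = 0 then 2 * V \<psi> 0 else 2 * V \<psi> (2 * q)) = 2 * W (2 * q)"
    using al by auto
  have crit_D: "D k = s" if "\<forall>k. c k * R k = s * N k" for s k
    using that dim_N_pos[of "n k"] by simp
  show ?thesis unfolding Let_def e1 e2 e3
    using dense critical[OF _ crit_D] sparse by blast
qed

end
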